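(* Any (generic) fundamental point-circle complex $(\mathsf p,\mathsf c)$ may be interpreted as a fundamental circle complex by prescribing the orientation of the circles associated with one-dimensional Cauchy data, the orientation of the remaining circles being determined by correlation. That is, let $w\in A_2^{-1}$, $u=w+e_1+e_2+e_3$, $f_1=e_1-e_2$, $f_2=e_2-e_3$, $f_3=e_3-e_1$, and let $\Sigma\subset A_2^0$ be the union of $\{w+e_3+if_1+jf_2\}$, $\{w+e_1+if_2+jf_3\}$, $\{w+e_2+if_3+jf_1\}$ with integers $i,j\geq0$, $\min(i,j)\le1$. Let the circles $\mathsf c(v)$ for which $v\in A_2^{1}\cup A_2^{-1}$ and all three neighbours of $v$ in $A_2^0$ lie in $\Sigma$ be given arbitrary orientations, except that the orientation of $\mathsf c(w)$ is the one for which $\mathsf c(w)$ is correlated to $\mathsf p(u)$. Then there is a unique choice of orientation of all remaining circles such that the points $\mathsf p$ (regarded as Lie circles of zero radius) and the oriented circles $\mathsf c$ form a fundamental circle complex on $\mathbb Z^3$; this orientation is determined by the requirement that opposite members of each elementary cube be correlated.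
   Context: $e_1,e_2,e_3$ is the standard basis of $\mathbb Z^3$; $A_2^k=\{n\in\mathbb Z^3:n_1+n_2+n_3=k\}$. A fundamental point-circle complex is a pair of maps $\mathsf p$ from the even sublattice ($n_1+n_2+n_3$ even) to points of $\mathbb R^2$ and $\mathsf c$ from the odd sublattice to non-oriented circles of $\mathbb R^2$ such that the point and circle attached to the endpoints of any edge of $\mathbb Z^3$ are incident. Oriented (Lie) circles: the points $[V]$, $V=(x,y,a,b,r)$, of the Lie quadric $\langle V,V\rangle=0$ in $\mathbb{RP}^4$, with $\langle V,V'\rangle=xx'+yy'-\tfrac12(ab'+a'b)-rr'$: $(x,y,1,x^2+y^2-r^2,r)$ is the oriented circle of centre $(x,y)$ and signed radius $r\ne0$, or the point $(x,y)$ if $r=0$; $(v,w,0,2d,1)$, $v^2+w^2=1$, is an oriented line; $(0,0,0,1,0)$ the point at infinity. Orientation of a circle is the sign of $r$. Lie circles touch iff $\langle V,V'\rangle=0$; a point touches an oriented circle iff it lies on it. With Plücker coordinates $\gamma^{\mu\nu}=\alpha^\mu\beta^\nu-\alpha^\nu\beta^\mu$ of the line in $\mathbb{RP}^3$ through points $\alpha,\beta$, the lines of the linear line complex $\mathcal L=\{\gamma^{03}=\gamma^{12}\}$ are the points $(\gamma^{01},\gamma^{23},\gamma^{02},\gamma^{13},\gamma^{03})$ of the quadric $2\gamma^{01}\gamma^{23}-2\gamma^{02}\gamma^{13}+2(\gamma^{03})^2=0$ of signature $(3,2)$; a fixed linear isometry identifies it with the Lie quadric, so that lines of $\mathcal L$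 correspond to Lie circles, intersecting lines to touching circles. A map from $\mathbb Z^3$ to Lie circles is a fundamental circle complex if the corresponding lines $\mathsf l:\mathbb Z^3\to\mathcal L$ satisfy: neighbouring lines $\mathsf l,\mathsf l_l$ intersect, in points $\mathsf p^l$, and for distinct $l,m,p$ the points $\mathsf p^l,\mathsf p^l_m,\mathsf p^l_{mp},\mathsf p^l_p$ are coplanar (lower indices are unit shifts). Correlated: a hexagon $x^1,\dots,x^6$ in $\mathbb{RP}^3$ in general position (indices mod 6) has a unique associated correlation $\kappa(x)=\{y:y^TBx=0\}$, $B=B^T$ invertible, with $\kappa(x^i)=\pi^{i+3}$, where $\pi^i$ is the plane through $x^{i-1},x^i,x^{i+1}$; the image of a line is the intersection of the images of its points. Two Lie circles at opposite vertices of an elementary cube of eight Lie circles touching along edges are correlated if the corresponding lines are images of each other under the correlation associated with the hexagon formed by the six remaining lines in cyclic order. All configurations are assumed generic, so that these hexagons are in general position and points and circles attached to nearby vertices are pairwise distinct. *)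

theory Defs
  imports "HOL-Analysis.Analysis"
begin

section \<open>The lattice\<close>

definition unit_shift :: "3 \<Rightarrow> int^3" where
  "unit_shift l = axis l 1"

definition level :: "int^3 \<Rightarrow> int" where
  "level n = n$1 + n$2 + n$3"

definition A2 :: "int \<Rightarrow> (int^3) set" where
  "A2 k = {n. level n = k}"

definition even_lattice :: "(int^3) set" where
  "even_lattice = {n. even (level n)}"

definition odd_lattice :: "(int^3) set" where
  "odd_lattice = {n. odd (level n)}"

definition neighbours :: "int^3 \<Rightarrow> int^3 \<Rightarrow> bool" where
  "neighbours n m \<longleftrightarrow> (\<exists>l. m = n + unit_shift l \<or> n = m + unit_shift l)"

section \<open>Fundamental point-circle complexes\<close>

text \<open>A non-oriented circle of the plane is given by its centre and its radius, which has to be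
  positive. The maps are total functions; only the values of \<open>p\<close> on the even and of \<open>c\<close> on the odd
  sublattice matter.\<close>

type_synonym circle = "(real^2) \<times> real"

definition fundamental_point_circle_complex ::
  "(int^3 \<Rightarrow> real^2) \<Rightarrow> (int^3 \<Rightarrow> circle) \<Rightarrow> bool" where
  "fundamental_point_circle_complex p c \<longleftrightarrow>
     (\<forall>v\<in>odd_lattice. 0 < snd (c v)) \<and>
     (\<forall>n\<in>even_lattice. \<forall>v\<in>odd_lattice.
        neighbours n v \<longrightarrow> p n \<in> sphere (fst (c v)) (snd (c v)))"

section \<open>Lie circles\<close>

text \<open>Points of a real projective space are represented by non-zero homogeneous coordinate vectors;
  all notions below are invariant under rescaling of the representatives. The homogeneous coordinates
  of a Lie circle are \<open>V = (x, y, a, b, r)\<close>.\<close>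

type_synonym vec5 = "real \<times> real \<times> real \<times> real \<times> real"

definition lie_form :: "vec5 \<Rightarrow> vec5 \<Rightarrow> real" where
  "lie_form = (\<lambda>(x, y, a, b, r) (x', y', a', b', r').
     x * x' + y * y' - (a * b' + a' * b) / 2 - r * r')"

definition lie_circle :: "vec5 \<Rightarrow> bool" where
  "lie_circle V \<longleftrightarrow> V \<noteq> 0 \<and> lie_form V V = 0"

text \<open>Centre \<open>z\<close> and signed radius \<open>r\<close>; the point \<open>z\<close> if \<open>r = 0\<close>.\<close>

definition oriented_circle :: "real^2 \<Rightarrow> real \<Rightarrow> vec5" where
  "oriented_circle z r = (z$1, z$2, 1, (z$1)\<^sup>2 + (z$2)\<^sup>2 - r\<^sup>2, r)"

text \<open>An orientation assigns to every odd vertex the sign of the signed radius. Orientations are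
  extensional functions, so that two of them are equal iff they agree on the odd sublattice.\<close>

definition orientations :: "(int^3 \<Rightarrow> real) set" where
  "orientations = odd_lattice \<rightarrow>\<^sub>E {-1, 1}"

definition as_lie_circles ::
  "(int^3 \<Rightarrow> real^2) \<Rightarrow> (int^3 \<Rightarrow> circle) \<Rightarrow> (int^3 \<Rightarrow> real) \<Rightarrow> int^3 \<Rightarrow> vec5" where
  "as_lie_circles p c \<sigma> n =
     (if n \<in> even_lattice then oriented_circle (p n) 0
      else oriented_circle (fst (c n)) (\<sigma> n * snd (c n)))"

section \<open>Lines of the linear line complex\<close>

text \<open>The homogeneous coordinates of projective 3-space carry the indices 0, 1, 2, 3 of the type
  \<open>4\<close>, that is, the residues modulo 4.\<close>

definition plucker :: "real^4 \<Rightarrow> real^4 \<Rightarrow> 4 \<Rightarrow> 4 \<Rightarrow> real" where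
  "plucker \<alpha> \<beta> \<mu> \<nu> = \<alpha>$\<mu> * \<beta>$\<nu> - \<alpha>$\<nu> * \<beta>$\<mu>"

text \<open>The point of the Pluecker quadric of the linear line complex; \<open>\<gamma>\<^sup>1\<^sup>2\<close> is omitted since it equals
  \<open>\<gamma>\<^sup>0\<^sup>3\<close> there.\<close>

definition complex_coords :: "real^4 \<Rightarrow> real^4 \<Rightarrow> vec5" where
  "complex_coords \<alpha> \<beta> =
     (plucker \<alpha> \<beta> 0 1, plucker \<alpha> \<beta> 2 3, plucker \<alpha> \<beta> 0 2, plucker \<alpha> \<beta> 1 3, plucker \<alpha> \<beta> 0 3)"

definition plucker_quadratic_form :: "vec5 \<Rightarrow> real" where
  "plucker_quadratic_form = (\<lambda>(g01, g23, g02, g13, g03).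
     2 * g01 * g23 - 2 * g02 * g13 + 2 * g03\<^sup>2)"

definition lie_plucker_isometry :: "(vec5 \<Rightarrow> vec5) \<Rightarrow> bool" where
  "lie_plucker_isometry \<Phi> \<longleftrightarrow>
     linear \<Phi> \<and> (\<forall>V. plucker_quadratic_form (\<Phi> V) = lie_form V V)"

lemma lie_plucker_isometry_exists: "\<exists>\<Phi>. lie_plucker_isometry \<Phi>"
proof -
  define \<Phi> :: "vec5 \<Rightarrow> vec5" where
    "\<Phi> = (\<lambda>(x, y, a, b, r). (a, - b / 2, y - r, - (y + r) / 2, x / sqrt 2))"
  have "linear \<Phi>"
    by (rule linearI) (auto simp: \<Phi>_def add_divide_distrib diff_divide_distrib algebra_simps)
  moreover have "plucker_quadratic_form (\<Phi> V) = lie_form V V" for V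
    by (cases V)
      (simp add: \<Phi>_def plucker_quadratic_form_def lie_form_def power_divide power2_eq_square
        field_simps)
  ultimately show ?thesis
    unfolding lie_plucker_isometry_def by blast
qed

text \<open>Subspaces of projective 3-space are represented by linear subspaces of the space of homogeneous
  coordinates. Every Lie circle \<open>V\<close> has a unique corresponding line: \<open>\<Phi> V\<close> satisfies the Pluecker
  relation and is non-zero, so that it determines the line through \<open>\<alpha>\<close> and \<open>\<beta>\<close>.\<close>

definition lie_line :: "(vec5 \<Rightarrow> vec5) \<Rightarrow> vec5 \<Rightarrow> (real^4) set" where
  "lie_line \<Phi> V = (THE l. \<exists>\<alpha> \<beta> k.
     l = span {\<alpha>, \<beta>} \<and> plucker \<alpha> \<beta> 0 3 = plucker \<alpha> \<beta> 1 2 \<and>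
     k \<noteq> 0 \<and> complex_coords \<alpha> \<beta> = k *\<^sub>R \<Phi> V)"

definition proj_coplanar :: "(real^4) set \<Rightarrow> bool" where
  "proj_coplanar S \<longleftrightarrow> (\<exists>h. h \<noteq> 0 \<and> (\<forall>y\<in>S. h \<bullet> y = 0))"

text \<open>\<open>P l n\<close> is the point of intersection of the lines at \<open>n\<close> and its neighbour in direction \<open>l\<close>.\<close>

definition fundamental_circle_complex ::
  "(vec5 \<Rightarrow> vec5) \<Rightarrow> (int^3 \<Rightarrow> vec5) \<Rightarrow> bool" where
  "fundamental_circle_complex \<Phi> V \<longleftrightarrow>
     (\<forall>n. lie_circle (V n)) \<and>
     (\<exists>P :: 3 \<Rightarrow> int^3 \<Rightarrow> real^4.
        (\<forall>l n. P l n \<noteq> 0 \<and>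
           lie_line \<Phi> (V n) \<inter> lie_line \<Phi> (V (n + unit_shift l)) = span {P l n}) \<and>
        (\<forall>l m q n. distinct [l, m, q] \<longrightarrow>
           proj_coplanar {P l n, P l (n + unit_shift m),
             P l (n + unit_shift m + unit_shift q), P l (n + unit_shift q)}))"

section \<open>Correlations\<close>

text \<open>Hexagons are indexed by the type \<open>6\<close> of residues modulo 6.\<close>

definition hexagon_vertices :: "(6 \<Rightarrow> (real^4) set) \<Rightarrow> (6 \<Rightarrow> real^4) \<Rightarrow> bool" where
  "hexagon_vertices L x \<longleftrightarrow> (\<forall>i. x i \<noteq> 0 \<and> L i \<inter> L (i + 1) = span {x i})"

definition general_position :: "(6 \<Rightarrow> real^4) \<Rightarrow> bool" where
  "general_position x \<longleftrightarrow> (\<forall>I. card I = 4 \<longrightarrow> \<not> proj_coplanar (x ` I))"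

definition hexagon_plane :: "(6 \<Rightarrow> real^4) \<Rightarrow> 6 \<Rightarrow> (real^4) set" where
  "hexagon_plane x i = span {x (i - 1), x i, x (i + 1)}"

definition correlation :: "real^4^4 \<Rightarrow> real^4 \<Rightarrow> (real^4) set" where
  "correlation B x = {y. y \<bullet> (B *v x) = 0}"

definition correlation_line :: "real^4^4 \<Rightarrow> (real^4) set \<Rightarrow> (real^4) set" where
  "correlation_line B l = (\<Inter>x\<in>l. correlation B x)"

definition associated_correlation :: "real^4^4 \<Rightarrow> (6 \<Rightarrow> real^4) \<Rightarrow> bool" where
  "associated_correlation B x \<longleftrightarrow> transpose B = B \<and> invertible B \<and>
     (\<forall>i. correlation B (x i) = hexagon_plane x (i + 3))"

text \<open>Two opposite vertices of an elementary cube are written \<open>v\<close> and \<open>v + s\<close>, where all components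
  of \<open>s\<close> are \<open>\<plusminus>1\<close>. The remaining six vertices in cyclic order:\<close>

definition diagonals :: "(int^3) set" where
  "diagonals = {s. \<forall>k. s$k \<in> {-1, 1}}"

definition cube_hexagon :: "int^3 \<Rightarrow> int^3 \<Rightarrow> 6 \<Rightarrow> int^3" where
  "cube_hexagon v s i =
     (let a = axis 1 (s$1); b = axis 2 (s$2); c = axis 3 (s$3) in
      v + (if i = 0 then a else if i = 1 then a + b else if i = 2 then b
           else if i = 3 then b + c else if i = 4 then c else c + a))"

text \<open>The Lie circles at \<open>v\<close> and \<open>v + s\<close> are correlated. For a hexagon in general position, \<open>B\<close> is
  unique up to a factor.\<close>

definition correlated ::
  "(vec5 \<Rightarrow> vec5) \<Rightarrow> (int^3 \<Rightarrow> vec5) \<Rightarrow> int^3 \<Rightarrow> int^3 \<Rightarrow> bool" where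
  "correlated \<Phi> V v s \<longleftrightarrow> (\<exists>x B.
     hexagon_vertices (\<lambda>i. lie_line \<Phi> (V (cube_hexagon v s i))) x \<and>
     associated_correlation B x \<and>
     correlation_line B (lie_line \<Phi> (V v)) = lie_line \<Phi> (V (v + s)))"

definition all_opposite_correlated ::
  "(vec5 \<Rightarrow> vec5) \<Rightarrow> (int^3 \<Rightarrow> vec5) \<Rightarrow> bool" where
  "all_opposite_correlated \<Phi> V \<longleftrightarrow> (\<forall>v. \<forall>s\<in>diagonals. correlated \<Phi> V v s)"

section \<open>Genericity\<close>

text \<open>Genericity is a property of the point-circle complex: the hexagons of all elementary cubes are
  in general position for every choice of the orientations of the circles, and points as well as
  circles at distinct vertices with a common neighbour are distinct.\<close>

definition nearby :: "int^3 \<Rightarrow> int^3 \<Rightarrow> bool" where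
  "nearby n m \<longleftrightarrow> n \<noteq> m \<and> (\<exists>k. neighbours n k \<and> neighbours m k)"

definition generic ::
  "(vec5 \<Rightarrow> vec5) \<Rightarrow> (int^3 \<Rightarrow> real^2) \<Rightarrow> (int^3 \<Rightarrow> circle) \<Rightarrow> bool" where
  "generic \<Phi> p c \<longleftrightarrow>
     (\<forall>\<sigma>\<in>orientations. \<forall>v. \<forall>s\<in>diagonals. \<exists>x.
        hexagon_vertices (\<lambda>i. lie_line \<Phi> (as_lie_circles p c \<sigma> (cube_hexagon v s i))) x \<and>
        general_position x) \<and>
     (\<forall>n\<in>even_lattice. \<forall>m\<in>even_lattice. nearby n m \<longrightarrow> p n \<noteq> p m) \<and>
     (\<forall>n\<in>odd_lattice. \<forall>m\<in>odd_lattice. nearby n m \<longrightarrow> c n \<noteq> c m)"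

section \<open>One-dimensional Cauchy data\<close>

definition sector_strip :: "int^3 \<Rightarrow> int^3 \<Rightarrow> int^3 \<Rightarrow> (int^3) set" where
  "sector_strip b f g = {b + i *s f + j *s g | i j. 0 \<le> i \<and> 0 \<le> j \<and> min i j \<le> 1}"

definition cauchy_points :: "int^3 \<Rightarrow> (int^3) set" where
  "cauchy_points w =
     (let f1 = unit_shift 1 - unit_shift 2;
          f2 = unit_shift 2 - unit_shift 3;
          f3 = unit_shift 3 - unit_shift 1
      in sector_strip (w + unit_shift 3) f1 f2 \<union>
         sector_strip (w + unit_shift 1) f2 f3 \<union>
         sector_strip (w + unit_shift 2) f3 f1)"

definition cauchy_circles :: "int^3 \<Rightarrow> (int^3) set" where
  "cauchy_circles w =
     {v \<in> A2 1 \<union> A2 (-1). \<forall>n \<in> A2 0. neighbours v n \<longrightarrow> n \<in> cauchy_points w}"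

end

theory Submission
  imports Defs
begin

text \<open>Identify the homogeneous coordinates of projective 3-space with pairs of complex numbers in such
  a way that the line of the circle with centre \<open>z\<close> and signed radius \<open>r\<close> is the graph of
  \<open>\<xi> \<mapsto> r \<xi> + z cnj \<xi>\<close>. A point on a circle then meets it in the vector of a spinor \<open>\<xi>\<close>, a square root of
  the direction of the radius. For an elementary cube with points \<open>q\<^sub>i\<close> and circles of signed radii
  \<open>r\<^sub>i\<close>, the four contact points of parallel edges are coplanar, and each pair of opposite vertices is
  correlated, iff the product of the \<open>r\<^sub>i\<close> and of the oriented areas of the four triangles of the \<open>q\<^sub>i\<close> is
  negative: all the expressions involved have squares that are real, with the sign of this product,
  and in the positive case a coplanarity would be an equality in Ptolemy's inequality. Flipping one
  orientation flips the condition, which also excludes correlation in the positive case.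

  The orientations thus have to solve one multiplicative sign equation per cube. The eight cubes
  around an odd vertex contain every circle an even number of times, and the corresponding product of
  areas is positive because the cross ratios on the twelve circles around the vertex multiply to 1.
  Hence one of the eight equations follows from the other seven, and the equations can be solved
  uniquely from the Cauchy data.\<close>

section \<open>Determinants and Pluecker coordinates\<close>

text \<open>Why the squares are real: on a circle the difference of two points is a real multiple of
  i times the product of their spinors. In the product of the sides of an inscribed triangle, one of
  them conjugated, all spinors cancel but the square of one, which is therefore known from the
  points alone, up to i and the real number that abc = 4 R S ties to radius and area. Spinors are
  fixed only up to sign, and this merely rescales contact points. The isometry is arbitrary, so the
  complex coordinates cannot be written down; they are built from the incidences of five special Lie
  circles, and the symplectic form of the line complex survives up to a constant. Coplanarity is
  then a Pfaffian, and the correlation of a hexagon is a linear map followed by the null polarity.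
  Genericity serves twice: distinct points and circles exclude tangency and vanishing areas, and
  general position makes the correlation of a hexagon unique. In the two levels that carry the data,
  a single cube has only Cauchy circles; it determines the sign at \<open>w\<close>, and each
  further cube determines exactly one new circle.\<close>

lemma UNIV_4_from_0: "(UNIV::4 set) = {0, 1, 2, 3}"
  using UNIV_4 by auto

lemma forall_4_from_0: "(\<forall>i::4. P i) \<longleftrightarrow> P 0 \<and> P 1 \<and> P 2 \<and> P 3"
  by (metis UNIV_4_from_0 UNIV_I empty_iff insert_iff)

lemma sum_4_from_0: "sum f (UNIV::4 set) = f 0 + f 1 + f 2 + (f 3 :: 'a::comm_monoid_add)"
  unfolding UNIV_4_from_0 by (simp add: ac_simps)

text \<open>Laplace expansion by the first two and the last two rows: the determinant as the
  exterior product of two lines, bilinear in their Pluecker coordinates.\<close>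

definition d4 :: "real^4 \<Rightarrow> real^4 \<Rightarrow> real^4 \<Rightarrow> real^4 \<Rightarrow> real" where
  "d4 a b c d = plucker a b 0 1 * plucker c d 2 3 - plucker a b 0 2 * plucker c d 1 3
     + plucker a b 0 3 * plucker c d 1 2 + plucker a b 1 2 * plucker c d 0 3
     - plucker a b 1 3 * plucker c d 0 2 + plucker a b 2 3 * plucker c d 0 1"

lemma det_4: "det (A::real^4^4) = d4 (A$0) (A$1) (A$2) (A$3)"
proof -
  have f: "finite {1::4, 2, 3}" "0 \<notin> {1, 2, 3::4}" "finite {2::4, 3}" "1 \<notin> {2, 3::4}"
    "finite {3::4}" "2 \<notin> {3::4}"
    by auto
  show ?thesis
    unfolding det_def UNIV_4_from_0
    unfolding sum_over_permutations_insert[OF f(1,2)]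
    unfolding sum_over_permutations_insert[OF f(3,4)]
    unfolding sum_over_permutations_insert[OF f(5,6)]
    unfolding permutes_sing
    by (simp add: sign_swap_id sign_compose permutation_swap_id permutation_compose sign_id
        Transposition.transpose_def d4_def plucker_def algebra_simps)
qed

definition rows4 :: "real^4 \<Rightarrow> real^4 \<Rightarrow> real^4 \<Rightarrow> real^4 \<Rightarrow> real^4^4" where
  "rows4 a b c d = (\<chi> i. if i = 0 then a else if i = 1 then b else if i = 2 then c else d)"

lemma rows4_nth [simp]:
  "rows4 a b c d $ 0 = a" "rows4 a b c d $ 1 = b" "rows4 a b c d $ 2 = c" "rows4 a b c d $ 3 = d"
  by (simp_all add: rows4_def)

lemma det_rows4: "det (rows4 a b c d) = d4 a b c d"
  by (simp add: det_4)

lemma det_zero_iff_kernel: "det (A::real^'n^'n) = 0 \<longleftrightarrow> (\<exists>x. x \<noteq> 0 \<and> A *v x = 0)"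
  by (metis invertible_det_nz invertible_left_inverse matrix_left_invertible_ker)

lemma proj_coplanar_iff_d4: "proj_coplanar {a, b, c, d} \<longleftrightarrow> d4 a b c d = 0"
proof -
  have "rows4 a b c d *v h = 0 \<longleftrightarrow> (\<forall>y\<in>{a, b, c, d}. h \<bullet> y = 0)" for h
    by (auto simp: vec_eq_iff forall_4_from_0 matrix_vector_mul_component inner_commute)
  then show ?thesis
    unfolding proj_coplanar_def det_rows4[symmetric] det_zero_iff_kernel by simp
qed

lemma d4_zero_dependent:
  assumes "d4 a b c d = 0"
  obtains s t u v :: real
  where "(s, t, u, v) \<noteq> (0, 0, 0, 0)" "s *\<^sub>R a + t *\<^sub>R b + u *\<^sub>R c + v *\<^sub>R d = 0"
proof -
  have "det (transpose (rows4 a b c d)) = 0"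
    using assms by (simp add: det_transpose det_rows4)
  then obtain x where x: "x \<noteq> 0" "transpose (rows4 a b c d) *v x = 0"
    unfolding det_zero_iff_kernel by blast
  have "x$0 *\<^sub>R a + x$1 *\<^sub>R b + x$2 *\<^sub>R c + x$3 *\<^sub>R d = 0"
    using x(2) by (simp add: matrix_vector_mult_def transpose_def sum_4_from_0 vec_eq_iff mult.commute)
  moreover have "(x$0, x$1, x$2, x$3) \<noteq> (0, 0, 0, 0)"
    using x(1) by (simp add: vec_eq_iff forall_4_from_0)
  ultimately show ?thesis using that by blast
qed

text \<open>The lines of the linear complex are the isotropic planes of this symplectic form.\<close>

definition omega :: "real^4 \<Rightarrow> real^4 \<Rightarrow> real" where
  "omega x y = plucker x y 0 3 - plucker x y 1 2"

lemma omega_add_left: "omega (x + y) z = omega x z + omega y z"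
  and omega_add_right: "omega z (x + y) = omega z x + omega z y"
  and omega_scale_left: "omega (a *\<^sub>R x) z = a * omega x z"
  and omega_scale_right: "omega z (a *\<^sub>R x) = a * omega z x"
  and omega_self: "omega x x = 0"
  and omega_zero_left: "omega 0 x = 0"
  and omega_zero_right: "omega x 0 = 0"
  by (simp_all add: omega_def plucker_def algebra_simps)

lemmas omega_bilinear = omega_add_left omega_add_right omega_scale_left omega_scale_right omega_self omega_zero_left omega_zero_right

lemma omega_swap: "omega y x = - omega x y"
  by (simp add: omega_def plucker_def)

lemma omega_nondegenerate:
  assumes "\<And>y. omega x y = 0" shows "x = 0"
proof -
  have "omega x (axis 0 1) = 0" "omega x (axis 1 1) = 0" "omega x (axis 2 1) = 0" "omega x (axis 3 1) = 0"
    using assms by auto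
  then show ?thesis
    by (simp add: omega_def plucker_def axis_def vec_eq_iff forall_4_from_0)
qed

text \<open>Up to sign the determinant is the Pfaffian of the Gram matrix of the symplectic form.
  Coplanarity of four points thus involves only their six products under
  \<open>omega\<close>.\<close>

lemma d4_pfaffian: "d4 a b c d = - (omega a b * omega c d - omega a c * omega b d + omega a d * omega b c)"
  by (simp add: omega_def d4_def plucker_def algebra_simps)

text \<open>The three-term sums are the coordinates of the trivector of \<open>y\<close>, \<alpha>
  and \<beta>; hence a line is determined by its Pluecker coordinates.\<close>

lemma mem_span_iff_plucker:
  assumes "plucker \<alpha> \<beta> j k \<noteq> 0"
  shows "y \<in> span {\<alpha>, \<beta>} \<longleftrightarrow>
    (\<forall>l m n. y$l * plucker \<alpha> \<beta> m n - y$m * plucker \<alpha> \<beta> l n + y$n * plucker \<alpha> \<beta> l m = 0)"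
    (is "_ \<longleftrightarrow> ?R")
proof
  assume "y \<in> span {\<alpha>, \<beta>}"
  then obtain s t where "y = s *\<^sub>R \<alpha> + t *\<^sub>R \<beta>"
    unfolding span_insert[of \<alpha> "{\<beta>}"] span_singleton by (auto simp: algebra_simps)
  then show ?R by (simp add: plucker_def algebra_simps)
next
  assume R: ?R
  let ?g = "plucker \<alpha> \<beta> j k"
  \<comment> \<open>Cramer's rule in the coordinates \<open>j\<close> and \<open>k\<close>.\<close>
  define s where "s = (y$j * \<beta>$k - y$k * \<beta>$j) / ?g"
  define t where "t = (\<alpha>$j * y$k - \<alpha>$k * y$j) / ?g"
  have "y$l = s * \<alpha>$l + t * \<beta>$l" for l
  proof -
    have "y$l * ?g - y$j * plucker \<alpha> \<beta> l k + y$k * plucker \<alpha> \<beta> l j = 0"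
      using R by blast
    then have "y$l * ?g = (y$j * \<beta>$k - y$k * \<beta>$j) * \<alpha>$l + (\<alpha>$j * y$k - \<alpha>$k * y$j) * \<beta>$l"
      by (simp add: plucker_def algebra_simps)
    then have "y$l = ((y$j * \<beta>$k - y$k * \<beta>$j) * \<alpha>$l + (\<alpha>$j * y$k - \<alpha>$k * y$j) * \<beta>$l) / ?g"
      using assms nonzero_eq_divide_eq by blast
    then show ?thesis
      by (simp only: s_def t_def add_divide_distrib times_divide_eq_left)
  qed
  then have "y = s *\<^sub>R \<alpha> + t *\<^sub>R \<beta>" by (simp add: vec_eq_iff)
  then show "y \<in> span {\<alpha>, \<beta>}"
    by (metis insertI1 insertI2 span_add span_base span_scale)
qed

lemma span_eq_if_plucker_proportional:
  assumes "plucker \<alpha> \<beta> j k \<noteq> 0" "m \<noteq> 0"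
    and "\<And>i j. plucker \<alpha> \<beta> i j = m * plucker \<alpha>' \<beta>' i j"
  shows "span {\<alpha>, \<beta>} = span {\<alpha>', \<beta>'}"
proof -
  have nz: "plucker \<alpha>' \<beta>' j k \<noteq> 0" using assms by auto
  have "y$l * plucker \<alpha> \<beta> i n - y$i * plucker \<alpha> \<beta> l n + y$n * plucker \<alpha> \<beta> l i
    = m * (y$l * plucker \<alpha>' \<beta>' i n - y$i * plucker \<alpha>' \<beta>' l n + y$n * plucker \<alpha>' \<beta>' l i)"
    for y l i n
    by (simp add: assms(3) algebra_simps)
  then have "y \<in> span {\<alpha>, \<beta>} \<longleftrightarrow> y \<in> span {\<alpha>', \<beta>'}" for y
    unfolding mem_span_iff_plucker[OF assms(1)] mem_span_iff_plucker[OF nz]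
    using assms(2) by simp
  then show ?thesis by blast
qed

lemma plucker_eqI:
  assumes "plucker \<alpha> \<beta> 0 1 = m * plucker \<alpha>' \<beta>' 0 1" "plucker \<alpha> \<beta> 0 2 = m * plucker \<alpha>' \<beta>' 0 2"
    "plucker \<alpha> \<beta> 0 3 = m * plucker \<alpha>' \<beta>' 0 3" "plucker \<alpha> \<beta> 1 2 = m * plucker \<alpha>' \<beta>' 1 2"
    "plucker \<alpha> \<beta> 1 3 = m * plucker \<alpha>' \<beta>' 1 3" "plucker \<alpha> \<beta> 2 3 = m * plucker \<alpha>' \<beta>' 2 3"
  shows "plucker \<alpha> \<beta> i j = m * plucker \<alpha>' \<beta>' i j"
proof -
  have sk: "plucker \<alpha> \<beta> j i = - plucker \<alpha> \<beta> i j" for \<alpha> \<beta> i j by (simp add: plucker_def)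
  have z: "plucker \<alpha> \<beta> i i = 0" for \<alpha> \<beta> i by (simp add: plucker_def)
  have "\<forall>i j. plucker \<alpha> \<beta> i j = m * plucker \<alpha>' \<beta>' i j"
    unfolding forall_4_from_0 z using assms
    by (simp add: sk[of _ _ 1 0] sk[of _ _ 2 0] sk[of _ _ 3 0] sk[of _ _ 2 1] sk[of _ _ 3 1] sk[of _ _ 3 2])
  then show ?thesis by blast
qed

text \<open>Resolves the definite description: the coordinate that \<open>complex_coords\<close>
  drops is recovered on the complex, so proportional coordinates give the same span.\<close>

lemma lie_line_eqI:
  assumes "plucker \<alpha> \<beta> 0 3 = plucker \<alpha> \<beta> 1 2" "k \<noteq> 0"
    and cc: "complex_coords \<alpha> \<beta> = k *\<^sub>R \<Phi> V" and "\<Phi> V \<noteq> 0"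
  shows "lie_line \<Phi> V = span {\<alpha>, \<beta>}"
  unfolding lie_line_def
proof (rule the_equality)
  show "\<exists>\<alpha>' \<beta>' k. span {\<alpha>, \<beta>} = span {\<alpha>', \<beta>'} \<and> plucker \<alpha>' \<beta>' 0 3 = plucker \<alpha>' \<beta>' 1 2 \<and> k \<noteq> 0 \<and>
       complex_coords \<alpha>' \<beta>' = k *\<^sub>R \<Phi> V"
    using assms by blast
next
  fix l assume "\<exists>\<alpha> \<beta> k. l = span {\<alpha>, \<beta>} \<and> plucker \<alpha> \<beta> 0 3 = plucker \<alpha> \<beta> 1 2 \<and> k \<noteq> 0 \<and>
       complex_coords \<alpha> \<beta> = k *\<^sub>R \<Phi> V"
  then obtain \<alpha>' \<beta>' k' where l: "l = span {\<alpha>', \<beta>'}" "plucker \<alpha>' \<beta>' 0 3 = plucker \<alpha>' \<beta>' 1 2"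
    "k' \<noteq> 0" "complex_coords \<alpha>' \<beta>' = k' *\<^sub>R \<Phi> V" by blast
  have "complex_coords \<alpha> \<beta> = (k / k') *\<^sub>R complex_coords \<alpha>' \<beta>'"
    using l cc by simp
  then have e: "plucker \<alpha> \<beta> 0 1 = (k / k') * plucker \<alpha>' \<beta>' 0 1" "plucker \<alpha> \<beta> 2 3 = (k / k') * plucker \<alpha>' \<beta>' 2 3"
    "plucker \<alpha> \<beta> 0 2 = (k / k') * plucker \<alpha>' \<beta>' 0 2" "plucker \<alpha> \<beta> 1 3 = (k / k') * plucker \<alpha>' \<beta>' 1 3"
    "plucker \<alpha> \<beta> 0 3 = (k / k') * plucker \<alpha>' \<beta>' 0 3"
    unfolding complex_coords_def scaleR_Pair prod.inject real_scaleR_def by blast+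
  have pl: "plucker \<alpha> \<beta> i j = (k / k') * plucker \<alpha>' \<beta>' i j" for i j
    by (rule plucker_eqI) (simp_all only: e assms(1)[symmetric] l(2)[symmetric])
  have "complex_coords \<alpha> \<beta> \<noteq> 0" using assms by simp
  then obtain i j where "plucker \<alpha> \<beta> i j \<noteq> 0"
    by (auto simp: complex_coords_def zero_prod_def)
  from span_eq_if_plucker_proportional[OF this _ pl] show "l = span {\<alpha>, \<beta>}"
    using assms(2) l by auto
qed

text \<open>One of the first four coordinates is non-zero, since the Pluecker relation forces
  \<open>e * e = 0\<close> when all of them vanish; it can be used as a divisor.\<close>

lemma complex_coords_surj:
  assumes "plucker_quadratic_form g = 0" "g \<noteq> 0"
  obtains \<alpha> \<beta> where "complex_coords \<alpha> \<beta> = g" "plucker \<alpha> \<beta> 0 3 = plucker \<alpha> \<beta> 1 2"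
proof -
  obtain a b c d e where g: "g = (a, b, c, d, e)" by (cases g)
  have q: "a * b - c * d + e * e = 0"
    using assms(1) by (simp add: g plucker_quadratic_form_def power2_eq_square)
  define vec where "vec = (\<lambda>x y z w. (\<chi> i. if i = 0 then x else if i = 1 then y else if i = 2 then z else w) :: real^4)"
  have v: "vec x y z w $ 0 = x" "vec x y z w $ 1 = y" "vec x y z w $ 2 = z" "vec x y z w $ 3 = w" for x y z w
    by (simp_all add: vec_def)
  have "a \<noteq> 0 \<or> b \<noteq> 0 \<or> c \<noteq> 0 \<or> d \<noteq> 0"
    using assms(2) q by (auto simp: g zero_prod_def)
  then consider "a \<noteq> 0" | "b \<noteq> 0" | "c \<noteq> 0" | "d \<noteq> 0" by blast
  then show ?thesis
  \<comment> \<open>In each case the witnesses are the two rows of the skew-symmetric matrix of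
    Pluecker coordinates that meet in the non-zero entry, one of them normalised.\<close>
  proof cases
    case 1
    then have "b = (c * d - e * e) / a" using q by (simp add: field_simps)
    then show ?thesis using 1
      by (intro that[of "vec 1 0 (- e / a) (- d / a)" "vec 0 a c e"])
         (simp_all add: complex_coords_def plucker_def v g field_simps)
  next
    case 2
    then have "a = (c * d - e * e) / b" using q by (simp add: field_simps)
    then show ?thesis using 2
      by (intro that[of "vec (- c / b) (- e / b) 0 1" "vec (- e) (- d) (- b) 0"])
         (simp_all add: complex_coords_def plucker_def v g field_simps)
  next
    case 3
    then have "d = (a * b + e * e) / c" using q by (simp add: field_simps)
    then show ?thesis using 3
      by (intro that[of "vec 1 (e / c) 0 (- b / c)" "vec 0 a c e"])
         (simp_all add: complex_coords_def plucker_def v g field_simps)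
  next
    case 4
    then have "c = (a * b + e * e) / d" using q by (simp add: field_simps)
    then show ?thesis using 4
      by (intro that[of "vec (e / d) 1 (b / d) 0" "vec (- a) 0 e d"])
         (simp_all add: complex_coords_def plucker_def v g field_simps)
  qed
qed

section \<open>Lie circles and lines of the complex\<close>

type_synonym vec6 = "real \<times> vec5"

text \<open>The full bivector, with the coordinate of the indices 1 and 2 kept in front, so that
  \<open>pol6\<close> gives the determinant for all pairs of vectors and not only for lines of the
  complex.\<close>

definition wedge :: "real^4 \<Rightarrow> real^4 \<Rightarrow> vec6" where
  "wedge \<alpha> \<beta> = (plucker \<alpha> \<beta> 1 2, complex_coords \<alpha> \<beta>)"

definition lift6 :: "vec5 \<Rightarrow> vec6" where
  "lift6 g = (snd (snd (snd (snd g))), g)"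

definition pol6 :: "vec6 \<Rightarrow> vec6 \<Rightarrow> real" where
  "pol6 = (\<lambda>(g12, g01, g23, g02, g13, g03) (h12, h01, h23, h02, h13, h03).
     g01 * h23 + g23 * h01 - g02 * h13 - g13 * h02 + g03 * h12 + g12 * h03)"

lemma wedge_add_left: "wedge (x + y) z = wedge x z + wedge y z"
  and wedge_add_right: "wedge z (x + y) = wedge z x + wedge z y"
  and wedge_scale_left: "wedge (a *\<^sub>R x) z = a *\<^sub>R wedge x z"
  and wedge_scale_right: "wedge z (a *\<^sub>R x) = a *\<^sub>R wedge z x"
  and wedge_self: "wedge x x = 0"
  and wedge_zero_left: "wedge 0 x = 0"
  and wedge_zero_right: "wedge x 0 = 0"
  by (simp_all add: wedge_def complex_coords_def plucker_def zero_prod_def algebra_simps)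

lemma wedge_swap: "wedge y x = - wedge x y"
  by (simp add: wedge_def complex_coords_def plucker_def)

lemma pol6_add_left: "pol6 (x + y) z = pol6 x z + pol6 y z"
  and pol6_add_right: "pol6 z (x + y) = pol6 z x + pol6 z y"
  and pol6_scale_left: "pol6 (a *\<^sub>R x) z = a * pol6 x z"
  and pol6_scale_right: "pol6 z (a *\<^sub>R x) = a * pol6 z x"
  by (auto simp: pol6_def algebra_simps split: prod.splits)

lemma pol6_wedge: "pol6 (wedge a b) (wedge c d) = d4 a b c d"
  by (simp add: pol6_def wedge_def d4_def complex_coords_def algebra_simps)

lemma plucker_zero_if_wedge_zero: "wedge u v = 0 \<Longrightarrow> plucker u v i j = 0"
  using plucker_eqI[of u v 0 u v i j] by (simp add: wedge_def complex_coords_def zero_prod_def)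

lemma wedge_zero_parallel:
  assumes "wedge u v = 0" "u \<noteq> 0"
  obtains c where "v = c *\<^sub>R u"
proof -
  obtain i where i: "u$i \<noteq> 0" using assms(2) by (auto simp: vec_eq_iff)
  define c where "c = v$i / u$i"
  have "v$j = c * u$j" for j
  proof -
    have "v$j * u$i = v$i * u$j"
      using plucker_zero_if_wedge_zero[OF assms(1), of i j] by (simp add: plucker_def mult.commute)
    then have "v$j = v$i * u$j / u$i" using i nonzero_eq_divide_eq by blast
    then show ?thesis by (simp add: c_def)
  qed
  then have "v = c *\<^sub>R u" by (simp add: vec_eq_iff)
  then show ?thesis by (rule that)
qed

lemma mem_span_pairE:
  fixes u :: "'a::real_vector"
  assumes "u \<in> span {\<alpha>, \<beta>}"
  obtains s t where "u = s *\<^sub>R \<alpha> + t *\<^sub>R \<beta>"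
  using assms unfolding span_insert[of \<alpha> "{\<beta>}"] span_singleton by (auto simp: algebra_simps)

lemma span_pair_eq:
  fixes \<alpha> :: "'a::real_vector"
  shows "span {\<alpha>, \<beta>} = {s *\<^sub>R \<alpha> + t *\<^sub>R \<beta> | s t. True}"
proof (intro subset_antisym subsetI)
  fix x assume "x \<in> span {\<alpha>, \<beta>}"
  then show "x \<in> {s *\<^sub>R \<alpha> + t *\<^sub>R \<beta> | s t. True}" by (elim mem_span_pairE) blast
next
  fix x assume "x \<in> {s *\<^sub>R \<alpha> + t *\<^sub>R \<beta> | s t. True}"
  then obtain s t where "x = s *\<^sub>R \<alpha> + t *\<^sub>R \<beta>" by blast
  then show "x \<in> span {\<alpha>, \<beta>}" by (simp add: span_add span_scale span_base)
qed

lemma wedge_rebase: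
  assumes "u \<in> span {\<alpha>, \<beta>}" "u \<noteq> 0"
  obtains v k where "wedge \<alpha> \<beta> = k *\<^sub>R wedge u v"
proof -
  obtain s t where u: "u = s *\<^sub>R \<alpha> + t *\<^sub>R \<beta>" using assms(1) by (rule mem_span_pairE)
  show ?thesis
  proof (cases "s = 0")
    case False
    then show ?thesis
      by (intro that[of "1 / s" \<beta>]) (simp add: u wedge_add_left wedge_scale_left wedge_self)
  next
    case True
    then have "t \<noteq> 0" using assms(2) u by auto
    then show ?thesis
      by (intro that[of "- 1 / t" \<alpha>])
         (simp add: u wedge_add_left wedge_scale_left wedge_self True wedge_swap[of \<alpha> \<beta>])
  qed
qed

lemma d4_zero_if_common:
  assumes "u \<in> span {a, b}" "u \<in> span {c, d}" "u \<noteq> 0"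
  shows "d4 a b c d = 0"
proof -
  obtain v k where 1: "wedge a b = k *\<^sub>R wedge u v" using wedge_rebase assms by blast
  obtain v' k' where 2: "wedge c d = k' *\<^sub>R wedge u v'" using wedge_rebase assms by blast
  have "d4 u v u v' = 0" by (simp add: d4_def plucker_def algebra_simps)
  then show ?thesis
    by (simp add: pol6_wedge[symmetric] 1 2 pol6_scale_left pol6_scale_right)
qed

text \<open>A linear dependence of the four vectors equates a vector of one span with a vector of
  the other; independence within each pair keeps it from being zero.\<close>

lemma common_if_d4_zero:
  assumes "d4 a b c d = 0" "wedge a b \<noteq> 0" "wedge c d \<noteq> 0"
  obtains u where "u \<in> span {a, b}" "u \<in> span {c, d}" "u \<noteq> 0"
proof -
  have indep: "s = 0 \<and> t = 0" if "s *\<^sub>R x + t *\<^sub>R y = 0" "wedge x y \<noteq> 0" for s t x y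
  proof -
    have "wedge (s *\<^sub>R x + t *\<^sub>R y) y = s *\<^sub>R wedge x y" "wedge x (s *\<^sub>R x + t *\<^sub>R y) = t *\<^sub>R wedge x y"
      by (simp_all add: wedge_add_left wedge_add_right wedge_scale_left wedge_scale_right wedge_self)
    then have "s *\<^sub>R wedge x y = 0" "t *\<^sub>R wedge x y = 0"
      using that(1) by (simp_all only: wedge_zero_left wedge_zero_right)
    then show ?thesis using that(2) by simp
  qed
  obtain s t u v :: real
    where nz: "(s, t, u, v) \<noteq> (0, 0, 0, 0)" and eq: "s *\<^sub>R a + t *\<^sub>R b + u *\<^sub>R c + v *\<^sub>R d = 0"
    using assms(1) by (rule d4_zero_dependent)
  let ?u = "s *\<^sub>R a + t *\<^sub>R b"
  have u: "?u = (- u) *\<^sub>R c + (- v) *\<^sub>R d"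
  proof -
    have "?u + (u *\<^sub>R c + v *\<^sub>R d) = 0" using eq by (simp add: add.assoc)
    then have "?u = - (u *\<^sub>R c + v *\<^sub>R d)" by (rule eq_neg_iff_add_eq_0[THEN iffD2])
    then show ?thesis by simp
  qed
  have "?u \<noteq> 0"
  proof
    assume "?u = 0"
    moreover then have "(- u) *\<^sub>R c + (- v) *\<^sub>R d = 0" using u by simp
    ultimately have "s = 0 \<and> t = 0" "- u = 0 \<and> - v = 0"
      using indep assms(2,3) by blast+
    then show False using nz by simp
  qed
  moreover have "?u \<in> span {a, b}" "?u \<in> span {c, d}"
    using u unfolding span_pair_eq by blast+
  ultimately show ?thesis by (rule that[rotated 2])
qed

lemma wedge_rebase2:
  assumes "u \<in> span {\<alpha>, \<beta>}" "v \<in> span {\<alpha>, \<beta>}" "wedge u v \<noteq> 0"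
  obtains k where "k \<noteq> 0" "wedge \<alpha> \<beta> = k *\<^sub>R wedge u v"
proof -
  obtain s t s' t' where uv: "u = s *\<^sub>R \<alpha> + t *\<^sub>R \<beta>" "v = s' *\<^sub>R \<alpha> + t' *\<^sub>R \<beta>"
    using assms(1,2) by (metis mem_span_pairE)
  have "wedge u v = (s * t' - t * s') *\<^sub>R wedge \<alpha> \<beta>"
    by (simp add: uv wedge_add_left wedge_add_right wedge_scale_left wedge_scale_right wedge_self
        wedge_swap[of \<alpha> \<beta>] algebra_simps)
  moreover have "s * t' - t * s' \<noteq> 0" using calculation assms(3) by auto
  ultimately show ?thesis
    by (intro that[of "1 / (s * t' - t * s')"]) auto
qed

section \<open>The Lie form and the determinant under the isometry\<close>

lemma lie_form_left_add: "lie_form (V + W) Z = lie_form V Z + lie_form W Z"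
  and lie_form_right_add: "lie_form Z (V + W) = lie_form Z V + lie_form Z W"
  by (auto simp: lie_form_def add_divide_distrib algebra_simps split: prod.splits)

lemma lie_form_commute: "lie_form W V = lie_form V W"
  by (auto simp: lie_form_def algebra_simps split: prod.splits)

locale isometry =
  fixes \<Phi> :: "vec5 \<Rightarrow> vec5"
  assumes iso: "lie_plucker_isometry \<Phi>"
begin

lemma linear: "linear \<Phi>" using iso by (simp add: lie_plucker_isometry_def)

lemma iso_q: "plucker_quadratic_form (\<Phi> V) = lie_form V V"
  using iso unfolding lie_plucker_isometry_def by blast

abbreviation "\<Phi>6 V \<equiv> lift6 (\<Phi> V)"

lemma \<Phi>6_add: "\<Phi>6 (V + W) = \<Phi>6 V + \<Phi>6 W"
  and \<Phi>6_scale: "\<Phi>6 (a *\<^sub>R V) = a *\<^sub>R \<Phi>6 V"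
  by (simp_all add: lift6_def linear_add[OF linear] linear_scale[OF linear])

lemma pol6_diag: "pol6 (\<Phi>6 V) (\<Phi>6 V) = lie_form V V"
proof -
  have "pol6 (lift6 g) (lift6 g) = plucker_quadratic_form g" for g
    by (auto simp: pol6_def lift6_def plucker_quadratic_form_def power2_eq_square split: prod.splits)
  then show ?thesis by (simp add: iso_q)
qed

text \<open>Polarisation, as the isometry is given by an identity of quadratic forms only.\<close>

lemma pol6_\<Phi>: "pol6 (\<Phi>6 V) (\<Phi>6 W) = lie_form V W"
proof -
  have "pol6 (\<Phi>6 (V + W)) (\<Phi>6 (V + W)) = lie_form (V + W) (V + W)" by (rule pol6_diag)
  moreover have "pol6 (\<Phi>6 W) (\<Phi>6 V) = pol6 (\<Phi>6 V) (\<Phi>6 W)"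
    by (auto simp: pol6_def algebra_simps split: prod.splits)
  ultimately show ?thesis
    by (simp add: \<Phi>6_add pol6_add_left pol6_add_right pol6_diag lie_form_left_add lie_form_right_add
        lie_form_commute[of W V])
qed

text \<open>The Lie form is nondegenerate: a vector in the kernel would be orthogonal to the five
  coordinate vectors.\<close>

lemma \<Phi>_nonzero: "V \<noteq> 0 \<Longrightarrow> \<Phi> V \<noteq> 0"
proof
  assume "V \<noteq> 0" "\<Phi> V = 0"
  then have z: "lie_form V W = 0" for W
    using pol6_\<Phi>[of V W] by (simp add: pol6_def lift6_def zero_prod_def split: prod.splits)
  obtain x y a b r where V: "V = (x, y, a, b, r)" by (cases V)
  have "x = 0" "y = 0" "a = 0" "b = 0" "r = 0"
    using z[of "(1,0,0,0,0)"] z[of "(0,1,0,0,0)"] z[of "(0,0,1,0,0)"] z[of "(0,0,0,1,0)"] z[of "(0,0,0,0,1)"]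
    by (simp_all add: V lie_form_def)
  then show False using \<open>V \<noteq> 0\<close> V by (simp add: zero_prod_def)
qed

lemma lie_line_wedge:
  assumes "wedge \<alpha> \<beta> = k *\<^sub>R \<Phi>6 V" "k \<noteq> 0" "V \<noteq> 0"
  shows "lie_line \<Phi> V = span {\<alpha>, \<beta>}"
proof (rule lie_line_eqI)
  show "complex_coords \<alpha> \<beta> = k *\<^sub>R \<Phi> V" "plucker \<alpha> \<beta> 0 3 = plucker \<alpha> \<beta> 1 2"
    using assms(1) by (cases "\<Phi> V"; simp add: wedge_def lift6_def complex_coords_def)+
qed (use assms \<Phi>_nonzero in auto)

lemma obtain_line:
  assumes "lie_circle V"
  obtains \<alpha> \<beta> where "wedge \<alpha> \<beta> = \<Phi>6 V" "lie_line \<Phi> V = span {\<alpha>, \<beta>}" "wedge \<alpha> \<beta> \<noteq> 0"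
proof -
  have V: "V \<noteq> 0" "lie_form V V = 0" using assms by (auto simp: lie_circle_def)
  then have "plucker_quadratic_form (\<Phi> V) = 0" by (simp add: iso_q)
  then obtain \<alpha> \<beta> where "complex_coords \<alpha> \<beta> = \<Phi> V" "plucker \<alpha> \<beta> 0 3 = plucker \<alpha> \<beta> 1 2"
    using complex_coords_surj \<Phi>_nonzero[OF V(1)] by blast
  then have "wedge \<alpha> \<beta> = \<Phi>6 V"
    by (cases "\<Phi> V") (simp add: wedge_def lift6_def complex_coords_def)
  moreover have "lift6 (\<Phi> V) \<noteq> 0" using \<Phi>_nonzero[OF V(1)] by (simp add: lift6_def zero_prod_def)
  ultimately show ?thesis using that lie_line_wedge[of \<alpha> \<beta> 1 V] V(1) by auto
qed

text \<open>The Lie form of two circles is the determinant of spanning vectors of their lines, so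
  touching becomes intersecting.\<close>

lemma lines_meet:
  assumes "lie_circle V" "lie_circle W" "lie_form V W = 0"
  obtains u where "u \<in> lie_line \<Phi> V" "u \<in> lie_line \<Phi> W" "u \<noteq> 0"
proof -
  obtain \<alpha> \<beta> where 1: "wedge \<alpha> \<beta> = \<Phi>6 V" "lie_line \<Phi> V = span {\<alpha>, \<beta>}" "wedge \<alpha> \<beta> \<noteq> 0"
    using assms obtain_line by blast
  obtain \<alpha>' \<beta>' where 2: "wedge \<alpha>' \<beta>' = \<Phi>6 W" "lie_line \<Phi> W = span {\<alpha>', \<beta>'}" "wedge \<alpha>' \<beta>' \<noteq> 0"
    using assms obtain_line by blast
  have "d4 \<alpha> \<beta> \<alpha>' \<beta>' = 0"
    using assms(3) 1 2 by (simp add: pol6_wedge[symmetric] pol6_\<Phi>)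
  then show ?thesis using common_if_d4_zero 1 2 that by metis
qed

lemma lines_skew:
  assumes "lie_circle V" "lie_circle W" "lie_form V W \<noteq> 0"
    and "u \<in> lie_line \<Phi> V" "u \<in> lie_line \<Phi> W"
  shows "u = 0"
proof -
  obtain \<alpha> \<beta> where 1: "wedge \<alpha> \<beta> = \<Phi>6 V" "lie_line \<Phi> V = span {\<alpha>, \<beta>}" "wedge \<alpha> \<beta> \<noteq> 0"
    using assms obtain_line by blast
  obtain \<alpha>' \<beta>' where 2: "wedge \<alpha>' \<beta>' = \<Phi>6 W" "lie_line \<Phi> W = span {\<alpha>', \<beta>'}" "wedge \<alpha>' \<beta>' \<noteq> 0"
    using assms obtain_line by blast
  have "d4 \<alpha> \<beta> \<alpha>' \<beta>' \<noteq> 0"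
    using assms(3) 1 2 by (simp add: pol6_wedge[symmetric] pol6_\<Phi>)
  then show ?thesis using d4_zero_if_common assms(4,5) 1 2 by metis
qed

lemma line_basis:
  assumes "lie_circle V" "u \<in> lie_line \<Phi> V" "v \<in> lie_line \<Phi> V" "wedge u v \<noteq> 0"
  obtains k where "k \<noteq> 0" "\<Phi>6 V = k *\<^sub>R wedge u v" "lie_line \<Phi> V = span {u, v}"
proof -
  obtain \<alpha> \<beta> where 1: "wedge \<alpha> \<beta> = \<Phi>6 V" "lie_line \<Phi> V = span {\<alpha>, \<beta>}"
    using assms obtain_line by blast
  then obtain k where k: "k \<noteq> 0" "\<Phi>6 V = k *\<^sub>R wedge u v"
    using wedge_rebase2 assms(2-4) by metis
  then have "wedge u v = (1 / k) *\<^sub>R \<Phi>6 V" by simp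
  then have "lie_line \<Phi> V = span {u, v}"
    using k assms(1) by (intro lie_line_wedge[of _ _ "1/k"]) (auto simp: lie_circle_def)
  then show ?thesis using that k by blast
qed

lemma wedge_nonzero_if_skew:
  assumes "lie_circle V" "lie_circle W" "lie_form V W \<noteq> 0"
    and "u \<in> lie_line \<Phi> V" "v \<in> lie_line \<Phi> W" "u \<noteq> 0" "v \<noteq> 0"
  shows "wedge u v \<noteq> 0"
proof
  assume "wedge u v = 0"
  then obtain c where v: "v = c *\<^sub>R u" using wedge_zero_parallel assms(6) by blast
  obtain \<alpha> \<beta> where "lie_line \<Phi> V = span {\<alpha>, \<beta>}" using assms obtain_line by blast
  then have "v \<in> lie_line \<Phi> V" using assms(4) v by (simp add: span_scale)
  then show False using lines_skew[of V W v] assms by blast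
qed

end

section \<open>Spinor coordinates\<close>

abbreviation cpx :: "real^2 \<Rightarrow> complex" where "cpx z \<equiv> Complex (z$1) (z$2)"

text \<open>The point-circle geometry becomes linear over the reals once the space of homogeneous coordinates
  is split into two Lagrangian planes, the lines of the origin and of infinity, each identified with
  the complex numbers.\<close>

locale lie_model =
  fixes \<Phi> :: "vec5 \<Rightarrow> vec5" and J :: "complex \<Rightarrow> complex \<Rightarrow> real^4" and c :: real
  assumes c_nonzero: "c \<noteq> 0"
    and J_add: "J (\<xi> + \<xi>') (\<eta> + \<eta>') = J \<xi> \<eta> + J \<xi>' \<eta>'"
    and J_scale: "J (a *\<^sub>R \<xi>) (a *\<^sub>R \<eta>) = a *\<^sub>R J \<xi> \<eta>"
    and omega_J: "omega (J \<xi> \<eta>) (J \<xi>' \<eta>') = c * (Re (cnj \<xi> * \<eta>') - Re (cnj \<xi>' * \<eta>))"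
    and line_J: "lie_line \<Phi> (oriented_circle z r) = range (\<lambda>\<xi>. J \<xi> (of_real r * \<xi> + cpx z * cnj \<xi>))"

context isometry
begin

text \<open>The four Lie circles are the origin, the point at infinity and the two orientations of
  one line through the origin. Each of the two points touches both oriented lines, while the two
  points do not touch each other and neither do the two orientations. The four lines of the complex
  therefore form a skew quadrilateral, whose vertices are a basis.\<close>

lemma skew_quadrilateral:
  obtains u1 u2 f1 f2 and \<kappa>1 \<kappa>2 \<kappa>3 \<kappa>4 :: real where
    "\<Phi>6 (0,0,1,0,0) = \<kappa>1 *\<^sub>R wedge u1 u2" "\<Phi>6 (1,0,0,0,1) = \<kappa>2 *\<^sub>R wedge f1 u2"
    "\<Phi>6 (-1,0,0,0,1) = \<kappa>3 *\<^sub>R wedge u1 f2" "\<Phi>6 (0,0,0,1,0) = \<kappa>4 *\<^sub>R wedge f1 f2"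
    "lie_line \<Phi> (0,0,1,0,0) = span {u1, u2}" "lie_line \<Phi> (0,0,0,1,0) = span {f1, f2}"
proof -
  let ?O = "(0,0,1,0,0) :: vec5" let ?I = "(0,0,0,1,0) :: vec5"
  let ?N1 = "(1,0,0,0,1) :: vec5" let ?N2 = "(-1,0,0,0,1) :: vec5"
  have lc: "lie_circle ?O" "lie_circle ?I" "lie_circle ?N1" "lie_circle ?N2"
    by (simp_all add: lie_circle_def lie_form_def zero_prod_def)
  have lf: "lie_form ?O ?N1 = 0" "lie_form ?O ?N2 = 0" "lie_form ?I ?N1 = 0" "lie_form ?I ?N2 = 0"
    "lie_form ?O ?I \<noteq> 0" "lie_form ?N1 ?N2 \<noteq> 0" "lie_form ?N2 ?N1 \<noteq> 0"
    by (simp_all add: lie_form_def)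
  obtain u2 where u2: "u2 \<in> lie_line \<Phi> ?O" "u2 \<in> lie_line \<Phi> ?N1" "u2 \<noteq> 0" using lines_meet lc lf by metis
  obtain u1 where u1: "u1 \<in> lie_line \<Phi> ?O" "u1 \<in> lie_line \<Phi> ?N2" "u1 \<noteq> 0" using lines_meet lc lf by metis
  obtain f1 where f1: "f1 \<in> lie_line \<Phi> ?I" "f1 \<in> lie_line \<Phi> ?N1" "f1 \<noteq> 0" using lines_meet lc lf by metis
  obtain f2 where f2: "f2 \<in> lie_line \<Phi> ?I" "f2 \<in> lie_line \<Phi> ?N2" "f2 \<noteq> 0" using lines_meet lc lf by metis
  have "wedge u1 u2 \<noteq> 0" using wedge_nonzero_if_skew[OF lc(4,3) lf(7)] u1 u2 by blast
  then obtain \<kappa>1 where 1: "\<Phi>6 ?O = \<kappa>1 *\<^sub>R wedge u1 u2" "lie_line \<Phi> ?O = span {u1, u2}"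
    using line_basis[OF lc(1) u1(1) u2(1)] by metis
  have "wedge f1 f2 \<noteq> 0" using wedge_nonzero_if_skew[OF lc(3,4) lf(6)] f1 f2 by blast
  then obtain \<kappa>4 where 4: "\<Phi>6 ?I = \<kappa>4 *\<^sub>R wedge f1 f2" "lie_line \<Phi> ?I = span {f1, f2}"
    using line_basis[OF lc(2) f1(1) f2(1)] by metis
  have "wedge u1 f2 \<noteq> 0" using wedge_nonzero_if_skew[OF lc(1,2) lf(5)] u1 f2 by blast
  then obtain \<kappa>3 where 3: "\<Phi>6 ?N2 = \<kappa>3 *\<^sub>R wedge u1 f2"
    using line_basis[OF lc(4) u1(2) f2(2)] by metis
  have "wedge f1 u2 \<noteq> 0" using wedge_nonzero_if_skew[OF lc(1,2) lf(5), of u2 f1] u2 f1 wedge_swap[of f1 u2] by auto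
  then obtain \<kappa>2 where 2: "\<Phi>6 ?N1 = \<kappa>2 *\<^sub>R wedge f1 u2"
    using line_basis[OF lc(3) f1(2) u2(2)] by metis
  show ?thesis using that 1 2 3 4 by blast
qed

text \<open>The two factors are the columns of the real matrix of
  \<open>\<xi> \<mapsto> r \<xi> + z cnj \<xi>\<close>. An oriented line through the origin
  orthogonal to the first one supplies the fifth Lie circle needed to normalise the vertices of the
  quadrilateral.\<close>

lemma normal_basis:
  obtains u1 u2 f1 f2 and k :: real where "k \<noteq> 0"
    "\<And>x y r. \<Phi>6 (x, y, 1, x\<^sup>2 + y\<^sup>2 - r\<^sup>2, r) =
       k *\<^sub>R wedge (u1 + (r + x) *\<^sub>R f1 + y *\<^sub>R f2) (u2 + y *\<^sub>R f1 + (r - x) *\<^sub>R f2)"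
    "omega u1 u2 = 0" "omega f1 f2 = 0" "omega u1 f2 = 0" "omega f1 u2 = 0" "omega u2 f2 = omega u1 f1" "omega u1 f1 \<noteq> 0"
proof -
  let ?O = "(0,0,1,0,0) :: vec5" let ?I = "(0,0,0,1,0) :: vec5"
  let ?N1 = "(1,0,0,0,1) :: vec5" let ?N2 = "(-1,0,0,0,1) :: vec5" let ?N3 = "(0,1,0,0,1) :: vec5"
  obtain u1 u2 f1 f2 \<kappa>1 \<kappa>2 \<kappa>3 \<kappa>4 where
    O: "\<Phi>6 ?O = \<kappa>1 *\<^sub>R wedge u1 u2" and N1: "\<Phi>6 ?N1 = \<kappa>2 *\<^sub>R wedge f1 u2"
    and N2: "\<Phi>6 ?N2 = \<kappa>3 *\<^sub>R wedge u1 f2" and I: "\<Phi>6 ?I = \<kappa>4 *\<^sub>R wedge f1 f2"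
    and lO: "lie_line \<Phi> ?O = span {u1, u2}" and lI: "lie_line \<Phi> ?I = span {f1, f2}"
    by (rule skew_quadrilateral)
  have lc: "lie_circle ?O" "lie_circle ?I" "lie_circle ?N3"
    by (simp_all add: lie_circle_def lie_form_def zero_prod_def)
  have lf: "lie_form ?O ?N3 = 0" "lie_form ?I ?N3 = 0" "lie_form ?O ?I \<noteq> 0"
    by (simp_all add: lie_form_def)
  obtain u where u: "u \<in> lie_line \<Phi> ?O" "u \<in> lie_line \<Phi> ?N3" "u \<noteq> 0" using lines_meet lc lf by metis
  obtain f where f: "f \<in> lie_line \<Phi> ?I" "f \<in> lie_line \<Phi> ?N3" "f \<noteq> 0" using lines_meet lc lf by metis
  have "wedge u f \<noteq> 0" using wedge_nonzero_if_skew[OF lc(1,2) lf(3)] u f by blast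
  then obtain \<kappa>5 where N3: "\<Phi>6 ?N3 = \<kappa>5 *\<^sub>R wedge u f"
    using line_basis[OF lc(3) u(2) f(2)] by metis
  obtain s1 s2 where us: "u = s1 *\<^sub>R u1 + s2 *\<^sub>R u2" using u(1) lO by (metis mem_span_pairE)
  obtain t1 t2 where ft: "f = t1 *\<^sub>R f1 + t2 *\<^sub>R f2" using f(1) lI by (metis mem_span_pairE)
  define D where "D = d4 u1 u2 f1 f2"
  have dz: "d4 a a b c = 0" "d4 a b a c = 0" "d4 a b c a = 0" "d4 b a a c = 0" "d4 b a c a = 0" "d4 b c a a = 0" for a b c
    by (simp_all add: d4_def plucker_def algebra_simps)
  have dD: "d4 u1 f2 f1 u2 = - D" "d4 u2 f1 u1 f2 = D" "d4 f1 u2 u1 f2 = - D"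
    by (simp_all add: D_def d4_def plucker_def algebra_simps)
  have "pol6 (\<Phi>6 ?O) (\<Phi>6 ?I) = -1/2" "pol6 (\<Phi>6 ?N1) (\<Phi>6 ?N2) = -2"
    "pol6 (\<Phi>6 ?N3) (\<Phi>6 ?N1) = -1" "pol6 (\<Phi>6 ?N3) (\<Phi>6 ?N2) = -1"
    "pol6 (\<Phi>6 ?N3) (\<Phi>6 ?N3) = 0"
    unfolding pol6_\<Phi> by (simp_all add: lie_form_def)
  then have e14: "\<kappa>1 * \<kappa>4 * D = -1/2" and e23: "\<kappa>2 * \<kappa>3 * D = 2"
    and e52: "\<kappa>5 * s1 * t2 * \<kappa>2 * D = 1" and e53: "\<kappa>5 * s2 * t1 * \<kappa>3 * D = -1"
    by (simp_all add: O I N1 N2 N3 us ft wedge_add_left wedge_add_right wedge_scale_left wedge_scale_right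
        pol6_add_left pol6_add_right pol6_scale_left pol6_scale_right pol6_wedge dD dz D_def[symmetric] mult_ac)
  have nz: "D \<noteq> 0" "\<kappa>1 \<noteq> 0" "\<kappa>2 \<noteq> 0" "\<kappa>3 \<noteq> 0" "\<kappa>4 \<noteq> 0" "\<kappa>5 \<noteq> 0" "s1 \<noteq> 0" "s2 \<noteq> 0" "t1 \<noteq> 0" "t2 \<noteq> 0"
    using e14 e23 e52 e53 by auto
  \<comment> \<open>Comparison with the desired matrix fixes the rescaling of \<open>u2\<close>,
    \<open>f1\<close> and \<open>f2\<close> in terms of \<open>k\<close>, by the coefficients of
    \<open>?O\<close>, \<open>?N3\<close> and \<open>?N2\<close>; then \<open>?N1\<close> fixes
    \<open>k\<close>. The other coefficients agree because of the values of the Lie form.\<close>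
  define A where "A = \<kappa>5 * s1 * t1"
  define k where "k = 2 * A * \<kappa>1 / \<kappa>2"
  have nz2: "A \<noteq> 0" "k \<noteq> 0" using nz by (auto simp: A_def k_def)
  have k3: "\<kappa>3 = 2 / (\<kappa>2 * D)" and k4: "\<kappa>4 = -1 / (2 * \<kappa>1 * D)"
    using e23 e14 nz by (simp_all add: field_simps)
  have st: "\<kappa>5 * s1 * t2 = \<kappa>3 / 2" "\<kappa>5 * s2 * t1 = - \<kappa>2 / 2"
    using e52 e53 nz unfolding k3 by (simp_all add: field_simps)
  have AB: "\<kappa>5 * s2 * t2 = - 1 / (2 * A * D)"
  proof -
    have "A * (\<kappa>5 * s2 * t2) = (\<kappa>5 * s1 * t2) * (\<kappa>5 * s2 * t1)" by (simp add: A_def)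
    also have "\<dots> = - 1 / (2 * D)" unfolding st k3 using nz by (simp add: field_simps)
    finally show ?thesis using nz nz2 by (simp add: field_simps)
  qed
  define U2 where "U2 = (\<kappa>1 / k) *\<^sub>R u2"
  define F1 where "F1 = (A / k) *\<^sub>R f1"
  define F2 where "F2 = (\<kappa>3 / (2 * k)) *\<^sub>R f2"
  have u2: "u2 = (k / \<kappa>1) *\<^sub>R U2" and f1: "f1 = (k / A) *\<^sub>R F1" and f2: "f2 = (2 * k / \<kappa>3) *\<^sub>R F2"
    using nz nz2 by (simp_all add: U2_def F1_def F2_def)
  have c: "\<kappa>2 * (k / A) * (k / \<kappa>1) = 2 * k" "\<kappa>4 * (k / A) * (2 * k / \<kappa>3) = - k"
     "(\<kappa>5 * s2 * t2) * (k / \<kappa>1) * (2 * k / \<kappa>3) = - k"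
    unfolding AB k4 k3 using nz nz2 by (simp_all add: k_def field_simps)
  have O': "\<Phi>6 ?O = k *\<^sub>R wedge u1 U2" and N1': "\<Phi>6 ?N1 = (2 * k) *\<^sub>R wedge F1 U2"
    and N2': "\<Phi>6 ?N2 = (2 * k) *\<^sub>R wedge u1 F2" and I': "\<Phi>6 ?I = (- k) *\<^sub>R wedge F1 F2"
    unfolding O N1 N2 I u2 f1 f2 wedge_scale_left wedge_scale_right scaleR_scaleR
    using c nz by (simp_all add: mult_ac)
  have "\<Phi>6 ?N3 = A *\<^sub>R wedge u1 f1 + (\<kappa>5 * s1 * t2) *\<^sub>R wedge u1 f2 + (\<kappa>5 * s2 * t1) *\<^sub>R wedge u2 f1
      + (\<kappa>5 * s2 * t2) *\<^sub>R wedge u2 f2"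
    unfolding N3 us ft A_def wedge_add_left wedge_add_right wedge_scale_left wedge_scale_right scaleR_scaleR
      scaleR_add_right by (simp add: mult_ac)
  also have "\<dots> = k *\<^sub>R wedge u1 F1 + k *\<^sub>R wedge u1 F2 + k *\<^sub>R wedge F1 U2 + (- k) *\<^sub>R wedge U2 F2"
  proof -
    have e1: "A * (k / A) = k" using nz2 by simp
    have e2: "\<kappa>5 * s1 * t2 * (2 * k / \<kappa>3) = k" unfolding st using nz by simp
    have e3: "\<kappa>5 * s2 * t1 * ((k / \<kappa>1) * (k / A)) = - k" unfolding st using c(1) by (simp add: mult_ac)
    have e4: "(\<kappa>5 * s2 * t2) * ((k / \<kappa>1) * (2 * k / \<kappa>3)) = - k" using c(3) by (simp only: mult.assoc)
    note e = e1 e2 e3 e4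
    have w: "wedge u1 f1 = (k / A) *\<^sub>R wedge u1 F1" "wedge u1 f2 = (2 * k / \<kappa>3) *\<^sub>R wedge u1 F2"
      "wedge u2 f1 = ((k / \<kappa>1) * (k / A)) *\<^sub>R wedge U2 F1" "wedge u2 f2 = ((k / \<kappa>1) * (2 * k / \<kappa>3)) *\<^sub>R wedge U2 F2"
      by (simp_all add: u2 f1 f2 wedge_scale_left wedge_scale_right mult.commute)
    show ?thesis
      unfolding w scaleR_scaleR e wedge_swap[of F1 U2] by simp
  qed
  finally have N3': "\<Phi>6 ?N3 = k *\<^sub>R wedge u1 F1 + k *\<^sub>R wedge u1 F2 + k *\<^sub>R wedge F1 U2 + (- k) *\<^sub>R wedge U2 F2" .
  \<comment> \<open>On lifted vectors the equation of the complex says that \<open>omega\<close>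
    vanishes. The four sides of the quadrilateral give four zeros, and \<open>?N3\<close> equates
    the two products that remain.\<close>
  have omega_snd: "omega a b = snd (snd (snd (snd (snd (wedge a b))))) - fst (wedge a b)" for a b
    by (simp add: omega_def wedge_def complex_coords_def)
  have omega_lift: "snd (snd (snd (snd (snd (\<Phi>6 V))))) - fst (\<Phi>6 V) = 0" for V by (simp add: lift6_def)
  have omz: "omega a b = 0" if "\<Phi>6 V = m *\<^sub>R wedge a b" "m \<noteq> 0" for a b m V
    using omega_lift[of V] that(2) unfolding that(1) by (simp add: omega_snd right_diff_distrib[symmetric])
  have oms: "omega u1 U2 = 0" "omega F1 F2 = 0" "omega u1 F2 = 0" "omega F1 U2 = 0"
    using omz[OF O'] omz[OF N1'] omz[OF N2'] omz[OF I'] nz2 by auto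
  have om4: "omega U2 F2 = omega u1 F1"
  proof -
    have "k * (omega u1 F1 - omega U2 F2) = 0"
      using omega_lift[of ?N3] oms unfolding N3' by (simp add: omega_snd algebra_simps)
    then show ?thesis using nz2 by simp
  qed
  have "D = (k / \<kappa>1) * (k / A) * (2 * k / \<kappa>3) * d4 u1 U2 F1 F2"
    unfolding D_def pol6_wedge[symmetric] u2 f1 f2 wedge_scale_left wedge_scale_right pol6_scale_left pol6_scale_right
    by (simp add: mult_ac)
  then have "d4 u1 U2 F1 F2 \<noteq> 0" using nz by auto
  then have om5: "omega u1 F1 \<noteq> 0" by (auto simp: d4_pfaffian oms om4)
  show ?thesis
  proof (rule that[OF nz2(2) _ oms(1,2,3,4) om4 om5])
    fix x y r :: real
    have "(x, y, 1, x\<^sup>2 + y\<^sup>2 - r\<^sup>2, r) = ?O + (x\<^sup>2 + y\<^sup>2 - r\<^sup>2) *\<^sub>R ?I + y *\<^sub>R ?N3 + ((x + r - y) / 2) *\<^sub>R ?N1 + ((r - y - x) / 2) *\<^sub>R ?N2"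
      by (simp add: field_simps)
    then have "\<Phi>6 (x, y, 1, x\<^sup>2 + y\<^sup>2 - r\<^sup>2, r) = \<Phi>6 ?O + (x\<^sup>2 + y\<^sup>2 - r\<^sup>2) *\<^sub>R \<Phi>6 ?I + y *\<^sub>R \<Phi>6 ?N3
      + ((x + r - y) / 2) *\<^sub>R \<Phi>6 ?N1 + ((r - y - x) / 2) *\<^sub>R \<Phi>6 ?N2"
      by (simp only: \<Phi>6_add \<Phi>6_scale)
    also have "\<dots> = k *\<^sub>R wedge (u1 + (r + x) *\<^sub>R F1 + y *\<^sub>R F2) (U2 + y *\<^sub>R F1 + (r - x) *\<^sub>R F2)"
    proof -
      have "((x + r - y) / 2) *\<^sub>R \<Phi>6 ?N1 = ((x + r - y) * k) *\<^sub>R wedge F1 U2"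
        "((r - y - x) / 2) *\<^sub>R \<Phi>6 ?N2 = ((r - y - x) * k) *\<^sub>R wedge u1 F2"
        by (simp_all add: N1' N2')
      note n = this
      show ?thesis
      unfolding O' I' N3' n wedge_add_left wedge_add_right wedge_scale_left wedge_scale_right wedge_self
        wedge_swap[of F1 F2] wedge_swap[of U2 F2]
      by (simp add: algebra_simps power2_eq_square)
    qed
    finally show "\<Phi>6 (x, y, 1, x\<^sup>2 + y\<^sup>2 - r\<^sup>2, r) =
       k *\<^sub>R wedge (u1 + (r + x) *\<^sub>R F1 + y *\<^sub>R F2) (U2 + y *\<^sub>R F1 + (r - x) *\<^sub>R F2)" .
  qed
qed

lemma model_exists: "\<exists>J c. lie_model \<Phi> J c"
proof -
  obtain u1 u2 f1 f2 k where k: "k \<noteq> 0" and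
    w: "\<And>x y r. \<Phi>6 (x, y, 1, x\<^sup>2 + y\<^sup>2 - r\<^sup>2, r) =
       k *\<^sub>R wedge (u1 + (r + x) *\<^sub>R f1 + y *\<^sub>R f2) (u2 + y *\<^sub>R f1 + (r - x) *\<^sub>R f2)"
    and oms: "omega u1 u2 = 0" "omega f1 f2 = 0" "omega u1 f2 = 0" "omega f1 u2 = 0" "omega u2 f2 = omega u1 f1" "omega u1 f1 \<noteq> 0"
    by (rule normal_basis) blast
  define J where "J = (\<lambda>\<xi> \<eta>. Re \<xi> *\<^sub>R u1 + Im \<xi> *\<^sub>R u2 + Re \<eta> *\<^sub>R f1 + Im \<eta> *\<^sub>R f2)"
  have "lie_model \<Phi> J (omega u1 f1)"
  proof
    show "omega u1 f1 \<noteq> 0" by fact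
    fix \<xi> \<eta> \<xi>' \<eta>' :: complex and a :: real
    show "J (\<xi> + \<xi>') (\<eta> + \<eta>') = J \<xi> \<eta> + J \<xi>' \<eta>'" "J (a *\<^sub>R \<xi>) (a *\<^sub>R \<eta>) = a *\<^sub>R J \<xi> \<eta>"
      by (simp_all add: J_def algebra_simps)
    show "omega (J \<xi> \<eta>) (J \<xi>' \<eta>') = omega u1 f1 * (Re (cnj \<xi> * \<eta>') - Re (cnj \<xi>' * \<eta>))"
      using oms omega_swap[of u1 u2] omega_swap[of f1 f2] omega_swap[of u1 f2] omega_swap[of f1 u2] omega_swap[of u2 f2] omega_swap[of u1 f1]
      by (simp add: J_def omega_bilinear algebra_simps)
  next
    fix z :: "real^2" and r :: real
    let ?x = "z$1" and ?y = "z$2"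
    let ?a = "u1 + (r + ?x) *\<^sub>R f1 + ?y *\<^sub>R f2" and ?b = "u2 + ?y *\<^sub>R f1 + (r - ?x) *\<^sub>R f2"
    have "lie_line \<Phi> (oriented_circle z r) = span {?a, ?b}"
      unfolding oriented_circle_def
      by (rule lie_line_wedge[of _ _ "1 / k"]) (use k in \<open>simp_all add: w zero_prod_def\<close>)
    also have "\<dots> = range (\<lambda>\<xi>. J \<xi> (of_real r * \<xi> + cpx z * cnj \<xi>))"
    proof -
      have "J (Complex s t) (of_real r * Complex s t + cpx z * cnj (Complex s t)) = s *\<^sub>R ?a + t *\<^sub>R ?b" for s t
        by (simp add: J_def algebra_simps)
      then show ?thesis unfolding span_pair_eq
        by (auto simp: image_iff) (metis complex.exhaust)+
    qed
    finally show "lie_line \<Phi> (oriented_circle z r) = range (\<lambda>\<xi>. J \<xi> (of_real r * \<xi> + cpx z * cnj \<xi>))" .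
  qed
  then show ?thesis by blast
qed

end

section \<open>Four points and four circles\<close>

lemma Re_mult_Re: "Re u * Re v = (Re (u * v) + Re (u * cnj v)) / 2"
  and Im_mult_Im: "Im u * Im v = (Re (u * cnj v) - Re (u * v)) / 2"
  by (simp_all add: field_simps)

lemma Re_imaginary_multiple: "w = \<i> * of_real a * u \<Longrightarrow> Re w = - a * Im u"
  by simp

lemma Re_minus_real_multiple: "Re (- of_real a * u) = - a * Re u"
  by simp

lemma Im_real_multiple: "Im (of_real a * u) = a * Im u"
  by simp

lemma unit_cnj: "cmod u = 1 \<Longrightarrow> u * cnj u = 1"
  by (simp add: complex_norm_square[symmetric])

lemma square_negative_Re:
  assumes "u\<^sup>2 * of_real p = of_real m" "m > 0" "p < 0"
  shows "Re u = 0"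
proof -
  have "Im (u\<^sup>2) * p = 0" "Re (u\<^sup>2) * p = m"
    using arg_cong[OF assms(1), of Im] arg_cong[OF assms(1), of Re] by simp_all
  then have "Im (u\<^sup>2) = 0" "Re (u\<^sup>2) < 0"
    using assms(2,3) by (auto simp: zero_less_mult_iff)
  then show ?thesis
    by (auto simp: power2_eq_square not_square_less_zero not_less)
qed

lemma square_positive_Im:
  assumes "u\<^sup>2 * of_real p = of_real m" "m > 0" "p > 0"
  shows "Im u = 0"
proof -
  have "(\<i> * u)\<^sup>2 * of_real (- p) = of_real m" using assms(1) by (simp add: power_mult_distrib)
  from square_negative_Re[OF this assms(2)] show ?thesis using assms(3) by simp
qed

text \<open>The points \<open>q i\<close> and the circles with centres \<open>z j\<close> and signed radii \<open>r j\<close> are the vertices of a cube,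
  those with equal indices being opposite. The \<open>\<xi> i j\<close> are spinors: square roots of the directions of
  the radii, determined up to sign.\<close>

locale tetra =
  fixes q z :: "'i \<Rightarrow> complex" and r :: "'i \<Rightarrow> real" and \<xi> :: "'i \<Rightarrow> 'i \<Rightarrow> complex"
  assumes q_eq: "i \<noteq> j \<Longrightarrow> q i = z j + of_real (r j) * (\<xi> i j)\<^sup>2"
    and unit: "i \<noteq> j \<Longrightarrow> cmod (\<xi> i j) = 1"
    and r_nonzero: "r j \<noteq> 0"
    and q_inj: "i \<noteq> j \<Longrightarrow> q i \<noteq> q j"
    and circles_distinct: "i \<noteq> j \<Longrightarrow> z i = z j \<Longrightarrow> \<bar>r i\<bar> \<noteq> \<bar>r j\<bar>"
begin

lemma xi_nonzero: "i \<noteq> j \<Longrightarrow> \<xi> i j \<noteq> 0"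
  using unit by fastforce

lemma cnj_xi: "i \<noteq> j \<Longrightarrow> cnj (\<xi> i j) = inverse (\<xi> i j)"
  using unit_cnj[OF unit] by (metis inverse_unique)

text \<open>Signed length of the chord of circle \<open>a\<close> between the points
  \<open>i\<close> and \<open>j\<close>; the sign depends on the choice of the spinors.\<close>

definition chord :: "'i \<Rightarrow> 'i \<Rightarrow> 'i \<Rightarrow> real" where
  "chord a i j = 2 * r a * Im (\<xi> i a * cnj (\<xi> j a))"

lemma chord_swap: "chord a j i = - chord a i j"
  by (simp add: chord_def algebra_simps)

text \<open>For unit spinors conjugation is inversion, so the difference of their squares is their
  product times twice the imaginary part of their quotient.\<close>

lemma q_diff:
  assumes "i \<noteq> a" "j \<noteq> a"
  shows "q i - q j = \<i> * of_real (chord a i j) * \<xi> i a * \<xi> j a"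
proof -
  have "q i - q j = of_real (r a) * ((\<xi> i a)\<^sup>2 - (\<xi> j a)\<^sup>2)"
    by (simp add: q_eq[OF assms(1)] q_eq[OF assms(2)] algebra_simps)
  also have "(\<xi> i a)\<^sup>2 - (\<xi> j a)\<^sup>2 = \<xi> i a * \<xi> j a * (\<xi> i a * cnj (\<xi> j a) - cnj (\<xi> i a * cnj (\<xi> j a)))"
    using assms by (simp add: power2_eq_square cnj_xi xi_nonzero field_simps)
  also have "\<xi> i a * cnj (\<xi> j a) - cnj (\<xi> i a * cnj (\<xi> j a)) = 2 * \<i> * of_real (Im (\<xi> i a * cnj (\<xi> j a)))"
    by (simp add: complex_eq_iff)
  finally show ?thesis by (simp add: chord_def mult_ac)
qed

lemma chord_nonzero: "i \<noteq> a \<Longrightarrow> j \<noteq> a \<Longrightarrow> i \<noteq> j \<Longrightarrow> chord a i j \<noteq> 0"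
  using q_diff[of i a j] q_inj[of i j] by auto

text \<open>Circles \<open>a\<close> and \<open>b\<close> share the points \<open>i\<close> and
  \<open>j\<close>. If their radii at \<open>i\<close> were parallel they would be tangent there and
  still meet again at \<open>j\<close>, hence they would coincide.\<close>

lemma not_tangent:
  assumes "distinct [a, b, i, j]"
  shows "(\<xi> i a)\<^sup>2 * cnj ((\<xi> i b)\<^sup>2) \<notin> \<real>"
proof
  assume R: "(\<xi> i a)\<^sup>2 * cnj ((\<xi> i b)\<^sup>2) \<in> \<real>"
  let ?e = "(\<xi> i b)\<^sup>2"
  have d: "i \<noteq> a" "i \<noteq> b" "j \<noteq> a" "j \<noteq> b" "i \<noteq> j" "a \<noteq> b" using assms by auto
  from R obtain s where s: "(\<xi> i a)\<^sup>2 * cnj ?e = of_real s" by (elim Reals_cases)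
  have ee: "cnj ?e * ?e = 1" by (simp add: power2_eq_square cnj_xi xi_nonzero d field_simps)
  have ea: "(\<xi> i a)\<^sup>2 = of_real s * ?e"
  proof -
    have "(\<xi> i a)\<^sup>2 = (\<xi> i a)\<^sup>2 * (cnj ?e * ?e)" by (simp only: ee mult_1_right)
    also have "\<dots> = of_real s * ?e" by (simp only: s mult.assoc[symmetric])
    finally show ?thesis .
  qed
  have "cmod ((\<xi> i a)\<^sup>2) = 1" "cmod ?e = 1" by (simp_all add: norm_power unit d)
  then have "\<bar>s\<bar> = 1" unfolding ea by (simp add: norm_mult)
  then have ss: "s * s = 1" by (metis abs_mult_self_eq mult_1)
  \<comment> \<open>That \<open>q j\<close> lies on circle \<open>c\<close>, written in terms of the
    direction \<open>e\<close> of the radius at \<open>q i\<close>. For parallel radii both circles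
    give the same equation, linear in the signed radius, with a non-zero coefficient.\<close>
  have far: "(cmod (q j - q i))\<^sup>2 + 2 * r c * Re ((q j - q i) * cnj e) = 0"
    if "q i - z c = of_real (r c) * e" "cmod e = 1" "c \<noteq> j" for c e
  proof -
    have "q j - z c = of_real (r c) * (\<xi> j c)\<^sup>2" using q_eq[of j c] that(3) by auto
    then have "cmod (q j - z c) = \<bar>r c\<bar>" using unit[of j c] that(3) by (simp add: norm_mult norm_power)
    then have n: "(cmod (q j - z c))\<^sup>2 = (r c)\<^sup>2" by simp
    have "q j - z c = (q j - q i) + of_real (r c) * e" unfolding that(1)[symmetric] by simp
    then have "(cmod (q j - z c))\<^sup>2 = (cmod (q j - q i))\<^sup>2 + 2 * r c * Re ((q j - q i) * cnj e) + (r c)\<^sup>2 * (cmod e)\<^sup>2"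
      unfolding cmod_power2 by (simp add: power2_eq_square algebra_simps)
    then show ?thesis using n that(2) by simp
  qed
  have za: "q i - z a = of_real (r a * s) * ?e" using q_eq[of i a] d by (simp add: ea)
  have zb: "q i - z b = of_real (r b) * ?e" using q_eq[of i b] d by simp
  have fa: "(cmod (q j - q i))\<^sup>2 + 2 * (r a * s) * Re ((q j - q i) * cnj ?e) = 0"
    using far[of a "of_real s * ?e"] za d \<open>\<bar>s\<bar> = 1\<close> \<open>cmod ?e = 1\<close> by (simp add: norm_mult algebra_simps)
  have fb: "(cmod (q j - q i))\<^sup>2 + 2 * r b * Re ((q j - q i) * cnj ?e) = 0"
    using far[of b ?e] zb d \<open>cmod ?e = 1\<close> by simp
  have "(cmod (q j - q i))\<^sup>2 \<noteq> 0" using q_inj[of i j] d by simp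
  then have "Re ((q j - q i) * cnj ?e) \<noteq> 0" using fb by auto
  moreover have "(r a * s - r b) * Re ((q j - q i) * cnj ?e) = 0"
    using fa fb by (simp add: algebra_simps)
  ultimately have rs: "r a * s = r b" by simp
  then have "q i - z a = q i - z b" unfolding za zb by (simp only:)
  then have "z a = z b" by simp
  moreover have "\<bar>r a\<bar> = \<bar>r b\<bar>" using rs \<open>\<bar>s\<bar> = 1\<close> by (metis abs_mult mult.right_neutral)
  ultimately show False using circles_distinct d by blast
qed

lemma Im_nonzero:
  assumes "distinct [a, b, i, j]"
  shows "Im (\<xi> i a * cnj (\<xi> i b)) \<noteq> 0"
proof
  assume "Im (\<xi> i a * cnj (\<xi> i b)) = 0"
  then have "\<xi> i a * cnj (\<xi> i b) \<in> \<real>" by (simp add: complex_is_Real_iff)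
  then have "(\<xi> i a * cnj (\<xi> i b))\<^sup>2 \<in> \<real>" by simp
  then show False using not_tangent[OF assms] by (simp add: power_mult_distrib)
qed

definition \<delta> :: "'i \<Rightarrow> 'i \<Rightarrow> 'i \<Rightarrow> 'i \<Rightarrow> real" where
  "\<delta> a j k l = chord a j k * chord a j l * chord a k l"

text \<open>By \<open>q_diff\<close> the spinors at \<open>k\<close> and \<open>l\<close> cancel
  against their conjugates. This expresses the direction of a radius by the points alone, up to i
  and a real factor.\<close>

lemma xi_squared:
  assumes "distinct [a, j, k, l]"
  shows "(q j - q k) * (q j - q l) * cnj (q k - q l) = \<i> * of_real (\<delta> a j k l) * (\<xi> j a)\<^sup>2"
proof -
  have d: "j \<noteq> a" "k \<noteq> a" "l \<noteq> a" using assms by auto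
  show ?thesis
    unfolding q_diff[OF d(1,2)] q_diff[OF d(1,3)] q_diff[OF d(2,3)]
    by (simp add: \<delta>_def power2_eq_square cnj_xi xi_nonzero d field_simps)
qed

text \<open>Signed form of the relation abc = 4 R S between sides, circumradius and area of a
  triangle.\<close>

lemma delta_area:
  assumes "distinct [a, j, k, l]"
  shows "\<delta> a j k l = - 2 * r a * Im (cnj (q k - q j) * (q l - q j))"
proof -
  have d: "j \<noteq> a" "k \<noteq> a" "l \<noteq> a" using assms by auto
  have "cnj (q k - q j) * (q l - q j) = of_real (chord a k j * chord a l j) * (\<xi> l a * cnj (\<xi> k a))"
    unfolding q_diff[OF d(2,1)] q_diff[OF d(3,1)] by (simp add: cnj_xi xi_nonzero d field_simps)
  then have "Im (cnj (q k - q j) * (q l - q j)) = chord a k j * chord a l j * Im (\<xi> l a * cnj (\<xi> k a))"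
    by simp
  then have "2 * r a * Im (cnj (q k - q j) * (q l - q j)) = chord a k j * chord a l j * chord a l k"
    by (simp add: chord_def)
  then show ?thesis by (simp add: \<delta>_def chord_swap[of a k j] chord_swap[of a l j] chord_swap[of a l k])
qed

text \<open>One inscribed triangle for each of the four circles; by \<open>delta_area\<close> this
  is 16 times the product of the signed radii and of the doubled oriented areas.\<close>

definition \<Delta> :: "'i \<Rightarrow> 'i \<Rightarrow> 'i \<Rightarrow> 'i \<Rightarrow> real" where
  "\<Delta> i j k l = \<delta> i j k l * \<delta> j i k l * \<delta> k i j l * \<delta> l i j k"

lemma Delta_swap: "\<Delta> j i k l = \<Delta> i j k l" "\<Delta> i k j l = \<Delta> i j k l" "\<Delta> i j l k = \<Delta> i j k l"
  unfolding \<Delta>_def \<delta>_def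
  by (simp_all add: chord_swap[of _ j i] chord_swap[of _ k j] chord_swap[of _ l k] mult_ac)

lemma Delta_nonzero: "distinct [i, j, k, l] \<Longrightarrow> \<Delta> i j k l \<noteq> 0"
  by (auto simp: \<Delta>_def \<delta>_def chord_nonzero)

text \<open>Each spinor is replaced through \<open>xi_squared\<close>, conjugated where the spinor
  is. The factors i cancel, and every difference of points meets its own conjugate.\<close>

lemma square_formula:
  assumes d: "distinct [a, b, c, d]"
  shows "(\<xi> c a * cnj (\<xi> c b) * cnj (\<xi> a c) * \<xi> a d)\<^sup>2 * of_real (\<Delta> a b c d) =
    of_real ((cmod ((q a - q b) * (q a - q c) * (q a - q d) * (q b - q c) * (q b - q d) * (q c - q d)))\<^sup>2)"
proof -
  have 1: "(q c - q b) * (q c - q d) * cnj (q b - q d) = \<i> * of_real (\<delta> a c b d) * (\<xi> c a)\<^sup>2"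
    and 2: "(q c - q a) * (q c - q d) * cnj (q a - q d) = \<i> * of_real (\<delta> b c a d) * (\<xi> c b)\<^sup>2"
    and 3: "(q a - q b) * (q a - q d) * cnj (q b - q d) = \<i> * of_real (\<delta> c a b d) * (\<xi> a c)\<^sup>2"
    and 4: "(q a - q b) * (q a - q c) * cnj (q b - q c) = \<i> * of_real (\<delta> d a b c) * (\<xi> a d)\<^sup>2"
    by (rule xi_squared; use d in auto)+
  have del: "\<Delta> a b c d = \<delta> a c b d * \<delta> b c a d * \<delta> c a b d * \<delta> d a b c"
    unfolding \<Delta>_def \<delta>_def by (simp add: chord_swap[of _ c b] chord_swap[of _ c a])
  have "(\<xi> c a * cnj (\<xi> c b) * cnj (\<xi> a c) * \<xi> a d)\<^sup>2 * of_real (\<Delta> a b c d) =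
    (\<i> * of_real (\<delta> a c b d) * (\<xi> c a)\<^sup>2) * cnj (\<i> * of_real (\<delta> b c a d) * (\<xi> c b)\<^sup>2)
    * cnj (\<i> * of_real (\<delta> c a b d) * (\<xi> a c)\<^sup>2) * (\<i> * of_real (\<delta> d a b c) * (\<xi> a d)\<^sup>2)"
    unfolding del by (simp add: power2_eq_square mult_ac)
  also have "\<dots> = ((q c - q b) * (q c - q d) * cnj (q b - q d)) * cnj ((q c - q a) * (q c - q d) * cnj (q a - q d))
     * cnj ((q a - q b) * (q a - q d) * cnj (q b - q d)) * ((q a - q b) * (q a - q c) * cnj (q b - q c))"
    unfolding 1 2 3 4 ..
  also have "\<dots> = ((q a - q b) * cnj (q a - q b)) * ((q a - q c) * cnj (q a - q c)) * ((q a - q d) * cnj (q a - q d))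
     * ((q b - q c) * cnj (q b - q c)) * ((q b - q d) * cnj (q b - q d)) * ((q c - q d) * cnj (q c - q d))"
  proof -
    define ab ac ad bc bd cd where "ab = q a - q b" "ac = q a - q c" "ad = q a - q d"
      "bc = q b - q c" "bd = q b - q d" "cd = q c - q d"
    note f = this
    have s: "q c - q b = - bc" "q c - q a = - ac" by (simp_all add: f)
    show ?thesis
      unfolding s f(1-6)[symmetric] by (simp add: mult_ac)
  qed
  also have "\<dots> = of_real ((cmod ((q a - q b) * (q a - q c) * (q a - q d) * (q b - q c) * (q b - q d) * (q c - q d)))\<^sup>2)"
    by (simp only: complex_norm_square[symmetric] norm_mult power_mult_distrib of_real_mult of_real_power)
  finally show ?thesis .
qed

lemma perp:
  assumes "distinct [a, b, c, d]" "\<Delta> a b c d < 0"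
  shows "Re (\<xi> c a * cnj (\<xi> c b) * cnj (\<xi> a c) * \<xi> a d) = 0"
proof (rule square_negative_Re[OF square_formula[OF assms(1)] _ assms(2)])
  have "q a \<noteq> q b" "q a \<noteq> q c" "q a \<noteq> q d" "q b \<noteq> q c" "q b \<noteq> q d" "q c \<noteq> q d"
    by (rule q_inj; use assms(1) in auto)+
  then show "0 < (cmod ((q a - q b) * (q a - q c) * (q a - q d) * (q b - q c) * (q b - q d) * (q c - q d)))\<^sup>2"
    by simp
qed

text \<open>In \<open>polar_of_contact\<close> this says that the image of a contact point is
  orthogonal to \<open>XX j l\<close>. By \<open>perp\<close> one half of each product of imaginary
  parts vanishes; what remains is the real part of the identity behind Ptolemy's theorem, whose
  third term vanishes by \<open>p3\<close>.\<close>

lemma correlation_identity: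
  assumes d: "distinct [i, j, k, l]" and neg: "\<Delta> i j k l < 0"
  shows "Im (\<xi> l i * cnj (\<xi> k i)) * Re (cnj (\<xi> i k) * cnj (\<xi> j i) * (q j - q i)) * Re (cnj (\<xi> i j) * cnj (\<xi> j l) * (q j - q i))
    + Im (\<xi> l i * cnj (\<xi> j i)) * Re (cnj (\<xi> k i) * cnj (\<xi> i j) * (q i - q k)) * Re (cnj (\<xi> i k) * cnj (\<xi> j l) * (q j - q i)) = 0"
    (is "?L = 0")
proof -
  have ne: "i \<noteq> j" "j \<noteq> i" "i \<noteq> k" "k \<noteq> i" "i \<noteq> l" "l \<noteq> i" "j \<noteq> k" "k \<noteq> j" "j \<noteq> l" "l \<noteq> j" "k \<noteq> l" "l \<noteq> k"
    using d by auto
  have p1: "Re (\<xi> j k * cnj (\<xi> j i) * cnj (\<xi> i l * cnj (\<xi> i j))) = 0"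
  proof -
    have "\<Delta> i k j l < 0" using neg Delta_swap by simp
    then have "Re (\<xi> j i * cnj (\<xi> j k) * cnj (\<xi> i j) * \<xi> i l) = 0" using perp d by auto
    moreover have "\<xi> j k * cnj (\<xi> j i) * cnj (\<xi> i l * cnj (\<xi> i j)) = cnj (\<xi> j i * cnj (\<xi> j k) * cnj (\<xi> i j) * \<xi> i l)"
      by (simp add: mult_ac)
    ultimately show ?thesis by (simp only: cnj.sel)
  qed
  have p2: "Re (\<xi> k j * cnj (\<xi> k i) * cnj (\<xi> i l * cnj (\<xi> i k))) = 0"
  proof -
    have "Re (\<xi> k i * cnj (\<xi> k j) * cnj (\<xi> i k) * \<xi> i l) = 0" using perp d neg by auto
    moreover have "\<xi> k j * cnj (\<xi> k i) * cnj (\<xi> i l * cnj (\<xi> i k)) = cnj (\<xi> k i * cnj (\<xi> k j) * cnj (\<xi> i k) * \<xi> i l)"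
      by (simp add: mult_ac)
    ultimately show ?thesis by (simp only: cnj.sel)
  qed
  have p3: "Re (\<xi> l j * cnj (\<xi> l i) * \<xi> i l * cnj (\<xi> i k)) = 0"
  proof -
    have "\<Delta> i j l k < 0" using neg Delta_swap by simp
    then have "Re (\<xi> l i * cnj (\<xi> l j) * cnj (\<xi> i l) * \<xi> i k) = 0" using perp d by auto
    moreover have "\<xi> l j * cnj (\<xi> l i) * \<xi> i l * cnj (\<xi> i k) = cnj (\<xi> l i * cnj (\<xi> l j) * cnj (\<xi> i l) * \<xi> i k)"
      by (simp add: mult_ac)
    ultimately show ?thesis by (simp only: cnj.sel)
  qed
  let ?a = "Im (\<xi> l i * cnj (\<xi> k i))" and ?b = "Im (\<xi> l i * cnj (\<xi> j i))"
  have e1: "Re (cnj (\<xi> i k) * cnj (\<xi> j i) * (q j - q i)) = - chord k j i * Im (\<xi> j k * cnj (\<xi> j i))"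
  proof -
    have "cnj (\<xi> i k) * cnj (\<xi> j i) * (q j - q i) = \<i> * of_real (chord k j i) * (\<xi> j k * cnj (\<xi> j i))"
      unfolding q_diff[OF ne(7,3)] by (simp add: cnj_xi xi_nonzero ne field_simps)
    then show ?thesis by (rule Re_imaginary_multiple)
  qed
  have e2: "Re (cnj (\<xi> i j) * cnj (\<xi> j l) * (q j - q i)) = - chord l j i * Im (\<xi> i l * cnj (\<xi> i j))"
  proof -
    have "cnj (\<xi> i j) * cnj (\<xi> j l) * (q j - q i) = \<i> * of_real (chord l j i) * (\<xi> i l * cnj (\<xi> i j))"
      unfolding q_diff[OF ne(9,5)] by (simp add: cnj_xi xi_nonzero ne field_simps)
    then show ?thesis by (rule Re_imaginary_multiple)
  qed
  have e3: "Re (cnj (\<xi> k i) * cnj (\<xi> i j) * (q i - q k)) = - chord j i k * Im (\<xi> k j * cnj (\<xi> k i))"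
  proof -
    have "cnj (\<xi> k i) * cnj (\<xi> i j) * (q i - q k) = \<i> * of_real (chord j i k) * (\<xi> k j * cnj (\<xi> k i))"
      unfolding q_diff[OF ne(1,8)] by (simp add: cnj_xi xi_nonzero ne field_simps)
    then show ?thesis by (rule Re_imaginary_multiple)
  qed
  have e4: "Re (cnj (\<xi> i k) * cnj (\<xi> j l) * (q j - q i)) = - chord l j i * Im (\<xi> i l * cnj (\<xi> i k))"
  proof -
    have "cnj (\<xi> i k) * cnj (\<xi> j l) * (q j - q i) = \<i> * of_real (chord l j i) * (\<xi> i l * cnj (\<xi> i k))"
      unfolding q_diff[OF ne(9,5)] by (simp add: cnj_xi xi_nonzero ne field_simps)
    then show ?thesis by (rule Re_imaginary_multiple)
  qed
  have s1: "Im (\<xi> j k * cnj (\<xi> j i)) * Im (\<xi> i l * cnj (\<xi> i j)) = - Re (\<xi> j k * cnj (\<xi> j i) * (\<xi> i l * cnj (\<xi> i j))) / 2"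
    unfolding Im_mult_Im p1 by simp
  have s2: "Im (\<xi> k j * cnj (\<xi> k i)) * Im (\<xi> i l * cnj (\<xi> i k)) = - Re (\<xi> k j * cnj (\<xi> k i) * (\<xi> i l * cnj (\<xi> i k))) / 2"
    unfolding Im_mult_Im p2 by simp
  \<comment> \<open>The common phase that turns all three products of differences into real
    multiples of the spinor products in question.\<close>
  define \<omega> where "\<omega> = cnj (\<xi> l i) * cnj (\<xi> k i) * cnj (\<xi> j i) * cnj (\<xi> i k) * cnj (\<xi> i j) * \<xi> i l"
  have w1: "(q l - q k) * (q j - q i) * \<omega> = - of_real (chord i l k * chord k j i) * (\<xi> j k * cnj (\<xi> j i) * (\<xi> i l * cnj (\<xi> i j)))"
    unfolding q_diff[OF ne(6,4)] q_diff[OF ne(7,3)] \<omega>_def by (simp add: cnj_xi xi_nonzero ne field_simps)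
  have w2: "(q l - q j) * (q i - q k) * \<omega> = - of_real (chord i l j * chord j i k) * (\<xi> k j * cnj (\<xi> k i) * (\<xi> i l * cnj (\<xi> i k)))"
    unfolding q_diff[OF ne(6,2)] q_diff[OF ne(1,8)] \<omega>_def by (simp add: cnj_xi xi_nonzero ne field_simps)
  have w3: "(q l - q i) * (q j - q k) * \<omega> = - of_real (chord j l i * chord i j k) * (\<xi> l j * cnj (\<xi> l i) * \<xi> i l * cnj (\<xi> i k))"
    unfolding q_diff[OF ne(10,1)] q_diff[OF ne(2,4)] \<omega>_def by (simp add: cnj_xi xi_nonzero ne field_simps)
  have "(q l - q k) * (q j - q i) * \<omega> + (q l - q j) * (q i - q k) * \<omega> = (q l - q i) * (q j - q k) * \<omega>"
    by (simp add: algebra_simps)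
  from arg_cong[OF this, of Re]
  have "chord i l k * chord k j i * Re (\<xi> j k * cnj (\<xi> j i) * (\<xi> i l * cnj (\<xi> i j)))
    + chord i l j * chord j i k * Re (\<xi> k j * cnj (\<xi> k i) * (\<xi> i l * cnj (\<xi> i k)))
    = chord j l i * chord i j k * Re (\<xi> l j * cnj (\<xi> l i) * \<xi> i l * cnj (\<xi> i k))"
    unfolding w1 w2 w3 plus_complex.sel Re_minus_real_multiple by simp
  then have "chord i l k * chord k j i * Re (\<xi> j k * cnj (\<xi> j i) * (\<xi> i l * cnj (\<xi> i j)))
    + chord i l j * chord j i k * Re (\<xi> k j * cnj (\<xi> k i) * (\<xi> i l * cnj (\<xi> i k))) = 0"
    unfolding p3 by simp
  moreover have "2 * r i * ?L = - (chord l j i / 2) *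
    (chord i l k * chord k j i * Re (\<xi> j k * cnj (\<xi> j i) * (\<xi> i l * cnj (\<xi> i j)))
    + chord i l j * chord j i k * Re (\<xi> k j * cnj (\<xi> k i) * (\<xi> i l * cnj (\<xi> i k))))"
  proof -
    have c: "2 * r i * ?a = chord i l k" "2 * r i * ?b = chord i l j" by (simp_all add: chord_def)
    have "2 * r i * ?L = (2 * r i * ?a) * chord k j i * chord l j i * (Im (\<xi> j k * cnj (\<xi> j i)) * Im (\<xi> i l * cnj (\<xi> i j)))
      + (2 * r i * ?b) * chord j i k * chord l j i * (Im (\<xi> k j * cnj (\<xi> k i)) * Im (\<xi> i l * cnj (\<xi> i k)))"
      unfolding e1 e2 e3 e4 by (simp only: distrib_left mult_minus_left mult_minus_right minus_minus mult_ac)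
    also have "\<dots> = - (chord l j i / 2) *
    (chord i l k * chord k j i * Re (\<xi> j k * cnj (\<xi> j i) * (\<xi> i l * cnj (\<xi> i j)))
    + chord i l j * chord j i k * Re (\<xi> k j * cnj (\<xi> k i) * (\<xi> i l * cnj (\<xi> i k))))"
      unfolding s1 s2 c by (simp add: field_simps del: times_complex.sel)
    finally show ?thesis .
  qed
  ultimately have "2 * r i * ?L = 0" by (simp only: mult_zero_right)
  then show ?thesis using r_nonzero[of i] by simp
qed

text \<open>The Pfaffian of the symplectic products of the contact points \<open>XX i j\<close>,
  \<open>XX j i\<close>, \<open>XX k l\<close>, \<open>XX l k\<close> on four parallel edges,
  without the constant of the model.\<close>

definition pf :: "'i \<Rightarrow> 'i \<Rightarrow> 'i \<Rightarrow> 'i \<Rightarrow> real" where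
  "pf i j k l =
     Re (cnj (\<xi> i j) * cnj (\<xi> j i) * (q j - q i)) * Re (cnj (\<xi> k l) * cnj (\<xi> l k) * (q l - q k))
   - Re (cnj (\<xi> i j) * cnj (\<xi> k l) * (q k - q i)) * Re (cnj (\<xi> j i) * cnj (\<xi> l k) * (q l - q j))
   + Re (cnj (\<xi> i j) * cnj (\<xi> l k) * (q l - q i)) * Re (cnj (\<xi> j i) * cnj (\<xi> k l) * (q k - q j))"

text \<open>\<open>T1\<close>, \<open>T2\<close> and \<open>T3\<close> are the halves
  \<open>u * cnj v\<close> that \<open>Re_mult_Re\<close> yields for the three products in
  \<open>pf\<close>.\<close>

definition T1 :: "'i \<Rightarrow> 'i \<Rightarrow> 'i \<Rightarrow> 'i \<Rightarrow> complex" where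
  "T1 i j k l = cnj (\<xi> i j) * cnj (\<xi> j i) * (q j - q i) * cnj (cnj (\<xi> k l) * cnj (\<xi> l k) * (q l - q k))"

definition T2 :: "'i \<Rightarrow> 'i \<Rightarrow> 'i \<Rightarrow> 'i \<Rightarrow> complex" where
  "T2 i j k l = cnj (\<xi> i j) * cnj (\<xi> k l) * (q k - q i) * cnj (cnj (\<xi> j i) * cnj (\<xi> l k) * (q l - q j))"

definition T3 :: "'i \<Rightarrow> 'i \<Rightarrow> 'i \<Rightarrow> 'i \<Rightarrow> complex" where
  "T3 i j k l = cnj (\<xi> i j) * cnj (\<xi> l k) * (q l - q i) * cnj (cnj (\<xi> j i) * cnj (\<xi> k l) * (q k - q j))"

text \<open>The other halves of the three products cancel by the identity behind Ptolemy's theorem.\<close>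

lemma pf_T: "pf i j k l = (Re (T1 i j k l) - Re (T2 i j k l) + Re (T3 i j k l)) / 2"
proof -
  let ?A = "cnj (\<xi> i j)" and ?B = "cnj (\<xi> j i)" and ?C = "cnj (\<xi> k l)" and ?D = "cnj (\<xi> l k)"
  have "(?A * ?B * (q j - q i)) * (?C * ?D * (q l - q k)) - (?A * ?C * (q k - q i)) * (?B * ?D * (q l - q j))
    + (?A * ?D * (q l - q i)) * (?B * ?C * (q k - q j)) = 0"
    by (simp add: algebra_simps)
  from arg_cong[OF this, of Re]
  have "Re ((?A * ?B * (q j - q i)) * (?C * ?D * (q l - q k))) - Re ((?A * ?C * (q k - q i)) * (?B * ?D * (q l - q j)))
    + Re ((?A * ?D * (q l - q i)) * (?B * ?C * (q k - q j))) = 0"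
    by (simp only: plus_complex.sel minus_complex.sel zero_complex.sel)
  then show ?thesis
    unfolding pf_def Re_mult_Re T1_def T2_def T3_def by argo
qed

text \<open>As in \<open>square_formula\<close>: one spinor from each of the four circles occurs in
  each term, so squaring brings in each factor of \<open>\<Delta>\<close> once, and the two
  conjugated factors i cancel the other two.\<close>

lemma T_squares:
  assumes d: "distinct [i, j, k, l]"
  defines "m \<equiv> (q i - q j) * (q i - q k) * (q i - q l) * (q j - q k) * (q j - q l) * (q k - q l)"
  shows "(T1 i j k l)\<^sup>2 * of_real (\<Delta> i j k l) = of_real ((cmod m)\<^sup>2 * (cmod ((q i - q j) * (q k - q l)))\<^sup>2)"
    and "(T2 i j k l)\<^sup>2 * of_real (\<Delta> i j k l) = of_real ((cmod m)\<^sup>2 * (cmod ((q i - q k) * (q j - q l)))\<^sup>2)"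
    and "(T3 i j k l)\<^sup>2 * of_real (\<Delta> i j k l) = of_real ((cmod m)\<^sup>2 * (cmod ((q i - q l) * (q j - q k)))\<^sup>2)"
proof -
  define ij ik il jk jl kl where "ij = q i - q j" "ik = q i - q k" "il = q i - q l"
      "jk = q j - q k" "jl = q j - q l" "kl = q k - q l"
  note f = this
  have s: "q j - q i = - ij" "q k - q i = - ik" "q l - q i = - il" "q k - q j = - jk" "q l - q j = - jl" "q l - q k = - kl"
    by (simp_all add: f)
  have dd: "distinct [j, i, k, l]" "distinct [l, k, i, j]" "distinct [k, l, i, j]" using d by auto
  have 1: "ik * il * cnj kl = \<i> * of_real (\<delta> j i k l) * (\<xi> i j)\<^sup>2"
    and 2: "jk * jl * cnj kl = \<i> * of_real (\<delta> i j k l) * (\<xi> j i)\<^sup>2"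
    and 3: "ik * jk * cnj ij = \<i> * of_real (\<delta> l i j k) * (\<xi> k l)\<^sup>2"
    and 4: "il * jl * cnj ij = \<i> * of_real (\<delta> k i j l) * (\<xi> l k)\<^sup>2"
    using xi_squared[OF dd(1)] xi_squared[OF d] xi_squared[OF dd(2)] xi_squared[OF dd(3)]
    unfolding s f(1-6)[symmetric] \<delta>_def
    by (simp_all add: chord_swap[of _ k i] chord_swap[of _ k j] chord_swap[of _ l i] chord_swap[of _ l j] mult_ac)
  have sq: "of_real ((cmod x)\<^sup>2 * (cmod y)\<^sup>2) = x * cnj x * (y * cnj y)" for x y
    by (simp only: complex_norm_square of_real_mult)
  have del: "of_real (\<Delta> i j k l) = of_real (\<delta> j i k l) * of_real (\<delta> i j k l) * of_real (\<delta> l i j k) * (of_real (\<delta> k i j l) :: complex)"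
    by (simp add: \<Delta>_def)
  have "(T1 i j k l)\<^sup>2 * of_real (\<Delta> i j k l) = cnj (ik * il * cnj kl) * cnj (jk * jl * cnj kl) * (ik * jk * cnj ij) * (il * jl * cnj ij)
     * (ij * cnj kl)\<^sup>2"
    unfolding 1 2 3 4 T1_def s del by (simp add: power2_eq_square mult_ac)
  then show "(T1 i j k l)\<^sup>2 * of_real (\<Delta> i j k l) = of_real ((cmod m)\<^sup>2 * (cmod ((q i - q j) * (q k - q l)))\<^sup>2)"
    unfolding sq m_def f(1-6)[symmetric] by (simp add: power2_eq_square mult_ac)
  have "(T2 i j k l)\<^sup>2 * of_real (\<Delta> i j k l) = cnj (ik * il * cnj kl) * (jk * jl * cnj kl) * cnj (ik * jk * cnj ij) * (il * jl * cnj ij)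
     * (ik * cnj jl)\<^sup>2"
    unfolding 1 2 3 4 T2_def s del by (simp add: power2_eq_square mult_ac)
  then show "(T2 i j k l)\<^sup>2 * of_real (\<Delta> i j k l) = of_real ((cmod m)\<^sup>2 * (cmod ((q i - q k) * (q j - q l)))\<^sup>2)"
    unfolding sq m_def f(1-6)[symmetric] by (simp add: power2_eq_square mult_ac)
  have "(T3 i j k l)\<^sup>2 * of_real (\<Delta> i j k l) = cnj (ik * il * cnj kl) * (jk * jl * cnj kl) * (ik * jk * cnj ij) * cnj (il * jl * cnj ij)
     * (il * cnj jk)\<^sup>2"
    unfolding 1 2 3 4 T3_def s del by (simp add: power2_eq_square mult_ac)
  then show "(T3 i j k l)\<^sup>2 * of_real (\<Delta> i j k l) = of_real ((cmod m)\<^sup>2 * (cmod ((q i - q l) * (q j - q k)))\<^sup>2)"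
    unfolding sq m_def f(1-6)[symmetric] by (simp add: power2_eq_square mult_ac)
qed

text \<open>A real cross ratio makes \<open>u * cnj v\<close> real, and comparing the chord from
  \<open>j\<close> to \<open>l\<close> on the circles \<open>i\<close> and \<open>k\<close> makes
  \<open>u * v\<close> real. Then the square of \<open>u\<close> is real, so these circles would be
  tangent at the point \<open>j\<close>.\<close>

lemma not_concyclic:
  assumes d: "distinct [i, j, k, l]"
  shows "Im ((q i - q j) * (q k - q l) * cnj ((q i - q l) * (q j - q k))) \<noteq> 0"
proof
  have ne: "i \<noteq> j" "j \<noteq> i" "i \<noteq> k" "k \<noteq> i" "i \<noteq> l" "l \<noteq> i" "j \<noteq> k" "k \<noteq> j" "j \<noteq> l" "l \<noteq> j" "k \<noteq> l" "l \<noteq> k"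
    using d by auto
  assume 0: "Im ((q i - q j) * (q k - q l) * cnj ((q i - q l) * (q j - q k))) = 0"
  define u where "u = \<xi> j k * cnj (\<xi> j i)"
  define v where "v = \<xi> l k * cnj (\<xi> l i)"
  have "(q i - q j) * (q k - q l) * cnj ((q i - q l) * (q j - q k)) =
      of_real (chord k i j * chord i k l * chord k i l * chord i j k) * (u * cnj v)"
    unfolding q_diff[OF ne(3,7)] q_diff[OF ne(4,6)] q_diff[OF ne(3,12)] q_diff[OF ne(2,4)] u_def v_def
    by (simp add: cnj_xi xi_nonzero ne field_simps)
  from arg_cong[OF this, of Im] 0
  have "chord k i j * chord i k l * chord k i l * chord i j k * Im (u * cnj v) = 0"
    unfolding 0 Im_real_multiple by simp
  then have "Im (u * cnj v) = 0" using chord_nonzero ne by simp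
  then have r1: "u * cnj v \<in> \<real>" by (simp add: complex_is_Real_iff)
  have "\<i> * of_real (chord k j l) * \<xi> j k * \<xi> l k = \<i> * of_real (chord i j l) * \<xi> j i * \<xi> l i"
    using q_diff[OF ne(7,12)] q_diff[OF ne(2,6)] by simp
  then have "of_real (chord k j l) * (u * v) = of_real (chord i j l)"
    by (simp add: u_def v_def cnj_xi xi_nonzero ne field_simps)
  then have "u * v = of_real (chord i j l / chord k j l)"
    using chord_nonzero[of j k l] ne by (simp add: field_simps)
  then have r2: "u * v \<in> \<real>" by simp
  have "cmod v = 1" by (simp add: v_def norm_mult unit ne)
  then have "v * cnj v = 1" by (rule unit_cnj)
  then have "u\<^sup>2 = (u * v) * (u * cnj v)" by (simp add: power2_eq_square)
  then have "u\<^sup>2 \<in> \<real>" using r1 r2 by simp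
  then show False using not_tangent[of k i j l] d by (auto simp: u_def power_mult_distrib)
qed

text \<open>For positive \<open>\<Delta>\<close> the three terms have the moduli of the products of opposite sides of the
  quadrilateral of the points, and a zero would be a case of equality in Ptolemy's inequality.\<close>

lemma pf_zero_iff:
  assumes d: "distinct [i, j, k, l]"
  shows "pf i j k l = 0 \<longleftrightarrow> \<Delta> i j k l < 0"
proof -
  have ne: "i \<noteq> j" "j \<noteq> i" "i \<noteq> k" "k \<noteq> i" "i \<noteq> l" "l \<noteq> i" "j \<noteq> k" "k \<noteq> j" "j \<noteq> l" "l \<noteq> j" "k \<noteq> l" "l \<noteq> k"
    using d by auto
  define m where "m = (q i - q j) * (q i - q k) * (q i - q l) * (q j - q k) * (q j - q l) * (q k - q l)"
  have qn: "q i \<noteq> q j" "q i \<noteq> q k" "q i \<noteq> q l" "q j \<noteq> q k" "q j \<noteq> q l" "q k \<noteq> q l" using q_inj ne by auto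
  have pos: "0 < (cmod m)\<^sup>2 * (cmod ((q i - q j) * (q k - q l)))\<^sup>2" "0 < (cmod m)\<^sup>2 * (cmod ((q i - q k) * (q j - q l)))\<^sup>2"
    "0 < (cmod m)\<^sup>2 * (cmod ((q i - q l) * (q j - q k)))\<^sup>2"
    using qn by (simp_all add: m_def)
  note sq = T_squares[OF d, folded m_def]
  show ?thesis
  proof (cases "\<Delta> i j k l < 0")
    case True
    then have "Re (T1 i j k l) = 0" "Re (T2 i j k l) = 0" "Re (T3 i j k l) = 0"
      using square_negative_Re sq pos by blast+
    then show ?thesis using True by (simp add: pf_T)
  next
    case False
    then have pos': "\<Delta> i j k l > 0" using Delta_nonzero[OF d] by linarith
    have "Im (T1 i j k l) = 0" "Im (T2 i j k l) = 0" "Im (T3 i j k l) = 0"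
      using square_positive_Im[OF _ _ pos'] sq pos by blast+
    then have re: "\<bar>Re (T1 i j k l)\<bar> = cmod (T1 i j k l)" "\<bar>Re (T2 i j k l)\<bar> = cmod (T2 i j k l)" "\<bar>Re (T3 i j k l)\<bar> = cmod (T3 i j k l)"
      by (simp_all add: cmod_eq_Re)
    let ?A = "(q i - q j) * (q k - q l)" and ?B = "(q i - q k) * (q j - q l)" and ?C = "(q i - q l) * (q j - q k)"
    have n: "cmod (T1 i j k l) = cmod ?A" "cmod (T2 i j k l) = cmod ?B" "cmod (T3 i j k l) = cmod ?C"
      unfolding T1_def T2_def T3_def by (simp_all add: norm_mult unit ne norm_minus_commute del: complex_cnj_diff)
    have ABC: "?B = ?A + ?C" by (simp add: algebra_simps)
    have "pf i j k l \<noteq> 0"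
    proof
      assume "pf i j k l = 0"
      then have T: "Re (T2 i j k l) = Re (T1 i j k l) + Re (T3 i j k l)" by (simp add: pf_T)
      \<comment> \<open>The modulus of \<open>?A + ?C\<close> is computed once from the points and
        once from the real numbers \<open>T1\<close> and \<open>T3\<close>. The comparison gives
        equality in the Cauchy-Schwarz inequality, that is, a real cross ratio.\<close>
      have "(cmod ?B)\<^sup>2 = (cmod ?A)\<^sup>2 + (cmod ?C)\<^sup>2 + 2 * Re (?A * cnj ?C)"
        unfolding ABC cmod_power2 by (simp add: power2_eq_square algebra_simps)
      moreover have "(cmod ?B)\<^sup>2 = (cmod ?A)\<^sup>2 + (cmod ?C)\<^sup>2 + 2 * (Re (T1 i j k l) * Re (T3 i j k l))"
        unfolding n[symmetric] re[symmetric] power2_abs T by (simp add: power2_eq_square algebra_simps)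
      ultimately have "Re (?A * cnj ?C) = Re (T1 i j k l) * Re (T3 i j k l)" by simp
      then have "(Re (?A * cnj ?C))\<^sup>2 = (cmod ?A)\<^sup>2 * (cmod ?C)\<^sup>2"
        by (simp only: power_mult_distrib n[symmetric] re[symmetric] power2_abs)
      moreover have "(Re (?A * cnj ?C))\<^sup>2 + (Im (?A * cnj ?C))\<^sup>2 = (cmod ?A)\<^sup>2 * (cmod ?C)\<^sup>2"
        unfolding cmod_power2[symmetric] norm_mult complex_mod_cnj power_mult_distrib ..
      ultimately have "Im (?A * cnj ?C) = 0" by simp
      then show False using not_concyclic[OF d] by simp
    qed
    then show ?thesis using False by simp
  qed
qed

end

section \<open>Hexagons and correlations\<close>

lemma UNIV_6: "(UNIV::6 set) = {0, 1, 2, 3, 4, 5}"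
proof -
  have "x \<in> {0, 1, 2, 3, 4, 5}" for x :: 6
  proof (cases x)
    case (of_int z)
    then have "0 \<le> z" "z < 6" by auto
    then have "z = 0 \<or> z = 1 \<or> z = 2 \<or> z = 3 \<or> z = 4 \<or> z = 5" by arith
    then show ?thesis using of_int by auto
  qed
  then show ?thesis by auto
qed

lemma forall_6: "(\<forall>i::6. P i) \<longleftrightarrow> P 0 \<and> P 1 \<and> P 2 \<and> P 3 \<and> P 4 \<and> P 5"
  by (metis UNIV_6 UNIV_I empty_iff insert_iff)

lemma mod_6_simps [simp]: "(6::6) = 0" "(7::6) = 1" "(8::6) = 2" "(9::6) = 3"
  by simp_all

lemma orthogonal_complements_eq:
  fixes u v :: "'a::real_inner"
  assumes "{y. y \<bullet> u = 0} = {y. y \<bullet> v = 0}"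
  obtains c where "v = c *\<^sub>R u"
proof (cases "u = 0")
  case True
  then have "v \<bullet> v = 0" using spec[OF assms[unfolded set_eq_iff mem_Collect_eq], of v] by simp
  then show ?thesis using that[of 0] by simp
next
  case False
  define c where "c = (v \<bullet> u) / (u \<bullet> u)"
  have u: "(v - c *\<^sub>R u) \<bullet> u = 0" using False by (simp add: inner_diff_left c_def)
  then have v: "(v - c *\<^sub>R u) \<bullet> v = 0"
    using spec[OF assms[unfolded set_eq_iff mem_Collect_eq]] by blast
  have "(v - c *\<^sub>R u) \<bullet> (v - c *\<^sub>R u) = 0"
    unfolding inner_diff_right inner_scaleR_right u v by simp
  then show ?thesis using that[of c] by simp
qed

section \<open>Bases of the space of homogeneous coordinates\<close>

definition cols4 :: "real^4 \<Rightarrow> real^4 \<Rightarrow> real^4 \<Rightarrow> real^4 \<Rightarrow> real^4^4" where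
  "cols4 a b c d = transpose (rows4 a b c d)"

lemma cols4_mult: "cols4 a b c d *v v = v$0 *\<^sub>R a + v$1 *\<^sub>R b + v$2 *\<^sub>R c + v$3 *\<^sub>R d"
  by (simp add: cols4_def matrix_vector_mult_def transpose_def sum_4_from_0 vec_eq_iff mult.commute)

lemma det_cols4: "det (cols4 a b c d) = d4 a b c d"
  by (simp add: cols4_def det_transpose det_rows4)

lemma basis4_expand:
  assumes "d4 a b c d \<noteq> 0"
  obtains s t u v where "y = s *\<^sub>R a + t *\<^sub>R b + u *\<^sub>R c + v *\<^sub>R d"
proof -
  have "invertible (cols4 a b c d)" using assms by (simp add: invertible_det_nz det_cols4)
  then obtain M where "cols4 a b c d ** M = mat 1" by (auto simp: invertible_def)
  then have "y = cols4 a b c d *v (M *v y)" by (simp add: matrix_vector_mul_assoc)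
  then show ?thesis using that unfolding cols4_mult by blast
qed

lemma basis4_independent:
  assumes "d4 a b c d \<noteq> 0" "s *\<^sub>R a + t *\<^sub>R b + u *\<^sub>R c + v *\<^sub>R d = 0"
  shows "s = 0 \<and> t = 0 \<and> u = 0 \<and> v = 0"
proof -
  define w :: "real^4" where "w = (\<chi> i. if i = 0 then s else if i = 1 then t else if i = 2 then u else v)"
  have w: "w$0 = s" "w$1 = t" "w$2 = u" "w$3 = v" by (simp_all add: w_def)
  have "cols4 a b c d *v w = 0" using assms(2) by (simp add: cols4_mult w)
  moreover have "det (cols4 a b c d) \<noteq> 0" using assms(1) by (simp add: det_cols4)
  ultimately have "w = 0" using det_zero_iff_kernel by blast
  then show ?thesis using w by simp
qed

lemma basis4_linear_extension:
  assumes "d4 a b c d \<noteq> 0"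
  obtains K :: "real^4^4" where "K *v a = a'" "K *v b = b'" "K *v c = c'" "K *v d = d'"
    "d4 a' b' c' d' \<noteq> 0 \<Longrightarrow> det K \<noteq> 0"
proof -
  have "invertible (cols4 a b c d)" using assms by (simp add: invertible_det_nz det_cols4)
  then obtain M where M: "M ** cols4 a b c d = mat 1" by (auto simp: invertible_def)
  define K where "K = cols4 a' b' c' d' ** M"
  have ax: "cols4 a b c d *v axis 0 1 = a" "cols4 a b c d *v axis 1 1 = b" "cols4 a b c d *v axis 2 1 = c" "cols4 a b c d *v axis 3 1 = d" for a b c d
    by (simp_all add: cols4_mult axis_def)
  have KX: "K *v (cols4 a b c d *v y) = cols4 a' b' c' d' *v y" for y
    by (metis K_def M matrix_mul_assoc matrix_mul_rid matrix_vector_mul_assoc)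
  have "det M * det (cols4 a b c d) = 1" by (metis M det_I det_mul)
  then have "det M \<noteq> 0" by auto
  then have "d4 a' b' c' d' \<noteq> 0 \<Longrightarrow> det K \<noteq> 0" by (simp add: K_def det_mul det_cols4)
  then show ?thesis
    using that[of K] KX[of "axis 0 1"] KX[of "axis 1 1"] KX[of "axis 2 1"] KX[of "axis 3 1"] by (simp add: ax)
qed

definition omega_matrix :: "real^4^4" where
  "omega_matrix = rows4 (- axis 3 1) (axis 2 1) (- axis 1 1) (axis 0 1)"

lemma inner_omega_matrix: "y \<bullet> (omega_matrix *v u) = omega u y"
  by (simp add: inner_vec_def sum_4_from_0 matrix_vector_mul_component omega_matrix_def inner_axis' omega_def plucker_def axis_def algebra_simps)

lemma det_omega_matrix: "det omega_matrix \<noteq> 0"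
  unfolding omega_matrix_def det_rows4 by (simp add: d4_def plucker_def axis_def)

text \<open>Closed hexagons whose sides are lines of the complex.\<close>

locale null_hexagon =
  fixes x :: "6 \<Rightarrow> real^4"
  assumes adj: "omega (x i) (x (i + 1)) = 0" and w_nonzero: "omega (x i) (x (i + 2)) \<noteq> 0"
begin

lemma adj': "omega (x 0) (x 1) = 0" "omega (x 1) (x 2) = 0" "omega (x 2) (x 3) = 0" "omega (x 3) (x 4) = 0"
  "omega (x 4) (x 5) = 0" "omega (x 5) (x 0) = 0"
  "omega (x 1) (x 0) = 0" "omega (x 2) (x 1) = 0" "omega (x 3) (x 2) = 0" "omega (x 4) (x 3) = 0"
  "omega (x 5) (x 4) = 0" "omega (x 0) (x 5) = 0"
proof -
  show *: "omega (x 0) (x 1) = 0" "omega (x 1) (x 2) = 0" "omega (x 2) (x 3) = 0" "omega (x 3) (x 4) = 0"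
      "omega (x 4) (x 5) = 0" "omega (x 5) (x 0) = 0"
    using adj[of 0] adj[of 1] adj[of 2] adj[of 3] adj[of 4] adj[of 5] by simp_all
  show "omega (x 1) (x 0) = 0" "omega (x 2) (x 1) = 0" "omega (x 3) (x 2) = 0" "omega (x 4) (x 3) = 0"
      "omega (x 5) (x 4) = 0" "omega (x 0) (x 5) = 0"
    using * by (metis omega_swap neg_equal_0_iff_equal)+
qed

lemma w_nonzero': "omega (x 0) (x 2) \<noteq> 0" "omega (x 1) (x 3) \<noteq> 0" "omega (x 2) (x 4) \<noteq> 0" "omega (x 3) (x 5) \<noteq> 0"
  "omega (x 4) (x 0) \<noteq> 0" "omega (x 5) (x 1) \<noteq> 0"
  using w_nonzero[of 0] w_nonzero[of 1] w_nonzero[of 2] w_nonzero[of 3] w_nonzero[of 4] w_nonzero[of 5] by simp_all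

lemma consecutive_basis: "d4 (x i) (x (i + 1)) (x (i + 2)) (x (i + 3)) \<noteq> 0"
proof -
  have "omega (x (i + 1)) (x (i + 1 + 1)) = 0" "omega (x (i + 2)) (x (i + 2 + 1)) = 0" "omega (x (i + 1)) (x (i + 1 + 2)) \<noteq> 0"
    by (rule adj w_nonzero)+
  then show ?thesis using adj[of i] w_nonzero[of i] by (simp add: d4_pfaffian add.assoc)
qed

text \<open>Since the sides are lines of the complex, the plane of three consecutive vertices is the
  null plane of the middle one. The required correlation is therefore a linear map sending each
  vertex to a multiple of the opposite one, followed by the null polarity.\<close>

lemma polar_plane: "omega (x i) y = 0 \<longleftrightarrow> y \<in> span {x (i - 1), x i, x (i + 1)}"
proof
  have z: "omega (x i) (x (i - 1)) = 0" using adj[of "i - 1"] omega_swap[of "x i"] by simp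
  assume "y \<in> span {x (i - 1), x i, x (i + 1)}"
  then show "omega (x i) y = 0"
  proof (induction rule: span_induct_alt)
    case (step c u v)
    then show ?case using adj[of i] z by (auto simp: omega_bilinear)
  qed (simp add: omega_bilinear)
next
  have z: "omega (x i) (x (i - 1)) = 0" using adj[of "i - 1"] omega_swap[of "x i"] by simp
  assume y: "omega (x i) y = 0"
  have "d4 (x (i - 1)) (x i) (x (i + 1)) (x (i + 2)) \<noteq> 0"
    using consecutive_basis[of "i - 1"] by (simp add: add.commute)
  then obtain s t u v where e: "y = s *\<^sub>R x (i - 1) + t *\<^sub>R x i + u *\<^sub>R x (i + 1) + v *\<^sub>R x (i + 2)"
    by (rule basis4_expand)
  have "v = 0" using y adj[of i] z w_nonzero[of i] by (simp add: e omega_bilinear)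
  then show "y \<in> span {x (i - 1), x i, x (i + 1)}"
    by (simp add: e span_add span_scale span_base)
qed

text \<open>These factors turn \<open>x i \<mapsto> k i *\<^sub>R x (i + 3)\<close> into a linear map that is self-adjoint with respect to
  \<open>omega\<close>.\<close>

definition k :: "6 \<Rightarrow> real" where
  "k i = (let w = (\<lambda>i. omega (x i) (x (i + 2))) in
    if i = 0 then 1 else if i = 1 then - w 1 / w 4 else if i = 2 then (w 1 * w 2) / (w 4 * w 5)
    else if i = 3 then - (w 1 * w 2 * w 3) / (w 4 * w 5 * w 0) else if i = 4 then (w 2 * w 3) / (w 5 * w 0) else - w 3 / w 0)"

lemma k_nonzero: "k i \<noteq> 0"
proof -
  have "\<forall>i. k i \<noteq> 0"
    unfolding forall_6 using w_nonzero' by (simp add: k_def Let_def)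
  then show ?thesis by blast
qed

lemma k_pair: "k i * omega (x (i + 3)) (x j) = k j * omega (x (j + 3)) (x i)"
proof -
  have w: "omega (x 2) (x 0) = - omega (x 0) (x 2)" "omega (x 3) (x 1) = - omega (x 1) (x 3)" "omega (x 4) (x 2) = - omega (x 2) (x 4)"
     "omega (x 5) (x 3) = - omega (x 3) (x 5)" "omega (x 0) (x 4) = - omega (x 4) (x 0)" "omega (x 1) (x 5) = - omega (x 5) (x 1)"
    by (rule omega_swap)+
  have kk: "k 0 = 1" "k 1 = - omega (x 1) (x 3) / omega (x 4) (x 0)"
    "k 2 = (omega (x 1) (x 3) * omega (x 2) (x 4)) / (omega (x 4) (x 0) * omega (x 5) (x 1))"
    "k 3 = - (omega (x 1) (x 3) * omega (x 2) (x 4) * omega (x 3) (x 5)) / (omega (x 4) (x 0) * omega (x 5) (x 1) * omega (x 0) (x 2))"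
    "k 4 = (omega (x 2) (x 4) * omega (x 3) (x 5)) / (omega (x 5) (x 1) * omega (x 0) (x 2))"
    "k 5 = - omega (x 3) (x 5) / omega (x 0) (x 2)"
    by (simp_all add: k_def Let_def)
  \<comment> \<open>Symmetry of the correlation amounts to this recursion around the hexagon. The
    definition of \<open>k\<close> solves it from \<open>k 0 = 1\<close>, and the last equation says
    that it closes up.\<close>
  have r: "k 1 * omega (x 4) (x 0) = - (k 0 * omega (x 1) (x 3))" "k 2 * omega (x 5) (x 1) = - (k 1 * omega (x 2) (x 4))"
    "k 3 * omega (x 0) (x 2) = - (k 2 * omega (x 3) (x 5))" "k 4 * omega (x 1) (x 3) = - (k 3 * omega (x 4) (x 0))"
    "k 5 * omega (x 2) (x 4) = - (k 4 * omega (x 5) (x 1))" "k 0 * omega (x 3) (x 5) = - (k 5 * omega (x 0) (x 2))"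
    unfolding kk using w_nonzero' by simp_all
  have "\<forall>i j. k i * omega (x (i + 3)) (x j) = k j * omega (x (j + 3)) (x i)"
    unfolding forall_6 by (simp add: adj' omega_self w r)
  then show ?thesis by blast
qed

text \<open>A linear map can be prescribed on four of the six vertices only. With these values the
  form \<open>omega (K *v u) v\<close> is symmetric on a basis, hence everywhere; symmetry and
  nondegeneracy then force the right values at the other two vertices.\<close>

lemma correlation_exists:
  obtains B where "transpose B = B" "invertible B" "\<And>i y. y \<bullet> (B *v x i) = k i * omega (x (i + 3)) y"
proof -
  have b: "d4 (x 0) (x 1) (x 2) (x 3) \<noteq> 0" using consecutive_basis[of 0] by simp
  have b': "d4 (k 0 *\<^sub>R x 3) (k 1 *\<^sub>R x 4) (k 2 *\<^sub>R x 5) (k 3 *\<^sub>R x 0) \<noteq> 0"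
    using consecutive_basis[of 3] k_nonzero
    by (simp add: pol6_wedge[symmetric] wedge_scale_left wedge_scale_right pol6_scale_left pol6_scale_right)
  obtain K where K: "K *v x 0 = k 0 *\<^sub>R x 3" "K *v x 1 = k 1 *\<^sub>R x 4" "K *v x 2 = k 2 *\<^sub>R x 5" "K *v x 3 = k 3 *\<^sub>R x 0"
    and dK: "det K \<noteq> 0"
    using basis4_linear_extension[OF b, of "k 0 *\<^sub>R x 3" "k 1 *\<^sub>R x 4" "k 2 *\<^sub>R x 5" "k 3 *\<^sub>R x 0"] b' by metis
  have Klin: "K *v (u + v) = K *v u + K *v v" "K *v (a *\<^sub>R u) = a *\<^sub>R (K *v u)" for a u v
    by (simp_all add: matrix_vector_right_distrib matrix_vector_mult_scaleR)
  have pb: "omega (K *v x 1) (x 0) = omega (K *v x 0) (x 1)" "omega (K *v x 2) (x 0) = omega (K *v x 0) (x 2)"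
    "omega (K *v x 3) (x 0) = omega (K *v x 0) (x 3)" "omega (K *v x 2) (x 1) = omega (K *v x 1) (x 2)"
    "omega (K *v x 3) (x 1) = omega (K *v x 1) (x 3)" "omega (K *v x 3) (x 2) = omega (K *v x 2) (x 3)"
    unfolding K omega_scale_left
    using k_pair[of 1 0] k_pair[of 2 0] k_pair[of 3 0] k_pair[of 2 1] k_pair[of 3 1] k_pair[of 3 2] by simp_all
  have sym: "omega (K *v u) v = omega (K *v v) u" for u v
  proof -
    obtain a0 a1 a2 a3 where u: "u = a0 *\<^sub>R x 0 + a1 *\<^sub>R x 1 + a2 *\<^sub>R x 2 + a3 *\<^sub>R x 3" using b by (rule basis4_expand)
    obtain b0 b1 b2 b3 where v: "v = b0 *\<^sub>R x 0 + b1 *\<^sub>R x 1 + b2 *\<^sub>R x 2 + b3 *\<^sub>R x 3" using b by (rule basis4_expand)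
    show ?thesis unfolding u v Klin omega_add_left omega_add_right omega_scale_left omega_scale_right pb
      by (simp add: algebra_simps)
  qed
  have Kx: "K *v x i = k i *\<^sub>R x (i + 3)" if i: "i \<in> {4, 5}" for i
  proof -
    let ?y = "K *v x i - k i *\<^sub>R x (i + 3)"
    have "omega (K *v x i) (x j) = k i * omega (x (i + 3)) (x j)" if "j \<in> {0, 1, 2, 3}" for j
    proof -
      have "K *v x j = k j *\<^sub>R x (j + 3)" using that K by auto
      then have "omega (K *v x i) (x j) = k j * omega (x (j + 3)) (x i)" by (metis sym omega_scale_left)
      then show ?thesis using k_pair by simp
    qed
    then have z: "omega ?y (x j) = 0" if "j \<in> {0, 1, 2, 3}" for j
      using that omega_add_left[of "K *v x i" "(- k i) *\<^sub>R x (i + 3)"] omega_scale_left[of "- k i" "x (i + 3)"] by simp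
    have "omega ?y y = 0" for y
    proof -
      obtain b0 b1 b2 b3 where v: "y = b0 *\<^sub>R x 0 + b1 *\<^sub>R x 1 + b2 *\<^sub>R x 2 + b3 *\<^sub>R x 3" using b by (rule basis4_expand)
      show ?thesis unfolding v omega_add_right omega_scale_right using z by simp
    qed
    then show ?thesis using omega_nondegenerate[of ?y] by simp
  qed
  have Kx': "K *v x i = k i *\<^sub>R x (i + 3)" for i
  proof -
    have "\<forall>i. K *v x i = k i *\<^sub>R x (i + 3)"
      unfolding forall_6 using K Kx[of 4] Kx[of 5] by simp
    then show ?thesis by blast
  qed
  define B where "B = omega_matrix ** K"
  have B: "y \<bullet> (B *v u) = omega (K *v u) y" for u y
    by (simp add: B_def matrix_vector_mul_assoc[symmetric] inner_omega_matrix)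
  have "B$i$j = B$j$i" for i j
  proof -
    have "axis i 1 \<bullet> (B *v axis j 1) = B$i$j" for i j
      by (simp add: inner_axis' matrix_vector_mult_basis column_def)
    then show ?thesis using B sym by metis
  qed
  then have "transpose B = B" by (simp add: transpose_def vec_eq_iff)
  moreover have "invertible B" using det_omega_matrix dK by (simp add: invertible_det_nz B_def det_mul)
  moreover have "y \<bullet> (B *v x i) = k i * omega (x (i + 3)) y" for i y
    by (simp add: B Kx' omega_bilinear)
  ultimately show ?thesis by (rule that)
qed

lemma associated_correlationI:
  assumes "transpose B = B" "invertible B" "\<And>i y. y \<bullet> (B *v x i) = k i * omega (x (i + 3)) y"
  shows "associated_correlation B x"
  unfolding associated_correlation_def correlation_def hexagon_plane_def
proof (intro conjI allI assms(1,2))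
  fix i
  show "{y. y \<bullet> (B *v x i) = 0} = span {x (i + 3 - 1), x (i + 3), x (i + 3 + 1)}"
    unfolding set_eq_iff mem_Collect_eq polar_plane[symmetric] assms(3) using k_nonzero by simp
qed

end

text \<open>Equal planes give each vertex proportional images. By general position
  \<open>x 4\<close> has no zero coordinate in the basis of the first four vertices, so all the
  factors agree, as for any projective frame.\<close>

lemma associated_correlation_unique:
  assumes gp: "general_position x" and B: "associated_correlation B x" and B': "associated_correlation B' x"
  obtains c where "c \<noteq> 0" "\<And>y. B' *v y = c *\<^sub>R (B *v y)"
proof -
  have np: "d4 (x i) (x j) (x k) (x l) \<noteq> 0" if "card {i, j, k, l} = 4" for i j k l
  proof -
    have "\<not> proj_coplanar (x ` {i, j, k, l})" using gp that unfolding general_position_def by blast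
    then show ?thesis by (simp add: proj_coplanar_iff_d4)
  qed
  have b: "d4 (x 0) (x 1) (x 2) (x 3) \<noteq> 0" "d4 (x 4) (x 1) (x 2) (x 3) \<noteq> 0" "d4 (x 0) (x 4) (x 2) (x 3) \<noteq> 0"
     "d4 (x 0) (x 1) (x 4) (x 3) \<noteq> 0" "d4 (x 0) (x 1) (x 2) (x 4) \<noteq> 0"
    by (rule np; simp)+
  have "\<exists>c. B' *v x i = c *\<^sub>R (B *v x i)" for i
  proof -
    have "correlation B (x i) = correlation B' (x i)" using B B' unfolding associated_correlation_def by metis
    then show ?thesis unfolding correlation_def using orthogonal_complements_eq by metis
  qed
  then obtain c where c: "\<And>i. B' *v x i = c i *\<^sub>R (B *v x i)" by metis
  obtain s t u v where x4: "x 4 = s *\<^sub>R x 0 + t *\<^sub>R x 1 + u *\<^sub>R x 2 + v *\<^sub>R x 3" using b(1) by (rule basis4_expand)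
  have nz: "s \<noteq> 0" "t \<noteq> 0" "u \<noteq> 0" "v \<noteq> 0"
    using b(2-5) unfolding x4
    by (auto simp: pol6_wedge[symmetric] wedge_add_left wedge_add_right wedge_scale_left wedge_scale_right wedge_self
        pol6_add_left pol6_add_right pol6_scale_left pol6_scale_right)
       (auto simp: pol6_wedge d4_def plucker_def algebra_simps)
  have lin: "A *v (a + b) = A *v a + A *v b" "A *v (r *\<^sub>R a) = r *\<^sub>R (A *v a)" for A :: "real^4^4" and a b r
    by (simp_all add: matrix_vector_right_distrib matrix_vector_mult_scaleR)
  have "B' *v x 4 = c 4 *\<^sub>R (B *v x 4)" by (rule c)
  then have "B *v ((s * (c 0 - c 4)) *\<^sub>R x 0 + (t * (c 1 - c 4)) *\<^sub>R x 1 + (u * (c 2 - c 4)) *\<^sub>R x 2 + (v * (c 3 - c 4)) *\<^sub>R x 3) = 0"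
    unfolding x4 lin c by (simp add: algebra_simps)
  moreover have "det B \<noteq> 0" using B unfolding associated_correlation_def invertible_det_nz by blast
  ultimately have "(s * (c 0 - c 4)) *\<^sub>R x 0 + (t * (c 1 - c 4)) *\<^sub>R x 1 + (u * (c 2 - c 4)) *\<^sub>R x 2 + (v * (c 3 - c 4)) *\<^sub>R x 3 = 0"
    using det_zero_iff_kernel by blast
  from basis4_independent[OF b(1) this] have cc: "c 0 = c 4" "c 1 = c 4" "c 2 = c 4" "c 3 = c 4" using nz by auto
  have all: "B' *v y = c 4 *\<^sub>R (B *v y)" for y
  proof -
    obtain s t u v where y: "y = s *\<^sub>R x 0 + t *\<^sub>R x 1 + u *\<^sub>R x 2 + v *\<^sub>R x 3" using b(1) by (rule basis4_expand)
    show ?thesis unfolding y lin c cc by (simp add: algebra_simps)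
  qed
  moreover have "c 4 \<noteq> 0"
  proof
    assume "c 4 = 0"
    then have "B' *v axis 0 1 = 0" using all by simp
    moreover have "det B' \<noteq> 0" using B' unfolding associated_correlation_def invertible_det_nz by blast
    ultimately have "axis 0 1 = (0::real^4)" using det_zero_iff_kernel by blast
    then show False by simp
  qed
  ultimately show ?thesis using that by blast
qed

lemma correlation_line_unique:
  assumes "general_position x" "associated_correlation B x" "associated_correlation B' x"
  shows "correlation_line B' l = correlation_line B l"
proof -
  obtain c where "c \<noteq> 0" "\<And>y. B' *v y = c *\<^sub>R (B *v y)" using associated_correlation_unique[OF assms] by blast
  then show ?thesis by (simp add: correlation_line_def correlation_def)
qed

text \<open>A line is sent to the orthogonal complement of its image under \<open>B\<close>; for
  symmetric \<open>B\<close> the two complements undo each other.\<close>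

lemma correlation_line_involution:
  assumes "transpose B = B" "invertible B" "subspace l"
  shows "correlation_line B (correlation_line B l) = l"
proof -
  obtain C where C: "C ** B = mat 1" "B ** C = mat 1" using assms(2) by (auto simp: invertible_def)
  have sym: "y \<bullet> (B *v x) = x \<bullet> (B *v y)" for x y
    by (metis assms(1) dot_lmul_matrix inner_commute transpose_matrix_vector)
  have sub: "subspace ((*v) B ` l)" using assms(3) by (simp add: linear_subspace_image)
  have 1: "correlation_line B l = orthogonal_comp ((*v) B ` l)"
    by (simp add: set_eq_iff correlation_line_def correlation_def orthogonal_comp_def orthogonal_def inner_commute)
  have o: "y \<bullet> (B *v x) = 0 \<longleftrightarrow> orthogonal x (B *v y)" for x y
    by (simp only: sym[of y x] orthogonal_def)
  have 2: "y \<in> correlation_line B (correlation_line B l) \<longleftrightarrow> B *v y \<in> orthogonal_comp (correlation_line B l)" for y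
    by (simp add: correlation_line_def[of B "correlation_line B l"] correlation_def orthogonal_comp_def o)
  have 3: "orthogonal_comp (correlation_line B l) = (*v) B ` l"
    unfolding 1 using orthogonal_comp_self[OF sub] .
  have 4: "B *v y \<in> (*v) B ` l \<longleftrightarrow> y \<in> l" for y
    using C by (auto simp: image_iff) (metis matrix_vector_mul_assoc matrix_vector_mul_lid)
  show ?thesis using 2 3 4 by blast
qed

section \<open>Contact elements of a cube\<close>

context lie_model
begin

lemma J_zero: "J 0 0 = 0"
  using J_scale[of 0 0 0] by simp

lemma J_inject: "J \<xi> \<eta> = J \<xi>' \<eta>' \<longleftrightarrow> \<xi> = \<xi>' \<and> \<eta> = \<eta>'"
proof
  assume e: "J \<xi> \<eta> = J \<xi>' \<eta>'"
  have "Re (cnj \<xi> * b) - Re (cnj a * \<eta>) = Re (cnj \<xi>' * b) - Re (cnj a * \<eta>')" for a b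
    using arg_cong[OF e, of "\<lambda>v. omega v (J a b)"] c_nonzero unfolding omega_J by simp
  from this[of 1 0] this[of \<i> 0] this[of 0 1] this[of 0 \<i>] show "\<xi> = \<xi>' \<and> \<eta> = \<eta>'"
    by (simp add: complex_eq_iff)
qed simp

lemma J_surj:
  obtains \<xi> \<eta> where "y = J \<xi> \<eta>"
proof -
  have "d4 (J 1 0) (J \<i> 0) (J 0 1) (J 0 \<i>) \<noteq> 0"
    unfolding d4_pfaffian omega_J using c_nonzero by simp
  then obtain s t u v where "y = s *\<^sub>R J 1 0 + t *\<^sub>R J \<i> 0 + u *\<^sub>R J 0 1 + v *\<^sub>R J 0 \<i>"
    by (rule basis4_expand)
  then have "y = J (s *\<^sub>R 1 + t *\<^sub>R \<i>) (u *\<^sub>R 1 + v *\<^sub>R \<i>)"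
    by (simp add: J_scale[symmetric] J_add[symmetric])
  then show ?thesis by (rule that)
qed

definition pt_line :: "complex \<Rightarrow> (real^4) set" where
  "pt_line q = range (\<lambda>\<xi>. J \<xi> (q * cnj \<xi>))"

definition circ_line :: "complex \<Rightarrow> real \<Rightarrow> (real^4) set" where
  "circ_line z r = range (\<lambda>\<xi>. J \<xi> (of_real r * \<xi> + z * cnj \<xi>))"

lemma circ_lineI: "J \<xi> (of_real r * \<xi> + z * cnj \<xi>) \<in> circ_line z r"
  unfolding circ_line_def by (rule rangeI)

lemma circ_lineE:
  assumes "y \<in> circ_line z r" obtains \<xi> where "y = J \<xi> (of_real r * \<xi> + z * cnj \<xi>)"
  using assms unfolding circ_line_def by blast

lemma lie_line_point: "lie_line \<Phi> (oriented_circle z 0) = pt_line (cpx z)"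
  and lie_line_circle: "lie_line \<Phi> (oriented_circle z r) = circ_line (cpx z) r"
  by (simp_all add: line_J pt_line_def circ_line_def)

lemma pt_line_circ_line: "pt_line q = circ_line q 0"
  by (simp add: pt_line_def circ_line_def)

lemma subspace_circ_line: "subspace (circ_line z r)"
proof (unfold subspace_def, intro conjI ballI allI)
  show "0 \<in> circ_line z r" using circ_lineI[of 0] J_zero by simp
next
  fix x y assume "x \<in> circ_line z r" "y \<in> circ_line z r"
  then obtain \<xi> \<xi>' where "x = J \<xi> (of_real r * \<xi> + z * cnj \<xi>)" "y = J \<xi>' (of_real r * \<xi>' + z * cnj \<xi>')"
    by (auto simp: circ_line_def)
  then have "x + y = J (\<xi> + \<xi>') (of_real r * (\<xi> + \<xi>') + z * cnj (\<xi> + \<xi>'))"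
    by (simp add: J_add[symmetric] algebra_simps)
  then show "x + y \<in> circ_line z r" by (simp only: circ_lineI)
next
  fix c x assume "x \<in> circ_line z r"
  then obtain \<xi> where "x = J \<xi> (of_real r * \<xi> + z * cnj \<xi>)"
    by (auto simp: circ_line_def)
  moreover have "c *\<^sub>R (of_real r * \<xi> + z * cnj \<xi>) = of_real r * (c *\<^sub>R \<xi>) + z * cnj (c *\<^sub>R \<xi>)"
    by (simp add: complex_eq_iff algebra_simps)
  ultimately have "c *\<^sub>R x = J (c *\<^sub>R \<xi>) (of_real r * (c *\<^sub>R \<xi>) + z * cnj (c *\<^sub>R \<xi>))"
    by (simp only: J_scale[symmetric])
  then show "c *\<^sub>R x \<in> circ_line z r" by (simp only: circ_lineI)
qed

lemma circ_line_inject: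
  assumes "circ_line z r = circ_line z r'" shows "r = r'"
proof -
  have "J 1 (of_real r * 1 + z * cnj 1) \<in> circ_line z r'"
    unfolding assms[symmetric] by (rule circ_lineI)
  then obtain \<xi> where "J 1 (of_real r * 1 + z * cnj 1) = J \<xi> (of_real r' * \<xi> + z * cnj \<xi>)" by (rule circ_lineE)
  then show ?thesis unfolding J_inject by auto
qed

definition X :: "complex \<Rightarrow> complex \<Rightarrow> real^4" where
  "X \<xi> q = J \<xi> (q * cnj \<xi>)"

lemma omega_X: "omega (X \<xi> q) (X \<xi>' q') = c * Re (cnj \<xi> * cnj \<xi>' * (q' - q))"
  unfolding X_def omega_J by (simp add: algebra_simps)

lemma X_nonzero: "\<xi> \<noteq> 0 \<Longrightarrow> X \<xi> q \<noteq> 0"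
  unfolding X_def using J_inject[of \<xi> "q * cnj \<xi>" 0 0] J_zero by auto

lemma X_scale: "X (a *\<^sub>R \<xi>) q = a *\<^sub>R X \<xi> q"
  unfolding X_def by (simp add: J_scale[symmetric])

lemma X_combination: "X (s *\<^sub>R \<xi> + t *\<^sub>R \<xi>') q = s *\<^sub>R X \<xi> q + t *\<^sub>R X \<xi>' q"
  unfolding X_def by (simp add: J_scale[symmetric] J_add[symmetric] algebra_simps)

text \<open>A spinor \<xi> belongs to both lines iff \<zeta>^2 times its conjugate is \<xi> again,
  which says that \<open>\<zeta> * cnj \<xi>\<close> is real, so that \<xi> is a real multiple of
  \<zeta>.\<close>

lemma pt_circ_inter:
  assumes "q = z + of_real r * \<zeta>\<^sup>2" "cmod \<zeta> = 1" "r \<noteq> 0"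
  shows "pt_line q \<inter> circ_line z r = span {X \<zeta> q}"
proof
  have z1: "\<zeta> * cnj \<zeta> = 1" "\<zeta> \<noteq> 0" using unit_cnj assms(2) by auto
  show "pt_line q \<inter> circ_line z r \<subseteq> span {X \<zeta> q}"
  proof
    fix y assume y: "y \<in> pt_line q \<inter> circ_line z r"
    then obtain \<xi> where 1: "y = J \<xi> (q * cnj \<xi>)" by (auto simp: pt_line_def)
    moreover from y obtain \<xi>' where "y = J \<xi>' (of_real r * \<xi>' + z * cnj \<xi>')" by (auto simp: circ_line_def)
    ultimately have "q * cnj \<xi> = of_real r * \<xi> + z * cnj \<xi>" by (auto simp: J_inject)
    then have "of_real r * (\<zeta>\<^sup>2 * cnj \<xi>) = of_real r * \<xi>" by (simp add: assms(1) algebra_simps)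
    then have "\<zeta>\<^sup>2 * cnj \<xi> = \<xi>" using assms(3) by simp
    then have "\<zeta> * cnj \<xi> = cnj (\<zeta> * cnj \<xi>)" using z1
      by (metis (no_types, lifting) complex_cnj_cnj complex_cnj_mult mult.assoc mult.commute mult.right_neutral power2_eq_square)
    then have "\<zeta> * cnj \<xi> = of_real (Re (\<zeta> * cnj \<xi>))" by (simp add: complex_eq_iff)
    then have "\<xi> = Re (\<zeta> * cnj \<xi>) *\<^sub>R \<zeta>"
      using \<open>\<zeta>\<^sup>2 * cnj \<xi> = \<xi>\<close> by (metis mult.assoc mult.commute power2_eq_square scaleR_conv_of_real)
    then have "y = Re (\<zeta> * cnj \<xi>) *\<^sub>R X \<zeta> q" using 1 X_scale X_def by metis
    then show "y \<in> span {X \<zeta> q}" by (simp add: span_scale span_base)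
  qed
next
  have "\<zeta>\<^sup>2 * cnj \<zeta> = \<zeta>" using unit_cnj[OF assms(2)] by (simp add: power2_eq_square mult.assoc)
  then have "q * cnj \<zeta> = of_real r * \<zeta> + z * cnj \<zeta>" by (simp add: assms(1) algebra_simps)
  then have "X \<zeta> q \<in> pt_line q" "X \<zeta> q \<in> circ_line z r"
    unfolding X_def pt_line_def by (blast, simp only: circ_lineI)
  then show "span {X \<zeta> q} \<subseteq> pt_line q \<inter> circ_line z r"
    using span_minimal[of "{X \<zeta> q}"] subspace_circ_line pt_line_circ_line by (metis Int_greatest empty_subsetI insert_subset)
qed

end

locale model_tetra = lie_model \<Phi> J c + tetra q z r \<xi>
  for \<Phi> J c and q z :: "'i \<Rightarrow> complex" and r \<xi>
begin

abbreviation XX :: "'i \<Rightarrow> 'i \<Rightarrow> real^4" where "XX i j \<equiv> X (\<xi> i j) (q i)"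

lemma omega_same_point: "omega (XX i a) (XX i b) = 0"
  by (simp add: omega_X)

lemma omega_same_circle: "i \<noteq> a \<Longrightarrow> j \<noteq> a \<Longrightarrow> omega (XX i a) (XX j a) = 0"
  unfolding omega_X q_diff[of j a i] by (simp add: q_diff[of j a i] cnj_xi xi_nonzero field_simps)

text \<open>The difference of the points \<open>a\<close> and \<open>i\<close>, measured on circle
  \<open>b\<close>, turns the product into a chord times a factor that is non-zero because the
  circles \<open>a\<close> and \<open>b\<close> are not tangent at the point
  \<open>i\<close>.\<close>

lemma omega_next:
  assumes "distinct [i, a, b, l]"
  shows "omega (XX i a) (XX a b) \<noteq> 0"
proof -
  have ne: "i \<noteq> a" "a \<noteq> i" "i \<noteq> b" "b \<noteq> i" "a \<noteq> b" "b \<noteq> a" using assms by auto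
  have "cnj (\<xi> i a) * cnj (\<xi> a b) * (q a - q i) = \<i> * of_real (chord b a i) * (\<xi> i b * cnj (\<xi> i a))"
    unfolding q_diff[OF ne(5,3)] by (simp add: cnj_xi xi_nonzero ne field_simps)
  then have "Re (cnj (\<xi> i a) * cnj (\<xi> a b) * (q a - q i)) = - chord b a i * Im (\<xi> i b * cnj (\<xi> i a))"
    by (rule Re_imaginary_multiple)
  moreover have "Im (\<xi> i b * cnj (\<xi> i a)) \<noteq> 0"
    by (rule Im_nonzero[of b a i l]) (use assms in auto)
  ultimately show ?thesis unfolding omega_X using chord_nonzero ne c_nonzero by simp
qed

lemma coplanar_iff:
  assumes "distinct [i, j, k, l]"
  shows "proj_coplanar {XX i j, XX j i, XX k l, XX l k} \<longleftrightarrow> \<Delta> i j k l < 0"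
proof -
  have "d4 (XX i j) (XX j i) (XX k l) (XX l k) = - (c\<^sup>2 * pf i j k l)"
    unfolding d4_pfaffian omega_X pf_def by (simp add: power2_eq_square algebra_simps)
  then show ?thesis
    unfolding proj_coplanar_iff_d4 using pf_zero_iff[OF assms] c_nonzero by simp
qed

text \<open>The three vectors lie on the line of circle \<open>i\<close>, which depends
  real-linearly on the spinor; the coefficients come from Cramer's rule for three vectors of the
  plane.\<close>

lemma circle_combination:
  assumes "distinct [i, j, k, l]"
  defines "\<alpha> \<equiv> Im (\<xi> l i * cnj (\<xi> k i)) / Im (\<xi> j i * cnj (\<xi> k i))"
    and "\<beta> \<equiv> - Im (\<xi> l i * cnj (\<xi> j i)) / Im (\<xi> j i * cnj (\<xi> k i))"
  shows "XX l i = \<alpha> *\<^sub>R XX j i + \<beta> *\<^sub>R XX k i"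
proof -
  have ne: "l \<noteq> i" "j \<noteq> i" "k \<noteq> i" "j \<noteq> k" using assms(1) by auto
  have "chord i j k \<noteq> 0" using chord_nonzero ne by blast
  then have S: "Im (\<xi> j i * cnj (\<xi> k i)) \<noteq> 0" by (simp add: chord_def)
  have id: "Im (u * cnj v) *\<^sub>R w = Im (w * cnj v) *\<^sub>R u + (- Im (w * cnj u)) *\<^sub>R v" for u v w
    by (simp add: complex_eq_iff algebra_simps)
  have e: "\<xi> l i = \<alpha> *\<^sub>R \<xi> j i + \<beta> *\<^sub>R \<xi> k i"
  proof -
    have "Im (\<xi> j i * cnj (\<xi> k i)) *\<^sub>R \<xi> l i = Im (\<xi> j i * cnj (\<xi> k i)) *\<^sub>R (\<alpha> *\<^sub>R \<xi> j i + \<beta> *\<^sub>R \<xi> k i)"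
      unfolding id[of "\<xi> j i"] \<alpha>_def \<beta>_def scaleR_add_right scaleR_scaleR using S by simp
    then show ?thesis using S by (simp only: scaleR_cancel_left) simp
  qed
  have circ: "q m * cnj (\<xi> m i) = of_real (r i) * \<xi> m i + z i * cnj (\<xi> m i)" if "m \<noteq> i" for m
    unfolding q_eq[OF that] using that by (simp add: cnj_xi xi_nonzero field_simps power2_eq_square)
  have "XX m i = J (\<xi> m i) (of_real (r i) * \<xi> m i + z i * cnj (\<xi> m i))" if "m \<noteq> i" for m
    unfolding X_def circ[OF that] ..
  then show ?thesis using ne
    by (simp add: J_scale[symmetric] J_add[symmetric]) (simp add: e J_inject algebra_simps scaleR_conv_of_real)
qed

text \<open>The combination is the image of \<open>XX l i\<close> under the linear map of the
  hexagon. It lies on the line of the point \<open>i\<close>, so it has a spinor \<eta>. By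
  \<open>correlation_identity\<close> it is orthogonal to \<open>XX j l\<close>, and this makes
  \<eta> a real multiple of \<open>\<xi> i l\<close>.\<close>

lemma polar_of_contact:
  assumes d: "distinct [i, j, k, l]" and neg: "\<Delta> i j k l < 0"
    and \<kappa>: "\<kappa> \<noteq> 0" "\<kappa>' \<noteq> 0" "\<kappa> * omega (XX i j) (XX k i) = \<kappa>' * omega (XX i k) (XX j i)"
  defines "\<alpha> \<equiv> Im (\<xi> l i * cnj (\<xi> k i)) / Im (\<xi> j i * cnj (\<xi> k i))"
    and "\<beta> \<equiv> - Im (\<xi> l i * cnj (\<xi> j i)) / Im (\<xi> j i * cnj (\<xi> k i))"
  obtains t where "t \<noteq> 0" "(\<kappa> * \<alpha>) *\<^sub>R XX i j + (\<kappa>' * \<beta>) *\<^sub>R XX i k = t *\<^sub>R XX i l"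
proof -
  have ne: "i \<noteq> j" "j \<noteq> i" "i \<noteq> k" "k \<noteq> i" "i \<noteq> l" "l \<noteq> i" "j \<noteq> k" "k \<noteq> j" "j \<noteq> l" "l \<noteq> j" "k \<noteq> l" "l \<noteq> k"
    using d by auto
  have S: "Im (\<xi> j i * cnj (\<xi> k i)) \<noteq> 0" using chord_nonzero[of j i k] ne by (simp add: chord_def)
  have S': "Im (\<xi> l i * cnj (\<xi> k i)) \<noteq> 0" "Im (\<xi> l i * cnj (\<xi> j i)) \<noteq> 0"
    using chord_nonzero[of l i k] chord_nonzero[of l i j] ne by (simp_all add: chord_def)
  define \<eta> where "\<eta> = (\<kappa> * \<alpha>) *\<^sub>R \<xi> i j + (\<kappa>' * \<beta>) *\<^sub>R \<xi> i k"
  have X\<eta>: "X \<eta> (q i) = (\<kappa> * \<alpha>) *\<^sub>R XX i j + (\<kappa>' * \<beta>) *\<^sub>R XX i k"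
    unfolding \<eta>_def by (rule X_combination)
  have ck: "omega (XX i j) (XX k i) \<noteq> 0"
    using omega_next[of k i j l] omega_swap[of "XX i j" "XX k i"] d by auto
  have id: "\<alpha> * omega (XX i k) (XX j i) * omega (XX i j) (XX j l) = \<beta> * omega (XX k i) (XX i j) * omega (XX i k) (XX j l)"
  proof -
    have "Im (\<xi> j i * cnj (\<xi> k i)) * (\<alpha> * omega (XX i k) (XX j i) * omega (XX i j) (XX j l) - \<beta> * omega (XX k i) (XX i j) * omega (XX i k) (XX j l))
      = c\<^sup>2 * (Im (\<xi> l i * cnj (\<xi> k i)) * Re (cnj (\<xi> i k) * cnj (\<xi> j i) * (q j - q i)) * Re (cnj (\<xi> i j) * cnj (\<xi> j l) * (q j - q i))
    + Im (\<xi> l i * cnj (\<xi> j i)) * Re (cnj (\<xi> k i) * cnj (\<xi> i j) * (q i - q k)) * Re (cnj (\<xi> i k) * cnj (\<xi> j l) * (q j - q i)))"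
      unfolding omega_X \<alpha>_def \<beta>_def using S by (simp add: power2_eq_square field_simps del: times_complex.sel)
    also have "\<dots> = 0" unfolding correlation_identity[OF d neg] by simp
    finally show ?thesis using S by simp
  qed
  have "omega (XX i j) (XX k i) * omega (X \<eta> (q i)) (XX j l) = 0"
  proof -
    have "omega (XX i j) (XX k i) * omega (X \<eta> (q i)) (XX j l) =
       \<alpha> * (\<kappa> * omega (XX i j) (XX k i)) * omega (XX i j) (XX j l) + \<kappa>' * \<beta> * omega (XX i j) (XX k i) * omega (XX i k) (XX j l)"
      unfolding X\<eta> omega_bilinear by (simp add: algebra_simps)
    also have "\<dots> = \<kappa>' * (\<alpha> * omega (XX i k) (XX j i) * omega (XX i j) (XX j l)) + \<kappa>' * \<beta> * omega (XX i j) (XX k i) * omega (XX i k) (XX j l)"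
      unfolding \<kappa>(3) by (simp add: mult_ac)
    also have "\<dots> = 0" unfolding id omega_swap[of "XX i j" "XX k i"] by simp
    finally show ?thesis .
  qed
  then have "Re (cnj \<eta> * cnj (\<xi> j l) * (q j - q i)) = 0" using ck c_nonzero unfolding omega_X by simp
  moreover have "cnj \<eta> * cnj (\<xi> j l) * (q j - q i) = \<i> * of_real (chord l j i) * (\<xi> i l * cnj \<eta>)"
    unfolding q_diff[OF ne(9,5)] by (simp add: cnj_xi xi_nonzero ne field_simps)
  then have "Re (cnj \<eta> * cnj (\<xi> j l) * (q j - q i)) = - chord l j i * Im (\<xi> i l * cnj \<eta>)"
    by (rule Re_imaginary_multiple)
  ultimately have im: "Im (\<xi> i l * cnj \<eta>) = 0" using chord_nonzero ne by simp
  define t where "t = Re (\<xi> i l * cnj \<eta>)"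
  have "\<xi> i l * cnj \<eta> = of_real t" using im by (simp add: complex_eq_iff t_def)
  then have "cnj (\<xi> i l * cnj \<eta>) * \<xi> i l = of_real t * \<xi> i l" by simp
  then have \<eta>t: "\<eta> = t *\<^sub>R \<xi> i l"
    by (simp add: cnj_xi xi_nonzero ne scaleR_conv_of_real field_simps)
  \<comment> \<open>The coefficient of \<open>\<xi> i j\<close> in \<eta> is non-zero, and
    \<open>\<xi> i j\<close> and \<open>\<xi> i k\<close> are independent over the reals since the
    circles \<open>j\<close> and \<open>k\<close> are not tangent at the point
    \<open>i\<close>.\<close>
  have "t \<noteq> 0"
  proof
    assume "t = 0"
    then have "\<eta> = 0" using \<eta>t by simp
    then have "Im (\<eta> * cnj (\<xi> i k)) = 0" by simp
    moreover have "\<eta> * cnj (\<xi> i k) = of_real (\<kappa> * \<alpha>) * (\<xi> i j * cnj (\<xi> i k)) + of_real (\<kappa>' * \<beta>)"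
      unfolding \<eta>_def by (simp add: cnj_xi xi_nonzero ne scaleR_conv_of_real field_simps)
    ultimately have "\<kappa> * \<alpha> * Im (\<xi> i j * cnj (\<xi> i k)) = 0"
      by (simp only: plus_complex.sel Im_real_multiple Im_complex_of_real add_0_right)
    then show False using Im_nonzero[of j k i l] \<kappa> S S' d by (auto simp: \<alpha>_def)
  qed
  then show ?thesis using that[of t] X\<eta> X_scale \<eta>t by metis
qed

text \<open>The sides are, in cyclic order, circle \<open>i\<close>, point \<open>k\<close>, circle
  \<open>j\<close>, point \<open>i\<close>, circle \<open>k\<close>, point \<open>j\<close>. Adding
  3 to the index exchanges the two indices of a contact point.\<close>

definition hexagon :: "'i \<Rightarrow> 'i \<Rightarrow> 'i \<Rightarrow> 6 \<Rightarrow> real^4" where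
  "hexagon i j k m = (if m = 0 then XX k i else if m = 1 then XX k j else if m = 2 then XX i j
     else if m = 3 then XX i k else if m = 4 then XX j k else XX j i)"

lemma hexagon_nth: "hexagon i j k 0 = XX k i" "hexagon i j k 1 = XX k j" "hexagon i j k 2 = XX i j"
  "hexagon i j k 3 = XX i k" "hexagon i j k 4 = XX j k" "hexagon i j k 5 = XX j i"
  by (simp_all add: hexagon_def)

lemma null_hexagon:
  assumes d: "distinct [i, j, k, l]"
  shows "null_hexagon (hexagon i j k)"
proof
  have ne: "i \<noteq> j" "j \<noteq> i" "i \<noteq> k" "k \<noteq> i" "i \<noteq> l" "l \<noteq> i" "j \<noteq> k" "k \<noteq> j" "j \<noteq> l" "l \<noteq> j" "k \<noteq> l" "l \<noteq> k"
    using d by auto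
  have "\<forall>m. omega (hexagon i j k m) (hexagon i j k (m + 1)) = 0"
    unfolding forall_6 by (simp add: hexagon_nth omega_same_point omega_same_circle ne)
  then show "omega (hexagon i j k m) (hexagon i j k (m + 1)) = 0" for m by blast
  have "omega (XX k i) (XX i j) \<noteq> 0" "omega (XX i k) (XX k j) \<noteq> 0" "omega (XX i j) (XX j k) \<noteq> 0"
    "omega (XX j i) (XX i k) \<noteq> 0" "omega (XX j k) (XX k i) \<noteq> 0" "omega (XX k j) (XX j i) \<noteq> 0"
    by (rule omega_next[of _ _ _ l]; use d in auto)+
  then have "omega (XX k i) (XX i j) \<noteq> 0" "omega (XX k j) (XX i k) \<noteq> 0" "omega (XX i j) (XX j k) \<noteq> 0"
    "omega (XX i k) (XX j i) \<noteq> 0" "omega (XX j k) (XX k i) \<noteq> 0" "omega (XX j i) (XX k j) \<noteq> 0"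
    using omega_swap by (metis neg_equal_0_iff_equal)+
  then have "\<forall>m. omega (hexagon i j k m) (hexagon i j k (m + 2)) \<noteq> 0"
    unfolding forall_6 by (simp add: hexagon_nth)
  then show "omega (hexagon i j k m) (hexagon i j k (m + 2)) \<noteq> 0" for m by blast
qed

text \<open>A line of the complex is its own polar, so the null planes of two of its points cut it
  out.\<close>

lemma circ_line_polar:
  assumes d: "distinct [i, j, k, l]"
  shows "{y. omega (XX i l) y = 0 \<and> omega (XX j l) y = 0} = circ_line (z l) (r l)"
proof -
  have ne: "i \<noteq> l" "j \<noteq> l" "i \<noteq> j" using d by auto
  have circ: "q m * cnj (\<xi> m l) = of_real (r l) * \<xi> m l + z l * cnj (\<xi> m l)" if "m \<noteq> l" for m
    unfolding q_eq[OF that] using that by (simp add: cnj_xi xi_nonzero field_simps power2_eq_square)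
  have omega: "omega (XX m l) (J \<xi>' \<eta>) = c * Re (cnj (\<xi> m l) * (\<eta> - of_real (r l) * \<xi>' - z l * cnj \<xi>'))" if "m \<noteq> l" for m \<xi>' \<eta>
    unfolding X_def circ[OF that] omega_J by (simp add: algebra_simps)
  have S: "Im (\<xi> i l * cnj (\<xi> j l)) \<noteq> 0" using chord_nonzero[of i l j] ne by (simp add: chord_def)
  have two: "w = 0" if "Re (cnj u * w) = 0" "Re (cnj v * w) = 0" "Im (u * cnj v) \<noteq> 0" for u v w
  proof -
    have "of_real (Im (u * cnj v)) * w = \<i> * (of_real (Re (cnj u * w)) * v - of_real (Re (cnj v * w)) * u)"
      by (simp add: complex_eq_iff algebra_simps)
    then have "of_real (Im (u * cnj v)) * w = 0" unfolding that(1,2) by simp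
    then show ?thesis using that(3) by (simp del: times_complex.sel)
  qed
  show ?thesis
  proof (intro set_eqI iffI)
    fix y assume y: "y \<in> {y. omega (XX i l) y = 0 \<and> omega (XX j l) y = 0}"
    obtain \<xi>' \<eta> where J: "y = J \<xi>' \<eta>" by (rule J_surj)
    have "\<eta> - of_real (r l) * \<xi>' - z l * cnj \<xi>' = 0"
      using y omega[of i] omega[of j] ne c_nonzero S unfolding J by (intro two[of "\<xi> i l" _ "\<xi> j l"]) auto
    then have "\<eta> = of_real (r l) * \<xi>' + z l * cnj \<xi>'" by (simp add: algebra_simps)
    then show "y \<in> circ_line (z l) (r l)" by (auto simp: J circ_line_def)
  next
    fix y assume "y \<in> circ_line (z l) (r l)"
    then obtain \<xi>' where "y = J \<xi>' (of_real (r l) * \<xi>' + z l * cnj \<xi>')" by (auto simp: circ_line_def)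
    then show "y \<in> {y. omega (XX i l) y = 0 \<and> omega (XX j l) y = 0}" using ne by (simp add: omega)
  qed
qed

text \<open>The line of the point \<open>l\<close> is spanned by its contact points with the circles
  \<open>i\<close> and \<open>j\<close>. The correlation sends these to the null planes of
  \<open>XX i l\<close> and \<open>XX j l\<close>, which are points on the line of circle
  \<open>l\<close>, and that line is its own polar.\<close>

theorem opposite_correlated:
  assumes d: "distinct [i, j, k, l]" and neg: "\<Delta> i j k l < 0"
  obtains B where "associated_correlation B (hexagon i j k)"
    "correlation_line B (pt_line (q l)) = circ_line (z l) (r l)"
proof -
  interpret h: null_hexagon "hexagon i j k" using d by (rule null_hexagon)
  have ne: "i \<noteq> j" "j \<noteq> i" "i \<noteq> k" "k \<noteq> i" "i \<noteq> l" "l \<noteq> i" "j \<noteq> k" "k \<noteq> j" "j \<noteq> l" "l \<noteq> j" "k \<noteq> l" "l \<noteq> k"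
    using d by auto
  have d': "distinct [j, i, k, l]" using d by auto
  have neg': "\<Delta> j i k l < 0" using neg Delta_swap by simp
  obtain B where B: "transpose B = B" "invertible B"
    "\<And>m y. y \<bullet> (B *v hexagon i j k m) = h.k m * omega (hexagon i j k (m + 3)) y"
    using h.correlation_exists by blast
  have Bx: "y \<bullet> (B *v XX k i) = h.k 0 * omega (XX i k) y" "y \<bullet> (B *v XX k j) = h.k 1 * omega (XX j k) y"
    "y \<bullet> (B *v XX i j) = h.k 2 * omega (XX j i) y" "y \<bullet> (B *v XX j i) = h.k 5 * omega (XX i j) y" for y
    using B(3)[of y 0] B(3)[of y 1] B(3)[of y 2] B(3)[of y 5] by (simp_all add: hexagon_nth)
  define \<alpha> where "\<alpha> = Im (\<xi> l i * cnj (\<xi> k i)) / Im (\<xi> j i * cnj (\<xi> k i))"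
  define \<beta> where "\<beta> = - Im (\<xi> l i * cnj (\<xi> j i)) / Im (\<xi> j i * cnj (\<xi> k i))"
  define \<alpha>' where "\<alpha>' = Im (\<xi> l j * cnj (\<xi> k j)) / Im (\<xi> i j * cnj (\<xi> k j))"
  define \<beta>' where "\<beta>' = - Im (\<xi> l j * cnj (\<xi> i j)) / Im (\<xi> i j * cnj (\<xi> k j))"
  have "h.k 5 * omega (XX i j) (XX k i) = h.k 0 * omega (XX i k) (XX j i)"
    using h.k_pair[of 5 0] by (simp add: hexagon_nth)
  then obtain t where t: "t \<noteq> 0" "(h.k 5 * \<alpha>) *\<^sub>R XX i j + (h.k 0 * \<beta>) *\<^sub>R XX i k = t *\<^sub>R XX i l"
    using polar_of_contact[OF d neg h.k_nonzero h.k_nonzero] unfolding \<alpha>_def \<beta>_def by metis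
  have "h.k 2 * omega (XX j i) (XX k j) = h.k 1 * omega (XX j k) (XX i j)"
    using h.k_pair[of 2 1] by (simp add: hexagon_nth)
  then obtain t' where t': "t' \<noteq> 0" "(h.k 2 * \<alpha>') *\<^sub>R XX j i + (h.k 1 * \<beta>') *\<^sub>R XX j k = t' *\<^sub>R XX j l"
    using polar_of_contact[OF d' neg' h.k_nonzero h.k_nonzero] unfolding \<alpha>'_def \<beta>'_def by metis
  have lin: "B *v (a *\<^sub>R u + b *\<^sub>R v) = a *\<^sub>R (B *v u) + b *\<^sub>R (B *v v)" for a b u v
    by (simp add: matrix_vector_right_distrib matrix_vector_mult_scaleR)
  have p1: "y \<bullet> (B *v XX l i) = t * omega (XX i l) y" for y
  proof -
    have "y \<bullet> (B *v XX l i) = omega ((h.k 5 * \<alpha>) *\<^sub>R XX i j + (h.k 0 * \<beta>) *\<^sub>R XX i k) y"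
      unfolding circle_combination[OF d, folded \<alpha>_def \<beta>_def] lin inner_add_right inner_scaleR_right Bx omega_bilinear by simp
    then show ?thesis unfolding t(2) omega_bilinear .
  qed
  have p2: "y \<bullet> (B *v XX l j) = t' * omega (XX j l) y" for y
  proof -
    have "y \<bullet> (B *v XX l j) = omega ((h.k 2 * \<alpha>') *\<^sub>R XX j i + (h.k 1 * \<beta>') *\<^sub>R XX j k) y"
      unfolding circle_combination[OF d', folded \<alpha>'_def \<beta>'_def] lin inner_add_right inner_scaleR_right Bx omega_bilinear by simp
    then show ?thesis unfolding t'(2) omega_bilinear .
  qed
  have S: "Im (\<xi> l i * cnj (\<xi> l j)) \<noteq> 0" using Im_nonzero[of i j l k] d by auto
  have "correlation_line B (pt_line (q l)) = {y. y \<bullet> (B *v XX l i) = 0 \<and> y \<bullet> (B *v XX l j) = 0}"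
  proof (intro set_eqI iffI)
    fix y assume "y \<in> correlation_line B (pt_line (q l))"
    then show "y \<in> {y. y \<bullet> (B *v XX l i) = 0 \<and> y \<bullet> (B *v XX l j) = 0}"
      by (auto simp: correlation_line_def correlation_def pt_line_def X_def)
  next
    fix y assume y: "y \<in> {y. y \<bullet> (B *v XX l i) = 0 \<and> y \<bullet> (B *v XX l j) = 0}"
    have "y \<bullet> (B *v X \<eta> (q l)) = 0" for \<eta>
    proof -
      have "Im (\<xi> l i * cnj (\<xi> l j)) *\<^sub>R \<eta> = Im (\<eta> * cnj (\<xi> l j)) *\<^sub>R \<xi> l i + (- Im (\<eta> * cnj (\<xi> l i))) *\<^sub>R \<xi> l j"
        by (simp add: complex_eq_iff algebra_simps)
      from arg_cong[OF this, of "\<lambda>\<xi>. X \<xi> (q l)"]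
      have E: "Im (\<xi> l i * cnj (\<xi> l j)) *\<^sub>R X \<eta> (q l) = Im (\<eta> * cnj (\<xi> l j)) *\<^sub>R XX l i + (- Im (\<eta> * cnj (\<xi> l i))) *\<^sub>R XX l j"
        by (simp only: X_scale X_combination)
      have "y \<bullet> (B *v (Im (\<xi> l i * cnj (\<xi> l j)) *\<^sub>R X \<eta> (q l))) = 0"
        unfolding E lin inner_add_right inner_scaleR_right using y by simp
      then have "Im (\<xi> l i * cnj (\<xi> l j)) * (y \<bullet> (B *v X \<eta> (q l))) = 0"
        by (simp only: matrix_vector_mult_scaleR inner_scaleR_right)
      then show ?thesis using S by (simp del: times_complex.sel)
    qed
    then show "y \<in> correlation_line B (pt_line (q l))"
      by (auto simp: correlation_line_def correlation_def pt_line_def X_def)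
  qed
  also have "\<dots> = circ_line (z l) (r l)"
    unfolding p1 p2 circ_line_polar[OF d, symmetric] using t(1) t'(1) by simp
  finally show ?thesis using that h.associated_correlationI[OF B] by blast
qed

end

section \<open>Elementary cubes\<close>

definition vec3 :: "int \<Rightarrow> int \<Rightarrow> int \<Rightarrow> int^3" where
  "vec3 x y z = vector [x, y, z]"

lemma vec3_nth [simp]: "vec3 x y z $ 1 = x" "vec3 x y z $ 2 = y" "vec3 x y z $ 3 = z"
  by (simp_all add: vec3_def vector_3)

lemma vec3_eq_iff: "v = w \<longleftrightarrow> v$1 = w$1 \<and> v$2 = w$2 \<and> v$3 = w$3" for v w :: "int^3"
  by (simp add: vec_eq_iff forall_3)

lemma vec3_collapse [simp]: "vec3 (v$1) (v$2) (v$3) = v"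
  by (simp add: vec3_eq_iff)

lemma axis_vec3: "axis 1 a = vec3 a 0 0" "axis 2 a = vec3 0 a 0" "axis 3 a = vec3 0 0 a"
  by (simp_all add: vec3_eq_iff axis_def)

lemma unit_shift_vec3: "unit_shift 1 = vec3 1 0 0" "unit_shift 2 = vec3 0 1 0" "unit_shift 3 = vec3 0 0 1"
  by (simp_all add: unit_shift_def axis_vec3)

lemma exists_3: "(\<exists>i::3. P i) \<longleftrightarrow> P 1 \<or> P 2 \<or> P 3"
  by (metis exhaust_3)

lemma abs_sum_eq_1_iff:
  fixes a b c :: int
  shows "\<bar>a\<bar> + \<bar>b\<bar> + \<bar>c\<bar> = 1 \<longleftrightarrow> (\<bar>a\<bar> = 1 \<and> b = 0 \<and> c = 0) \<or> (a = 0 \<and> \<bar>b\<bar> = 1 \<and> c = 0) \<or> (a = 0 \<and> b = 0 \<and> \<bar>c\<bar> = 1)"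
proof
  assume e: "\<bar>a\<bar> + \<bar>b\<bar> + \<bar>c\<bar> = 1"
  show "(\<bar>a\<bar> = 1 \<and> b = 0 \<and> c = 0) \<or> (a = 0 \<and> \<bar>b\<bar> = 1 \<and> c = 0) \<or> (a = 0 \<and> b = 0 \<and> \<bar>c\<bar> = 1)"
  proof (cases "a = 0")
    case True
    show ?thesis
    proof (cases "b = 0")
      case True
      then show ?thesis using e \<open>a = 0\<close> by simp
    next
      case False
      then have "c = 0" "\<bar>b\<bar> = 1" using e \<open>a = 0\<close> by linarith+
      then show ?thesis using \<open>a = 0\<close> by simp
    qed
  next
    case False
    then have "b = 0" "c = 0" "\<bar>a\<bar> = 1" using e by linarith+
    then show ?thesis by simp
  qed
qed auto

lemma abs_diff_eq_1_iff: "\<bar>a - b\<bar> = 1 \<longleftrightarrow> b = a + 1 \<or> a = b + (1::int)"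
  by linarith

lemma neighbours_iff: "neighbours n m \<longleftrightarrow> \<bar>n$1 - m$1\<bar> + \<bar>n$2 - m$2\<bar> + \<bar>n$3 - m$3\<bar> = 1"
proof -
  have e: "n = vec3 (n$1) (n$2) (n$3)" "m = vec3 (m$1) (m$2) (m$3)" by simp_all
  obtain a b c a' b' c' where n: "n = vec3 a b c" and m: "m = vec3 a' b' c'" using e by blast
  show ?thesis unfolding n m
  unfolding neighbours_def exists_3 unit_shift_vec3 vec3_eq_iff abs_sum_eq_1_iff abs_diff_eq_1_iff
    vector_add_component vec3_nth right_minus_eq add_0_right
  by blast
qed

text \<open>The even and the odd vertices of a cube, numbered so that those with equal indices are opposite.\<close>

definition ev :: "int^3 \<Rightarrow> int^3 \<Rightarrow> 4 \<Rightarrow> int^3" where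
  "ev v s k = (if k = 0 then v else if k = 1 then v + vec3 0 (s$2) (s$3)
     else if k = 2 then v + vec3 (s$1) 0 (s$3) else v + vec3 (s$1) (s$2) 0)"

definition od :: "int^3 \<Rightarrow> int^3 \<Rightarrow> 4 \<Rightarrow> int^3" where
  "od v s k = (if k = 0 then v + s else if k = 1 then v + vec3 (s$1) 0 0
     else if k = 2 then v + vec3 0 (s$2) 0 else v + vec3 0 0 (s$3))"

lemma ev_nth: "ev v s 0 = v" "ev v s 1 = v + vec3 0 (s$2) (s$3)" "ev v s 2 = v + vec3 (s$1) 0 (s$3)" "ev v s 3 = v + vec3 (s$1) (s$2) 0"
  and od_nth: "od v s 0 = v + s" "od v s 1 = v + vec3 (s$1) 0 0" "od v s 2 = v + vec3 0 (s$2) 0" "od v s 3 = v + vec3 0 0 (s$3)"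
  by (simp_all add: ev_def od_def)

lemma diagonals_iff: "s \<in> diagonals \<longleftrightarrow> \<bar>s$1\<bar> = 1 \<and> \<bar>s$2\<bar> = 1 \<and> \<bar>s$3\<bar> = 1"
  unfolding diagonals_def by (auto simp: forall_3)

lemma cube_neighbours: "s \<in> diagonals \<Longrightarrow> i \<noteq> j \<Longrightarrow> neighbours (ev v s i) (od v s j)"
proof -
  assume "s \<in> diagonals" "i \<noteq> j"
  moreover have "\<forall>i j. i \<noteq> j \<longrightarrow> neighbours (ev v s i) (od v s j)" if "s \<in> diagonals"
    using that unfolding forall_4_from_0 ev_nth od_nth neighbours_iff diagonals_iff by simp
  ultimately show ?thesis by blast
qed

lemma neighbours_sym: "neighbours n m \<longleftrightarrow> neighbours m n"
  unfolding neighbours_def by blast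

lemma cube_even: "v \<in> even_lattice \<Longrightarrow> s \<in> diagonals \<Longrightarrow> ev v s k \<in> even_lattice"
  and cube_odd: "v \<in> even_lattice \<Longrightarrow> s \<in> diagonals \<Longrightarrow> od v s k \<in> odd_lattice"
proof -
  assume a: "v \<in> even_lattice" "s \<in> diagonals"
  then have "odd (s$1)" "odd (s$2)" "odd (s$3)" unfolding diagonals_iff by presburger+
  moreover have "even (v$1 + v$2 + v$3)" using a(1) by (simp add: even_lattice_def level_def)
  ultimately have "\<forall>k. ev v s k \<in> even_lattice" "\<forall>k. od v s k \<in> odd_lattice"
    unfolding forall_4_from_0 ev_nth od_nth even_lattice_def odd_lattice_def level_def mem_Collect_eq
      vector_add_component vec3_nth even_add by blast+
  then show "ev v s k \<in> even_lattice" "od v s k \<in> odd_lattice" by blast+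
qed

lemma cube_distinct: "s \<in> diagonals \<Longrightarrow> i \<noteq> j \<Longrightarrow> ev v s i \<noteq> ev v s j"
    "s \<in> diagonals \<Longrightarrow> i \<noteq> j \<Longrightarrow> od v s i \<noteq> od v s j"
proof -
  assume a: "s \<in> diagonals" "i \<noteq> j"
  then have "\<forall>i j. i \<noteq> j \<longrightarrow> ev v s i \<noteq> ev v s j" "\<forall>i j. i \<noteq> j \<longrightarrow> od v s i \<noteq> od v s j"
    unfolding forall_4_from_0 ev_nth od_nth vec3_eq_iff diagonals_iff by auto
  then show "ev v s i \<noteq> ev v s j" "od v s i \<noteq> od v s j" using a by blast+
qed

lemma exists_third: "\<exists>k::4. k \<noteq> i \<and> k \<noteq> j"
proof -
  have "card {i, j} \<le> 2" by (simp add: card_insert_if)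
  then have "{i, j} \<noteq> UNIV" by (intro notI) simp
  then show ?thesis by blast
qed

lemma cube_nearby:
  assumes "s \<in> diagonals" "i \<noteq> j"
  shows "nearby (ev v s i) (ev v s j)" "nearby (od v s i) (od v s j)"
proof -
  obtain k where "k \<noteq> i" "k \<noteq> j" using exists_third by blast
  then have "neighbours (ev v s i) (od v s k)" "neighbours (ev v s j) (od v s k)"
      "neighbours (od v s i) (ev v s k)" "neighbours (od v s j) (ev v s k)"
    using cube_neighbours[OF assms(1)] neighbours_sym by metis+
  then show "nearby (ev v s i) (ev v s j)" "nearby (od v s i) (od v s j)"
    unfolding nearby_def using cube_distinct[OF assms] by blast+
qed

lemma cube_hexagon_nth: "cube_hexagon v s 0 = od v s 1" "cube_hexagon v s 1 = ev v s 3" "cube_hexagon v s 2 = od v s 2"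
  "cube_hexagon v s 3 = ev v s 1" "cube_hexagon v s 4 = od v s 3" "cube_hexagon v s 5 = ev v s 2"
  by (simp_all add: cube_hexagon_def Let_def axis_vec3 ev_nth od_nth vec3_eq_iff)

lemma cube_hexagon_opposite: "cube_hexagon (v + s) (- s) i = cube_hexagon v s (i + 3)"
proof -
  have "\<forall>i. cube_hexagon (v + s) (- s) i = cube_hexagon v s (i + 3)"
    unfolding forall_6 by (simp add: cube_hexagon_nth ev_nth od_nth vec3_eq_iff)
  then show ?thesis by blast
qed

section \<open>Changing the representatives and the starting corner of a hexagon\<close>

lemma hexagon_vertices_parallel:
  assumes "hexagon_vertices L x" "hexagon_vertices L x'"
  obtains a where "\<And>i. a i \<noteq> 0" "\<And>i. x' i = a i *\<^sub>R x i"
proof -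
  have "\<exists>a. a \<noteq> 0 \<and> x' i = a *\<^sub>R x i" for i
  proof -
    have "span {x i} = span {x' i}" "x' i \<noteq> 0" using assms unfolding hexagon_vertices_def by metis+
    then have "x' i \<in> span {x i}" using span_base by blast
    then obtain a where "x' i = a *\<^sub>R x i" unfolding span_singleton by blast
    then show ?thesis using \<open>x' i \<noteq> 0\<close> by auto
  qed
  then show ?thesis using that by metis
qed

lemma span_scaled_triple:
  fixes a b c :: "'a::real_vector"
  assumes "r \<noteq> 0" "s \<noteq> 0" "t \<noteq> (0::real)"
  shows "span {r *\<^sub>R a, s *\<^sub>R b, t *\<^sub>R c} = span {a, b, c}"
proof -
  have 1: "span {r *\<^sub>R a, s *\<^sub>R b, t *\<^sub>R c} \<subseteq> span {a, b, c}" for r s t and a b c :: 'a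
    by (rule span_minimal) (auto intro: span_scale span_base)
  have "span {a, b, c} \<subseteq> span {r *\<^sub>R a, s *\<^sub>R b, t *\<^sub>R c}"
    using 1[of "1 / r" "r *\<^sub>R a" "1 / s" "s *\<^sub>R b" "1 / t" "t *\<^sub>R c"] assms by simp
  then show ?thesis using 1 by blast
qed

lemma associated_correlation_rescale:
  assumes "associated_correlation B x" "\<And>i. a i \<noteq> 0" "\<And>i. x' i = a i *\<^sub>R x i"
  shows "associated_correlation B x'"
proof -
  have "correlation B (x' i) = correlation B (x i)" for i
    using assms(2)[of i] by (simp add: correlation_def assms(3) matrix_vector_mult_scaleR)
  moreover have "hexagon_plane x' i = hexagon_plane x i" for i
    unfolding hexagon_plane_def assms(3) using assms(2) by (intro span_scaled_triple)
  ultimately show ?thesis using assms(1) unfolding associated_correlation_def by simp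
qed

text \<open>Seen from the other end the hexagon is rotated by three places, which respects the
  associated correlation, and the correlation acts on lines as an involution.\<close>

lemma correlated_opposite:
  assumes "subspace (lie_line \<Phi> (V v))" "correlated \<Phi> V v s"
  shows "correlated \<Phi> V (v + s) (- s)"
proof -
  from assms(2) obtain x B where x: "hexagon_vertices (\<lambda>i. lie_line \<Phi> (V (cube_hexagon v s i))) x"
    and B: "associated_correlation B x" "correlation_line B (lie_line \<Phi> (V v)) = lie_line \<Phi> (V (v + s))"
    unfolding correlated_def by blast
  have 33: "(i::6) + 3 + 3 = i" "i + 3 - 1 = i - 1 + 3" "i + 3 + 1 = i + 1 + 3" for i
    by (simp_all add: algebra_simps)
  define x' where "x' = (\<lambda>i. x (i + 3))"
  have "hexagon_vertices (\<lambda>i. lie_line \<Phi> (V (cube_hexagon (v + s) (- s) i))) x'"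
    using x unfolding hexagon_vertices_def x'_def cube_hexagon_opposite 33(3)[symmetric] by blast
  moreover have "hexagon_plane x' i = hexagon_plane x (i + 3)" for i
    by (simp only: hexagon_plane_def x'_def 33(2,3))
  then have "associated_correlation B x'"
    using B(1) unfolding associated_correlation_def by (simp add: x'_def)
  moreover have "correlation_line B (lie_line \<Phi> (V (v + s))) = lie_line \<Phi> (V v)"
    using correlation_line_involution[of B "lie_line \<Phi> (V v)"] B assms(1) unfolding associated_correlation_def by metis
  ultimately show ?thesis unfolding correlated_def by (metis add_diff_cancel diff_conv_add_uminus)
qed

lemma cmod_cpx: "cmod (cpx z - cpx w) = dist z w"
  by (simp add: cmod_def dist_norm norm_vec_def L2_set_def sum_2)

locale pattern = lie_model \<Phi> J \<kappa> for \<Phi> J \<kappa> +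
  fixes p :: "int^3 \<Rightarrow> real^2" and cc :: "int^3 \<Rightarrow> circle"
  assumes pcc: "fundamental_point_circle_complex p cc"
    and gen: "generic \<Phi> p cc"
begin

abbreviation pc :: "int^3 \<Rightarrow> complex" where "pc n \<equiv> cpx (p n)"
abbreviation zc :: "int^3 \<Rightarrow> complex" where "zc v \<equiv> cpx (fst (cc v))"
abbreviation R :: "int^3 \<Rightarrow> real" where "R v \<equiv> snd (cc v)"

text \<open>Any square root would do: the other one only changes the representative of the contact
  point.\<close>

definition xi :: "(int^3 \<Rightarrow> real) \<Rightarrow> int^3 \<Rightarrow> int^3 \<Rightarrow> complex" where
  "xi \<sigma> n v = csqrt ((pc n - zc v) / of_real (\<sigma> v * R v))"

definition contact :: "(int^3 \<Rightarrow> real) \<Rightarrow> int^3 \<Rightarrow> int^3 \<Rightarrow> real^4" where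
  "contact \<sigma> n v = X (xi \<sigma> n v) (pc n)"

abbreviation ell :: "(int^3 \<Rightarrow> real) \<Rightarrow> int^3 \<Rightarrow> (real^4) set" where
  "ell \<sigma> n \<equiv> lie_line \<Phi> (as_lie_circles p cc \<sigma> n)"

lemma R_pos: "v \<in> odd_lattice \<Longrightarrow> 0 < R v"
  using pcc by (auto simp: fundamental_point_circle_complex_def)

lemma not_even: "v \<in> odd_lattice \<Longrightarrow> v \<notin> even_lattice" "v \<notin> even_lattice \<Longrightarrow> v \<in> odd_lattice"
  by (auto simp: even_lattice_def odd_lattice_def)

lemma ell_even: "n \<in> even_lattice \<Longrightarrow> ell \<sigma> n = pt_line (pc n)"
  by (simp add: as_lie_circles_def lie_line_point)

lemma ell_odd: "v \<in> odd_lattice \<Longrightarrow> ell \<sigma> v = circ_line (zc v) (\<sigma> v * R v)"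
  by (simp add: as_lie_circles_def lie_line_circle not_even)

lemma subspace_ell: "subspace (ell \<sigma> n)"
  by (cases "n \<in> even_lattice") (auto simp: ell_even ell_odd not_even pt_line_circ_line subspace_circ_line)

lemma xi_properties:
  assumes "n \<in> even_lattice" "v \<in> odd_lattice" "neighbours n v" "\<sigma> v \<in> {-1, 1}"
  shows "cmod (xi \<sigma> n v) = 1" "pc n = zc v + of_real (\<sigma> v * R v) * (xi \<sigma> n v)\<^sup>2" "\<sigma> v * R v \<noteq> 0"
proof -
  have "p n \<in> sphere (fst (cc v)) (R v)" using pcc assms by (auto simp: fundamental_point_circle_complex_def)
  then have d: "cmod (pc n - zc v) = R v" unfolding cmod_cpx by (simp add: dist_commute)
  show nz: "\<sigma> v * R v \<noteq> 0" using R_pos[OF assms(2)] assms(4) by auto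
  have "cmod ((pc n - zc v) / of_real (\<sigma> v * R v)) = 1"
    using d R_pos[OF assms(2)] assms(4) by (auto simp: norm_divide norm_mult)
  then show "cmod (xi \<sigma> n v) = 1" by (simp add: xi_def)
  show "pc n = zc v + of_real (\<sigma> v * R v) * (xi \<sigma> n v)\<^sup>2"
    using nz by (simp add: xi_def)
qed

lemma contact_properties:
  assumes "n \<in> even_lattice" "v \<in> odd_lattice" "neighbours n v" "\<sigma> v \<in> {-1, 1}"
  shows "contact \<sigma> n v \<noteq> 0" "ell \<sigma> n \<inter> ell \<sigma> v = span {contact \<sigma> n v}" "ell \<sigma> v \<inter> ell \<sigma> n = span {contact \<sigma> n v}"
proof -
  note xi = xi_properties[where \<sigma>=\<sigma>, OF assms]
  show "contact \<sigma> n v \<noteq> 0" unfolding contact_def using xi(1) by (intro X_nonzero) auto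
  show "ell \<sigma> n \<inter> ell \<sigma> v = span {contact \<sigma> n v}"
    unfolding contact_def ell_even[OF assms(1)] ell_odd[OF assms(2)]
    by (rule pt_circ_inter[OF xi(2,1,3)])
  then show "ell \<sigma> v \<inter> ell \<sigma> n = span {contact \<sigma> n v}" by blast
qed

text \<open>Only the four circles of the cube need a sign, so that Cauchy data can be treated before
  they are extended to an orientation.\<close>

definition admissible :: "(int^3 \<Rightarrow> real) \<Rightarrow> int^3 \<Rightarrow> int^3 \<Rightarrow> bool" where
  "admissible \<sigma> v s \<longleftrightarrow> v \<in> even_lattice \<and> s \<in> diagonals \<and> (\<forall>k. \<sigma> (od v s k) \<in> {-1, 1})"

lemma cube_tetra:
  assumes "admissible \<sigma> v s"
  shows "model_tetra \<Phi> J \<kappa> (\<lambda>k. pc (ev v s k)) (\<lambda>k. zc (od v s k)) (\<lambda>k. \<sigma> (od v s k) * R (od v s k))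
     (\<lambda>i j. xi \<sigma> (ev v s i) (od v s j))"
proof unfold_locales
  have a: "v \<in> even_lattice" "s \<in> diagonals" "\<And>k. \<sigma> (od v s k) \<in> {-1, 1}" using assms by (auto simp: admissible_def)
  fix i j :: 4
  note xi = xi_properties[where \<sigma>=\<sigma>, OF cube_even[OF a(1,2), of i] cube_odd[OF a(1,2), of j] cube_neighbours[OF a(2), of i j v] a(3)[of j]]
  show "\<sigma> (od v s j) * R (od v s j) \<noteq> 0"
    using R_pos[OF cube_odd[OF a(1,2)], of j] a(3)[of j] by auto
  assume ij: "i \<noteq> j"
  show "pc (ev v s i) = zc (od v s j) + of_real (\<sigma> (od v s j) * R (od v s j)) * (xi \<sigma> (ev v s i) (od v s j))\<^sup>2"
    "cmod (xi \<sigma> (ev v s i) (od v s j)) = 1"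
    using xi[OF ij] by blast+
  have "p (ev v s i) \<noteq> p (ev v s j)"
    using gen cube_nearby(1)[OF a(2) ij] cube_even[OF a(1,2)] unfolding generic_def by blast
  then show "pc (ev v s i) \<noteq> pc (ev v s j)" by (simp add: vec_eq_iff forall_2)
  have ne: "cc (od v s i) \<noteq> cc (od v s j)"
    using gen cube_nearby(2)[OF a(2) ij] cube_odd[OF a(1,2)] unfolding generic_def by blast
  assume "zc (od v s i) = zc (od v s j)"
  then have "fst (cc (od v s i)) = fst (cc (od v s j))" by (simp add: vec_eq_iff forall_2)
  then have "R (od v s i) \<noteq> R (od v s j)" using ne by (simp add: prod_eq_iff)
  moreover have "\<bar>\<sigma> (od v s k)\<bar> = 1" for k using a(3)[of k] by auto
  ultimately show "\<bar>\<sigma> (od v s i) * R (od v s i)\<bar> \<noteq> \<bar>\<sigma> (od v s j) * R (od v s j)\<bar>"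
    using R_pos[OF cube_odd[OF a(1,2)], of i] R_pos[OF cube_odd[OF a(1,2)], of j] by (simp add: abs_mult)
qed

end

section \<open>The sign condition of a cube\<close>

text \<open>Twice the oriented area of the triangle.\<close>

definition area3 :: "complex \<Rightarrow> complex \<Rightarrow> complex \<Rightarrow> real" where
  "area3 a b c = Im (cnj (b - a) * (c - a))"

lemma area3_swap: "area3 b a c = - area3 a b c" "area3 a c b = - area3 a b c"
  by (simp_all add: area3_def algebra_simps)

definition Theta :: "complex \<Rightarrow> complex \<Rightarrow> complex \<Rightarrow> complex \<Rightarrow> real" where
  "Theta a b c d = area3 b c d * area3 a c d * area3 a b d * area3 a b c"

text \<open>A transposition of two points exchanges two of the triangles and reverses the
  orientation of the other two.\<close>

lemma Theta_swap: "Theta b a c d = Theta a b c d" "Theta a c b d = Theta a b c d" "Theta a b d c = Theta a b c d"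
  unfolding Theta_def
  by (simp_all add: area3_swap(1)[of b a] area3_swap(1)[of c b] area3_swap(1)[of d c]
      area3_swap(2)[of _ b a] area3_swap(2)[of _ c b] area3_swap(2)[of _ d c])

lemma (in tetra) Delta_Theta:
  assumes "distinct [i, j, k, l]"
  shows "\<Delta> i j k l = 16 * (r i * r j * r k * r l) * Theta (q i) (q j) (q k) (q l)"
proof -
  have d: "distinct [j, i, k, l]" "distinct [k, i, j, l]" "distinct [l, i, j, k]" using assms by auto
  have dl: "\<delta> a b c d = - 2 * r a * area3 (q b) (q c) (q d)" if "distinct [a, b, c, d]" for a b c d
    unfolding area3_def using that by (rule delta_area)
  show ?thesis
    unfolding \<Delta>_def dl[OF assms] dl[OF d(1)] dl[OF d(2)] dl[OF d(3)] Theta_def by (simp add: mult_ac)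
qed

lemma proj_coplanar_scale:
  assumes "a \<noteq> 0" "b \<noteq> 0" "c \<noteq> 0" "d \<noteq> 0"
  shows "proj_coplanar {a *\<^sub>R x, b *\<^sub>R y, c *\<^sub>R z, d *\<^sub>R w} \<longleftrightarrow> proj_coplanar {x, y, z, w}"
  unfolding proj_coplanar_def using assms by simp

definition main_diagonal :: "int^3" where "main_diagonal = vec3 1 1 1"

lemma level_main_diagonal: "level (n + main_diagonal) = level n + 3"
  by (simp add: level_def main_diagonal_def)

lemma level_shift: "level (n + unit_shift l) = level n + 1"
proof -
  have "\<forall>l. level (n + unit_shift l) = level n + 1" unfolding forall_3 unit_shift_vec3 level_def by simp
  then show ?thesis by blast
qed

context pattern
begin

definition good :: "(int^3 \<Rightarrow> real) \<Rightarrow> int^3 \<Rightarrow> int^3 \<Rightarrow> bool" where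
  "good \<sigma> v s \<longleftrightarrow> \<sigma> (od v s 0) * \<sigma> (od v s 1) * \<sigma> (od v s 2) * \<sigma> (od v s 3)
     * Theta (pc (ev v s 0)) (pc (ev v s 1)) (pc (ev v s 2)) (pc (ev v s 3)) < 0"

definition hex :: "(int^3 \<Rightarrow> real) \<Rightarrow> int^3 \<Rightarrow> int^3 \<Rightarrow> 6 \<Rightarrow> real^4" where
  "hex \<sigma> v s = (let cx = (\<lambda>i j. contact \<sigma> (ev v s i) (od v s j)) in
    (\<lambda>m. if m = 0 then cx 3 1 else if m = 1 then cx 3 2 else if m = 2 then cx 1 2
     else if m = 3 then cx 1 3 else if m = 4 then cx 2 3 else cx 2 1))"

lemma Delta_good:
  assumes "admissible \<sigma> v s"
  shows "tetra.\<Delta> (\<lambda>k. \<sigma> (od v s k) * R (od v s k)) (\<lambda>i j. xi \<sigma> (ev v s i) (od v s j)) 0 1 2 3 < 0 \<longleftrightarrow> good \<sigma> v s"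
    and "Theta (pc (ev v s 0)) (pc (ev v s 1)) (pc (ev v s 2)) (pc (ev v s 3)) \<noteq> 0"
proof -
  interpret T: model_tetra \<Phi> J \<kappa> "\<lambda>k. pc (ev v s k)" "\<lambda>k. zc (od v s k)" "\<lambda>k. \<sigma> (od v s k) * R (od v s k)"
     "\<lambda>i j. xi \<sigma> (ev v s i) (od v s j)"
    by (rule cube_tetra[OF assms])
  have R: "R (od v s k) > 0" for k using R_pos cube_odd assms by (auto simp: admissible_def)
  have d: "distinct [0::4, 1, 2, 3]" by simp
  have "T.\<Delta> 0 1 2 3 = 16 * (R (od v s 0) * R (od v s 1) * R (od v s 2) * R (od v s 3)) *
    (\<sigma> (od v s 0) * \<sigma> (od v s 1) * \<sigma> (od v s 2) * \<sigma> (od v s 3)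
     * Theta (pc (ev v s 0)) (pc (ev v s 1)) (pc (ev v s 2)) (pc (ev v s 3)))"
    unfolding T.Delta_Theta[OF d] by (simp only: mult_ac)
  moreover have "0 < 16 * (R (od v s 0) * R (od v s 1) * R (od v s 2) * R (od v s 3))"
    using R[of 0] R[of 1] R[of 2] R[of 3] by simp
  ultimately show "T.\<Delta> 0 1 2 3 < 0 \<longleftrightarrow> good \<sigma> v s"
    unfolding good_def using mult_less_cancel_left_pos[of _ _ 0] by (simp only: mult_zero_right)
  show "Theta (pc (ev v s 0)) (pc (ev v s 1)) (pc (ev v s 2)) (pc (ev v s 3)) \<noteq> 0"
    using T.Delta_nonzero[OF d] unfolding T.Delta_Theta[OF d] by auto
qed

lemma contact_cube:
  assumes "admissible \<sigma> v s" "i \<noteq> j"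
  shows "contact \<sigma> (ev v s i) (od v s j) \<noteq> 0"
    "ell \<sigma> (ev v s i) \<inter> ell \<sigma> (od v s j) = span {contact \<sigma> (ev v s i) (od v s j)}"
    "ell \<sigma> (od v s j) \<inter> ell \<sigma> (ev v s i) = span {contact \<sigma> (ev v s i) (od v s j)}"
proof -
  have a: "v \<in> even_lattice" "s \<in> diagonals" "\<And>k. \<sigma> (od v s k) \<in> {-1, 1}" using assms(1) by (auto simp: admissible_def)
  note c = contact_properties[where \<sigma>=\<sigma>, OF cube_even[OF a(1,2), of i] cube_odd[OF a(1,2), of j] cube_neighbours[OF a(2) assms(2), of v] a(3)[of j]]
  show "contact \<sigma> (ev v s i) (od v s j) \<noteq> 0"
    "ell \<sigma> (ev v s i) \<inter> ell \<sigma> (od v s j) = span {contact \<sigma> (ev v s i) (od v s j)}"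
    "ell \<sigma> (od v s j) \<inter> ell \<sigma> (ev v s i) = span {contact \<sigma> (ev v s i) (od v s j)}"
    by (rule c)+
qed

lemma hexagon_vertices_hex:
  assumes "admissible \<sigma> v s"
  shows "hexagon_vertices (\<lambda>i. ell \<sigma> (cube_hexagon v s i)) (hex \<sigma> v s)"
  unfolding hexagon_vertices_def forall_6
  by (simp add: cube_hexagon_nth hex_def contact_cube[OF assms])

text \<open>Genericity speaks of global orientations, so the four signs of a cube are completed by 1
  elsewhere.\<close>

lemma extend_orientation:
  assumes "admissible \<sigma> v s"
  obtains \<sigma>' where "\<sigma>' \<in> orientations" "\<And>k. \<sigma>' (od v s k) = \<sigma> (od v s k)"
proof -
  define \<sigma>' where "\<sigma>' = (\<lambda>u. if u \<in> range (od v s) then \<sigma> u else if u \<in> odd_lattice then 1 else undefined)"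
  have "\<sigma>' \<in> orientations"
    unfolding orientations_def
  proof (rule PiE_I)
    fix u assume u: "u \<in> odd_lattice"
    show "\<sigma>' u \<in> {-1, 1}"
    proof (cases "u \<in> range (od v s)")
      case True
      then have "\<sigma> u \<in> {-1, 1}" using assms unfolding admissible_def by blast
      then show ?thesis using True by (simp add: \<sigma>'_def)
    qed (use u in \<open>simp add: \<sigma>'_def\<close>)
  next
    fix u assume u: "u \<notin> odd_lattice"
    then have "u \<notin> range (od v s)" using assms cube_odd unfolding admissible_def by blast
    then show "\<sigma>' u = undefined" using u by (simp add: \<sigma>'_def)
  qed
  then show ?thesis by (rule that) (simp add: \<sigma>'_def)
qed

lemma ell_cong: "n \<in> even_lattice \<or> \<sigma> n = \<sigma>' n \<Longrightarrow> ell \<sigma> n = ell \<sigma>' n"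
  by (auto simp: as_lie_circles_def)

lemma cube_hexagon_cases: "(\<exists>k. k \<noteq> 0 \<and> cube_hexagon v s i = ev v s k) \<or> (\<exists>k. k \<noteq> 0 \<and> cube_hexagon v s i = od v s k)"
proof -
  have "\<forall>i. (\<exists>k. k \<noteq> 0 \<and> cube_hexagon v s i = ev v s k) \<or> (\<exists>k. k \<noteq> 0 \<and> cube_hexagon v s i = od v s k)"
  proof -
    have "(1::4) \<noteq> 0" "(2::4) \<noteq> 0" "(3::4) \<noteq> 0" by simp_all
    then show ?thesis unfolding forall_6 cube_hexagon_nth by blast
  qed
  from spec[OF this, of i] show ?thesis .
qed

lemma general_position_cube:
  assumes "admissible \<sigma> v s"
  obtains x where "hexagon_vertices (\<lambda>i. ell \<sigma> (cube_hexagon v s i)) x" "general_position x"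
proof -
  obtain \<sigma>' where s': "\<sigma>' \<in> orientations" "\<And>k. \<sigma>' (od v s k) = \<sigma> (od v s k)"
    using extend_orientation[OF assms] by blast
  have "ell \<sigma>' (cube_hexagon v s i) = ell \<sigma> (cube_hexagon v s i)" for i
    using cube_hexagon_cases[of v s i] cube_even s'(2) assms unfolding admissible_def
    by (intro ell_cong) auto
  moreover obtain x where "hexagon_vertices (\<lambda>i. ell \<sigma>' (cube_hexagon v s i)) x" "general_position x"
    using gen s'(1) assms unfolding generic_def admissible_def by blast
  ultimately show ?thesis using that by simp
qed

lemma correlated_if_good:
  assumes "admissible \<sigma> v s" "good \<sigma> v s"
  obtains B where "associated_correlation B (hex \<sigma> v s)" "correlation_line B (ell \<sigma> v) = ell \<sigma> (v + s)"
proof -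
  interpret T: model_tetra \<Phi> J \<kappa> "\<lambda>k. pc (ev v s k)" "\<lambda>k. zc (od v s k)" "\<lambda>k. \<sigma> (od v s k) * R (od v s k)"
     "\<lambda>i j. xi \<sigma> (ev v s i) (od v s j)"
    by (rule cube_tetra[OF assms(1)])
  have a: "v \<in> even_lattice" "s \<in> diagonals" using assms(1) by (auto simp: admissible_def)
  have "T.\<Delta> 0 1 2 3 < 0" using Delta_good[OF assms(1)] assms(2) by blast
  \<comment> \<open>The pair \<open>v\<close>, \<open>v + s\<close> has index 0, and
    \<open>opposite_correlated\<close> concerns the pair listed last.\<close>
  then have "T.\<Delta> 1 2 3 0 < 0" using T.Delta_swap by metis
  then obtain B where B: "associated_correlation B (T.hexagon 1 2 3)"
    "correlation_line B (pt_line (pc (ev v s 0))) = circ_line (zc (od v s 0)) (\<sigma> (od v s 0) * R (od v s 0))"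
    using T.opposite_correlated[of 1 2 3 0] by auto
  have "T.hexagon 1 2 3 = hex \<sigma> v s"
    by (rule ext) (simp add: T.hexagon_def hex_def contact_def)
  moreover have "pt_line (pc (ev v s 0)) = ell \<sigma> v" using ell_even[OF a(1)] by (simp add: ev_nth)
  moreover have "circ_line (zc (od v s 0)) (\<sigma> (od v s 0) * R (od v s 0)) = ell \<sigma> (v + s)"
    using ell_odd[OF cube_odd[OF a, of 0]] by (simp add: od_nth)
  ultimately show ?thesis using that B by simp
qed

lemma correlated_iff_good:
  assumes "admissible \<sigma> v s"
  shows "correlated \<Phi> (as_lie_circles p cc \<sigma>) v s \<longleftrightarrow> good \<sigma> v s"
proof
  assume "good \<sigma> v s"
  then show "correlated \<Phi> (as_lie_circles p cc \<sigma>) v s"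
    using correlated_if_good[OF assms] hexagon_vertices_hex[OF assms] unfolding correlated_def by metis
next
  assume "correlated \<Phi> (as_lie_circles p cc \<sigma>) v s"
  then obtain x B where x: "hexagon_vertices (\<lambda>i. ell \<sigma> (cube_hexagon v s i)) x"
    and B: "associated_correlation B x" "correlation_line B (ell \<sigma> v) = ell \<sigma> (v + s)"
    unfolding correlated_def by blast
  have a: "v \<in> even_lattice" "s \<in> diagonals" "\<And>k. \<sigma> (od v s k) \<in> {-1, 1}" using assms by (auto simp: admissible_def)
  show "good \<sigma> v s"
  proof (rule ccontr)
    assume ng: "\<not> good \<sigma> v s"
    \<comment> \<open>The circle at \<open>v + s\<close> is not a side of the hexagon, so reversing
      it keeps the hexagon and makes the cube good.\<close>
    define \<sigma>' where "\<sigma>' = \<sigma>(v + s := - \<sigma> (v + s))"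
    have s': "\<sigma>' (od v s 0) = - \<sigma> (od v s 0)" "\<And>k. k \<noteq> 0 \<Longrightarrow> \<sigma>' (od v s k) = \<sigma> (od v s k)"
      using cube_distinct(2)[OF a(2), of _ 0 v] by (auto simp: \<sigma>'_def od_nth)
    have adm: "admissible \<sigma>' v s"
      unfolding admissible_def
    proof (intro conjI a(1,2) allI)
      fix k show "\<sigma>' (od v s k) \<in> {-1, 1}" using s' a(3)[of k] by (cases "k = 0") auto
    qed
    have "good \<sigma>' v s"
    proof -
      have "\<sigma> (od v s 0) * \<sigma> (od v s 1) * \<sigma> (od v s 2) * \<sigma> (od v s 3) \<noteq> 0"
        using a(3)[of 0] a(3)[of 1] a(3)[of 2] a(3)[of 3] by auto
      then show ?thesis
        using ng Delta_good(2)[OF assms] unfolding good_def by (simp add: s' not_less less_le)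
    qed
    then obtain B' where B': "associated_correlation B' (hex \<sigma>' v s)" "correlation_line B' (ell \<sigma>' v) = ell \<sigma>' (v + s)"
      using correlated_if_good[OF adm] by blast
    have lines: "ell \<sigma>' (cube_hexagon v s i) = ell \<sigma> (cube_hexagon v s i)" for i
      using cube_hexagon_cases[of v s i] cube_even a(1,2) s'(2) by (intro ell_cong) auto
    have hv: "hexagon_vertices (\<lambda>i. ell \<sigma> (cube_hexagon v s i)) (hex \<sigma>' v s)"
      using hexagon_vertices_hex[OF adm] unfolding lines .
    \<comment> \<open>Uniqueness of the correlation needs general position, which genericity grants
      for some choice of representatives of the vertices; both correlations are carried over to that
      choice.\<close>
    obtain y where y: "hexagon_vertices (\<lambda>i. ell \<sigma> (cube_hexagon v s i)) y" "general_position y"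
      using general_position_cube[OF assms] by blast
    have "associated_correlation B y" "associated_correlation B' y"
      using hexagon_vertices_parallel[OF x y(1)] hexagon_vertices_parallel[OF hv y(1)]
        associated_correlation_rescale[OF B(1)] associated_correlation_rescale[OF B'(1)] by metis+
    then have "correlation_line B' (ell \<sigma> v) = correlation_line B (ell \<sigma> v)"
      using correlation_line_unique[OF y(2)] by blast
    moreover have "ell \<sigma>' v = ell \<sigma> v" using a(1) by (intro ell_cong) simp
    ultimately have "ell \<sigma>' (v + s) = ell \<sigma> (v + s)" using B(2) B'(2) by simp
    then have "circ_line (zc (v + s)) (\<sigma>' (v + s) * R (v + s)) = circ_line (zc (v + s)) (\<sigma> (v + s) * R (v + s))"
      using ell_odd[OF cube_odd[OF a(1,2), of 0]] by (simp add: od_nth)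
    from circ_line_inject[OF this] show False
      using R_pos[OF cube_odd[OF a(1,2), of 0]] a(3)[of 0] by (simp add: \<sigma>'_def od_nth)
  qed
qed

lemma correlated_opposite_iff:
  "correlated \<Phi> (as_lie_circles p cc \<sigma>) (v + s) (- s) \<longleftrightarrow> correlated \<Phi> (as_lie_circles p cc \<sigma>) v s"
  using correlated_opposite[where v=v and s=s and V="as_lie_circles p cc \<sigma>"]
    correlated_opposite[where v="v + s" and s="- s" and V="as_lie_circles p cc \<sigma>"] subspace_ell by auto

lemma coplanar_iff_good:
  assumes "admissible \<sigma> v s"
  defines "cx \<equiv> (\<lambda>i j. contact \<sigma> (ev v s i) (od v s j))"
  shows "proj_coplanar {cx 0 1, cx 1 0, cx 2 3, cx 3 2} \<longleftrightarrow> good \<sigma> v s"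
    "proj_coplanar {cx 0 2, cx 2 0, cx 1 3, cx 3 1} \<longleftrightarrow> good \<sigma> v s"
    "proj_coplanar {cx 0 3, cx 3 0, cx 1 2, cx 2 1} \<longleftrightarrow> good \<sigma> v s"
proof -
  interpret T: model_tetra \<Phi> J \<kappa> "\<lambda>k. pc (ev v s k)" "\<lambda>k. zc (od v s k)" "\<lambda>k. \<sigma> (od v s k) * R (od v s k)"
     "\<lambda>i j. xi \<sigma> (ev v s i) (od v s j)"
    by (rule cube_tetra[OF assms(1)])
  have cx: "cx i j = T.XX i j" for i j by (simp add: cx_def contact_def)
  have sw: "T.\<Delta> 0 2 1 3 = T.\<Delta> 0 1 2 3" "T.\<Delta> 0 3 1 2 = T.\<Delta> 0 1 2 3" using T.Delta_swap by metis+
  show "proj_coplanar {cx 0 1, cx 1 0, cx 2 3, cx 3 2} \<longleftrightarrow> good \<sigma> v s"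
    unfolding cx using T.coplanar_iff[of 0 1 2 3] Delta_good[OF assms(1)] by simp
  show "proj_coplanar {cx 0 2, cx 2 0, cx 1 3, cx 3 1} \<longleftrightarrow> good \<sigma> v s"
    unfolding cx using T.coplanar_iff[of 0 2 1 3] Delta_good[OF assms(1)] sw by simp
  show "proj_coplanar {cx 0 3, cx 3 0, cx 1 2, cx 2 1} \<longleftrightarrow> good \<sigma> v s"
    unfolding cx using T.coplanar_iff[of 0 3 1 2] Delta_good[OF assms(1)] sw by simp
qed

section \<open>From single cubes to fundamental circle complexes\<close>

definition edge_point :: "(int^3 \<Rightarrow> real) \<Rightarrow> 3 \<Rightarrow> int^3 \<Rightarrow> real^4" where
  "edge_point \<sigma> l n = (if n \<in> even_lattice then contact \<sigma> n (n + unit_shift l) else contact \<sigma> (n + unit_shift l) n)"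

text \<open>A cube is named by its lowest corner, but \<open>good\<close> starts from an even
  corner; for odd \<open>n\<close> this is the opposite one.\<close>

definition cube_good :: "(int^3 \<Rightarrow> real) \<Rightarrow> int^3 \<Rightarrow> bool" where
  "cube_good \<sigma> n \<longleftrightarrow> (if n \<in> even_lattice then good \<sigma> n main_diagonal else good \<sigma> (n + main_diagonal) (- main_diagonal))"

lemma lie_circle_oriented_circle: "lie_circle (oriented_circle z r)"
  by (simp add: oriented_circle_def lie_circle_def lie_form_def zero_prod_def power2_eq_square field_simps)

lemma orientation_admissible: "\<sigma> \<in> orientations \<Longrightarrow> v \<in> even_lattice \<Longrightarrow> s \<in> diagonals \<Longrightarrow> admissible \<sigma> v s"
  unfolding admissible_def orientations_def using cube_odd by auto

lemma edge_point_properties: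
  assumes "\<sigma> \<in> orientations"
  shows "edge_point \<sigma> l n \<noteq> 0" "ell \<sigma> n \<inter> ell \<sigma> (n + unit_shift l) = span {edge_point \<sigma> l n}"
proof -
  have nb: "neighbours n (n + unit_shift l)" "neighbours (n + unit_shift l) n" unfolding neighbours_def by blast+
  have s: "v \<in> odd_lattice \<Longrightarrow> \<sigma> v \<in> {-1, 1}" for v using assms unfolding orientations_def by auto
  have par: "n + unit_shift l \<in> even_lattice \<longleftrightarrow> n \<in> odd_lattice" "n + unit_shift l \<in> odd_lattice \<longleftrightarrow> n \<in> even_lattice"
    by (simp_all add: even_lattice_def odd_lattice_def level_shift)
  show "edge_point \<sigma> l n \<noteq> 0" "ell \<sigma> n \<inter> ell \<sigma> (n + unit_shift l) = span {edge_point \<sigma> l n}"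
    using contact_properties[of n "n + unit_shift l" \<sigma>] contact_properties[of "n + unit_shift l" n \<sigma>] nb s par not_even
    unfolding edge_point_def by (cases "n \<in> even_lattice"; simp)+
qed

lemma main_diagonal_diagonal: "main_diagonal \<in> diagonals" "- main_diagonal \<in> diagonals"
  by (simp_all add: diagonals_iff main_diagonal_def)

text \<open>By the symmetry of \<Delta> the three edge directions of a cube impose one and the same
  condition, so the right-hand side does not mention the directions.\<close>

lemma edge_points_coplanar_iff:
  assumes "\<sigma> \<in> orientations" "distinct [l, m, q]"
  shows "proj_coplanar {edge_point \<sigma> l n, edge_point \<sigma> l (n + unit_shift m),
             edge_point \<sigma> l (n + unit_shift m + unit_shift q), edge_point \<sigma> l (n + unit_shift q)} \<longleftrightarrow> cube_good \<sigma> n"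
proof (cases "n \<in> even_lattice")
  case True
  let ?cx = "\<lambda>i j. contact \<sigma> (ev n main_diagonal i) (od n main_diagonal j)"
  have lev: "even (level n)" using True by (simp add: even_lattice_def)
  have e: "n \<in> even_lattice" "n + unit_shift 1 \<notin> even_lattice" "n + unit_shift 2 \<notin> even_lattice" "n + unit_shift 3 \<notin> even_lattice"
    "n + unit_shift 1 + unit_shift 2 \<in> even_lattice" "n + unit_shift 2 + unit_shift 3 \<in> even_lattice"
    "n + unit_shift 1 + unit_shift 3 \<in> even_lattice" "n + unit_shift 2 + unit_shift 1 \<in> even_lattice" "n + unit_shift 3 + unit_shift 2 \<in> even_lattice"
    "n + unit_shift 3 + unit_shift 1 \<in> even_lattice"
    using lev by (simp_all add: even_lattice_def level_shift)
  have v: "n + unit_shift 1 = od n main_diagonal 1" "n + unit_shift 2 = od n main_diagonal 2" "n + unit_shift 3 = od n main_diagonal 3"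
     "n + unit_shift 1 + unit_shift 2 = ev n main_diagonal 3" "n + unit_shift 2 + unit_shift 1 = ev n main_diagonal 3"
     "n + unit_shift 1 + unit_shift 3 = ev n main_diagonal 2" "n + unit_shift 3 + unit_shift 1 = ev n main_diagonal 2"
     "n + unit_shift 2 + unit_shift 3 = ev n main_diagonal 1" "n + unit_shift 3 + unit_shift 2 = ev n main_diagonal 1"
     "ev n main_diagonal 1 + unit_shift 1 = od n main_diagonal 0" "ev n main_diagonal 2 + unit_shift 2 = od n main_diagonal 0" "ev n main_diagonal 3 + unit_shift 3 = od n main_diagonal 0"
     "od n main_diagonal 1 + unit_shift 2 = ev n main_diagonal 3" "od n main_diagonal 1 + unit_shift 3 = ev n main_diagonal 2" "od n main_diagonal 2 + unit_shift 1 = ev n main_diagonal 3"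
     "od n main_diagonal 2 + unit_shift 3 = ev n main_diagonal 1" "od n main_diagonal 3 + unit_shift 1 = ev n main_diagonal 2" "od n main_diagonal 3 + unit_shift 2 = ev n main_diagonal 1"
    by (simp_all add: ev_nth od_nth main_diagonal_def unit_shift_vec3 vec3_eq_iff)
  have n: "contact \<sigma> n w = contact \<sigma> (ev n main_diagonal 0) w" for w by (simp add: ev_nth)
  have ep: "edge_point \<sigma> 1 n = ?cx 0 1" "edge_point \<sigma> 2 n = ?cx 0 2" "edge_point \<sigma> 3 n = ?cx 0 3"
    "edge_point \<sigma> 1 (n + unit_shift 2) = ?cx 3 2" "edge_point \<sigma> 1 (n + unit_shift 3) = ?cx 2 3"
    "edge_point \<sigma> 2 (n + unit_shift 1) = ?cx 3 1" "edge_point \<sigma> 2 (n + unit_shift 3) = ?cx 1 3"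
    "edge_point \<sigma> 3 (n + unit_shift 1) = ?cx 2 1" "edge_point \<sigma> 3 (n + unit_shift 2) = ?cx 1 2"
    "edge_point \<sigma> 1 (n + unit_shift 2 + unit_shift 3) = ?cx 1 0" "edge_point \<sigma> 1 (n + unit_shift 3 + unit_shift 2) = ?cx 1 0"
    "edge_point \<sigma> 2 (n + unit_shift 1 + unit_shift 3) = ?cx 2 0" "edge_point \<sigma> 2 (n + unit_shift 3 + unit_shift 1) = ?cx 2 0"
    "edge_point \<sigma> 3 (n + unit_shift 1 + unit_shift 2) = ?cx 3 0" "edge_point \<sigma> 3 (n + unit_shift 2 + unit_shift 1) = ?cx 3 0"
    unfolding edge_point_def using e by (simp_all only: if_True if_False n) (simp_all only: v)
  note g = coplanar_iff_good[OF orientation_admissible[OF assms(1) True main_diagonal_diagonal(1)]]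
  have g6: "proj_coplanar {?cx 0 1, ?cx 2 3, ?cx 1 0, ?cx 3 2} \<longleftrightarrow> good \<sigma> n main_diagonal"
    "proj_coplanar {?cx 0 1, ?cx 3 2, ?cx 1 0, ?cx 2 3} \<longleftrightarrow> good \<sigma> n main_diagonal"
    "proj_coplanar {?cx 0 2, ?cx 1 3, ?cx 2 0, ?cx 3 1} \<longleftrightarrow> good \<sigma> n main_diagonal"
    "proj_coplanar {?cx 0 2, ?cx 3 1, ?cx 2 0, ?cx 1 3} \<longleftrightarrow> good \<sigma> n main_diagonal"
    "proj_coplanar {?cx 0 3, ?cx 1 2, ?cx 3 0, ?cx 2 1} \<longleftrightarrow> good \<sigma> n main_diagonal"
    "proj_coplanar {?cx 0 3, ?cx 2 1, ?cx 3 0, ?cx 1 2} \<longleftrightarrow> good \<sigma> n main_diagonal"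
    using g by (simp_all only: insert_commute)
  have "\<forall>l m q. distinct [l, m, q] \<longrightarrow> (proj_coplanar {edge_point \<sigma> l n, edge_point \<sigma> l (n + unit_shift m),
             edge_point \<sigma> l (n + unit_shift m + unit_shift q), edge_point \<sigma> l (n + unit_shift q)} \<longleftrightarrow> good \<sigma> n main_diagonal)"
    unfolding forall_3 by (simp add: ep g6)
  then show ?thesis using assms(2) True unfolding cube_good_def by simp
next
  case False
  let ?v = "n + main_diagonal"
  let ?cx = "\<lambda>i j. contact \<sigma> (ev ?v (- main_diagonal) i) (od ?v (- main_diagonal) j)"
  have lev: "odd (level n)" using False by (simp add: even_lattice_def)
  have True: "?v \<in> even_lattice" using lev by (simp add: even_lattice_def level_main_diagonal)
  have e: "n \<notin> even_lattice" "n + unit_shift 1 \<in> even_lattice" "n + unit_shift 2 \<in> even_lattice" "n + unit_shift 3 \<in> even_lattice"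
    "n + unit_shift 1 + unit_shift 2 \<notin> even_lattice" "n + unit_shift 2 + unit_shift 3 \<notin> even_lattice"
    "n + unit_shift 1 + unit_shift 3 \<notin> even_lattice" "n + unit_shift 2 + unit_shift 1 \<notin> even_lattice" "n + unit_shift 3 + unit_shift 2 \<notin> even_lattice"
    "n + unit_shift 3 + unit_shift 1 \<notin> even_lattice"
    using lev by (simp_all add: even_lattice_def level_shift)
  have v: "n + unit_shift 1 = ev ?v (- main_diagonal) 1" "n + unit_shift 2 = ev ?v (- main_diagonal) 2" "n + unit_shift 3 = ev ?v (- main_diagonal) 3"
     "n + unit_shift 1 + unit_shift 2 = od ?v (- main_diagonal) 3" "n + unit_shift 2 + unit_shift 1 = od ?v (- main_diagonal) 3"
     "n + unit_shift 1 + unit_shift 3 = od ?v (- main_diagonal) 2" "n + unit_shift 3 + unit_shift 1 = od ?v (- main_diagonal) 2"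
     "n + unit_shift 2 + unit_shift 3 = od ?v (- main_diagonal) 1" "n + unit_shift 3 + unit_shift 2 = od ?v (- main_diagonal) 1"
     "od ?v (- main_diagonal) 1 + unit_shift 1 = ev ?v (- main_diagonal) 0" "od ?v (- main_diagonal) 2 + unit_shift 2 = ev ?v (- main_diagonal) 0" "od ?v (- main_diagonal) 3 + unit_shift 3 = ev ?v (- main_diagonal) 0"
     "ev ?v (- main_diagonal) 1 + unit_shift 2 = od ?v (- main_diagonal) 3" "ev ?v (- main_diagonal) 1 + unit_shift 3 = od ?v (- main_diagonal) 2" "ev ?v (- main_diagonal) 2 + unit_shift 1 = od ?v (- main_diagonal) 3"
     "ev ?v (- main_diagonal) 2 + unit_shift 3 = od ?v (- main_diagonal) 1" "ev ?v (- main_diagonal) 3 + unit_shift 1 = od ?v (- main_diagonal) 2" "ev ?v (- main_diagonal) 3 + unit_shift 2 = od ?v (- main_diagonal) 1"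
    by (simp_all add: ev_nth od_nth main_diagonal_def unit_shift_vec3 vec3_eq_iff)
  have n: "contact \<sigma> w n = contact \<sigma> w (od ?v (- main_diagonal) 0)" for w by (simp add: od_nth)
  have ep: "edge_point \<sigma> 1 n = ?cx 1 0" "edge_point \<sigma> 2 n = ?cx 2 0" "edge_point \<sigma> 3 n = ?cx 3 0"
    "edge_point \<sigma> 1 (n + unit_shift 2) = ?cx 2 3" "edge_point \<sigma> 1 (n + unit_shift 3) = ?cx 3 2"
    "edge_point \<sigma> 2 (n + unit_shift 1) = ?cx 1 3" "edge_point \<sigma> 2 (n + unit_shift 3) = ?cx 3 1"
    "edge_point \<sigma> 3 (n + unit_shift 1) = ?cx 1 2" "edge_point \<sigma> 3 (n + unit_shift 2) = ?cx 2 1"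
    "edge_point \<sigma> 1 (n + unit_shift 2 + unit_shift 3) = ?cx 0 1" "edge_point \<sigma> 1 (n + unit_shift 3 + unit_shift 2) = ?cx 0 1"
    "edge_point \<sigma> 2 (n + unit_shift 1 + unit_shift 3) = ?cx 0 2" "edge_point \<sigma> 2 (n + unit_shift 3 + unit_shift 1) = ?cx 0 2"
    "edge_point \<sigma> 3 (n + unit_shift 1 + unit_shift 2) = ?cx 0 3" "edge_point \<sigma> 3 (n + unit_shift 2 + unit_shift 1) = ?cx 0 3"
    unfolding edge_point_def using e by (simp_all only: if_True if_False n) (simp_all only: v)
  note g = coplanar_iff_good[OF orientation_admissible[OF assms(1) True main_diagonal_diagonal(2)]]
  have g6: "proj_coplanar {?cx 1 0, ?cx 2 3, ?cx 0 1, ?cx 3 2} \<longleftrightarrow> good \<sigma> ?v (- main_diagonal)"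
    "proj_coplanar {?cx 1 0, ?cx 3 2, ?cx 0 1, ?cx 2 3} \<longleftrightarrow> good \<sigma> ?v (- main_diagonal)"
    "proj_coplanar {?cx 2 0, ?cx 1 3, ?cx 0 2, ?cx 3 1} \<longleftrightarrow> good \<sigma> ?v (- main_diagonal)"
    "proj_coplanar {?cx 2 0, ?cx 3 1, ?cx 0 2, ?cx 1 3} \<longleftrightarrow> good \<sigma> ?v (- main_diagonal)"
    "proj_coplanar {?cx 3 0, ?cx 1 2, ?cx 0 3, ?cx 2 1} \<longleftrightarrow> good \<sigma> ?v (- main_diagonal)"
    "proj_coplanar {?cx 3 0, ?cx 2 1, ?cx 0 3, ?cx 1 2} \<longleftrightarrow> good \<sigma> ?v (- main_diagonal)"
    using g by (simp_all only: insert_commute)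
  have "\<forall>l m q. distinct [l, m, q] \<longrightarrow> (proj_coplanar {edge_point \<sigma> l n, edge_point \<sigma> l (n + unit_shift m),
             edge_point \<sigma> l (n + unit_shift m + unit_shift q), edge_point \<sigma> l (n + unit_shift q)} \<longleftrightarrow> good \<sigma> ?v (- main_diagonal))"
    unfolding forall_3 by (simp add: ep g6)
  then show ?thesis using assms(2) False unfolding cube_good_def by simp
qed

lemma fundamental_iff:
  assumes "\<sigma> \<in> orientations"
  shows "fundamental_circle_complex \<Phi> (as_lie_circles p cc \<sigma>) \<longleftrightarrow> (\<forall>n. cube_good \<sigma> n)"
proof
  assume "\<forall>n. cube_good \<sigma> n"
  moreover have "lie_circle (as_lie_circles p cc \<sigma> n)" for n
    by (simp add: as_lie_circles_def lie_circle_oriented_circle)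
  ultimately show "fundamental_circle_complex \<Phi> (as_lie_circles p cc \<sigma>)"
    unfolding fundamental_circle_complex_def
    using edge_point_properties[OF assms] edge_points_coplanar_iff[OF assms]
    by (intro conjI allI exI[of _ "edge_point \<sigma>"] impI) blast+
next
  assume "fundamental_circle_complex \<Phi> (as_lie_circles p cc \<sigma>)"
  then obtain P where P: "\<And>l n. P l n \<noteq> 0" "\<And>l n. ell \<sigma> n \<inter> ell \<sigma> (n + unit_shift l) = span {P l n}"
    and co: "\<And>l m q n. distinct [l, m, q] \<Longrightarrow> proj_coplanar {P l n, P l (n + unit_shift m), P l (n + unit_shift m + unit_shift q), P l (n + unit_shift q)}"
    unfolding fundamental_circle_complex_def by metis
  \<comment> \<open>The points of intersection are determined up to factors, which coplanarity
    ignores.\<close>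
  have "\<exists>a. a \<noteq> 0 \<and> P l n = a *\<^sub>R edge_point \<sigma> l n" for l n
  proof -
    have "P l n \<in> span {edge_point \<sigma> l n}"
      using P(2)[of n l] edge_point_properties(2)[OF assms, of n l] span_base[of "P l n" "{P l n}"] by simp
    then obtain a where "P l n = a *\<^sub>R edge_point \<sigma> l n" unfolding span_singleton by blast
    then show ?thesis using P(1)[of l n] by auto
  qed
  then obtain a where a: "\<And>l n. a l n \<noteq> 0" "\<And>l n. P l n = a l n *\<^sub>R edge_point \<sigma> l n" by metis
  show "\<forall>n. cube_good \<sigma> n"
  proof
    fix n
    have d: "distinct [1::3, 2, 3]" by simp
    show "cube_good \<sigma> n"
      using co[OF d, of n] unfolding a(2) proj_coplanar_scale[OF a(1) a(1) a(1) a(1)] edge_points_coplanar_iff[OF assms d] .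
  qed
qed

end

section \<open>The Cauchy problem for signs\<close>

lemma sign_mult: "x \<in> {-1, 1} \<Longrightarrow> y \<in> {-1, 1} \<Longrightarrow> x * y \<in> {-1, 1::real}"
  by auto

text \<open>The Cauchy circles in the coordinates of \<open>odd_vertex\<close>. The layers 0 and 1
  are the levels -1 and 1, and each of them carries three rays.\<close>

definition Cauchy_pos :: "int \<Rightarrow> int \<Rightarrow> int \<Rightarrow> bool" where
  "Cauchy_pos a b k \<longleftrightarrow>
     (k = 0 \<and> (b = 0 \<and> 0 \<le> a \<or> a = 0 \<and> 0 \<le> b \<or> a = b \<and> a \<le> 0)) \<or>
     (k = 1 \<and> (b = 0 \<and> 0 \<le> a \<or> a = 0 \<and> 1 \<le> b \<or> b = a + 1 \<and> a \<le> -1))"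

text \<open>Decreases along the recursion towards the two middle layers; inside these
  \<open>rank2\<close> takes over.\<close>

definition layer :: "int \<Rightarrow> nat" where
  "layer k = (if 2 \<le> k then nat k else if k < 0 then nat (2 - k) else 0)"

text \<open>One linear form for each sector between two rays. The shifts by 1 in layer 1 make it
  decrease also where the recursion passes from one of the two layers to the other.\<close>

definition rank2 :: "int \<Rightarrow> int \<Rightarrow> int \<Rightarrow> nat" where
  "rank2 a b k = (if Cauchy_pos a b k then 0 else if k = 0 then nat (max (a + b) (max (b - 2 * a) (a - 2 * b)))
     else nat (max (a + b) (max (b - 2 * a - 1) (a - 2 * b + 1))))"

lemma not_Cauchy_pos_0: "\<not> Cauchy_pos a b 0 \<Longrightarrow> \<not> (1 \<le> a \<and> 1 \<le> b) \<Longrightarrow> \<not> (a < 0 \<and> a < b) \<Longrightarrow> b < 0 \<and> b < a"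
  by (simp add: Cauchy_pos_def) linarith

lemma not_Cauchy_pos_1: "\<not> Cauchy_pos a b 1 \<Longrightarrow> \<not> (1 \<le> a \<and> 1 \<le> b) \<Longrightarrow> \<not> (a < 0 \<and> a + 1 < b) \<Longrightarrow> b < 0 \<and> b \<le> a"
  by (simp add: Cauchy_pos_def) linarith

lemma rank2_0: "1 \<le> a \<Longrightarrow> 1 \<le> b \<Longrightarrow> rank2 (a - 1) b 1 < rank2 a b 0"
  "1 \<le> a \<Longrightarrow> 1 \<le> b \<Longrightarrow> rank2 (a - 1) b 0 < rank2 a b 0"
  "1 \<le> a \<Longrightarrow> 1 \<le> b \<Longrightarrow> rank2 (a - 1) (b - 1) 0 < rank2 a b 0"
  "a < 0 \<Longrightarrow> a < b \<Longrightarrow> rank2 a b 1 < rank2 a b 0"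
  "a < 0 \<Longrightarrow> a < b \<Longrightarrow> rank2 a (b - 1) 0 < rank2 a b 0"
  "a < 0 \<Longrightarrow> a < b \<Longrightarrow> rank2 (a + 1) b 0 < rank2 a b 0"
  "b < 0 \<Longrightarrow> b < a \<Longrightarrow> rank2 a (b + 1) 1 < rank2 a b 0"
  "b < 0 \<Longrightarrow> b < a \<Longrightarrow> rank2 a (b + 1) 0 < rank2 a b 0"
  "b < 0 \<Longrightarrow> b < a \<Longrightarrow> rank2 (a + 1) (b + 1) 0 < rank2 a b 0"
  by (auto simp: rank2_def Cauchy_pos_def)

lemma rank2_1: "1 \<le> a \<Longrightarrow> 1 \<le> b \<Longrightarrow> rank2 a (b - 1) 0 < rank2 a b 1"
  "1 \<le> a \<Longrightarrow> 1 \<le> b \<Longrightarrow> rank2 a (b - 1) 1 < rank2 a b 1"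
  "1 \<le> a \<Longrightarrow> 1 \<le> b \<Longrightarrow> rank2 (a - 1) (b - 1) 1 < rank2 a b 1"
  "a < 0 \<Longrightarrow> a + 1 < b \<Longrightarrow> rank2 (a + 1) b 0 < rank2 a b 1"
  "a < 0 \<Longrightarrow> a + 1 < b \<Longrightarrow> rank2 (a + 1) b 1 < rank2 a b 1"
  "a < 0 \<Longrightarrow> a + 1 < b \<Longrightarrow> rank2 (a + 1) (b + 1) 1 < rank2 a b 1"
  "b < 0 \<Longrightarrow> b \<le> a \<Longrightarrow> rank2 a b 0 < rank2 a b 1"
  "b < 0 \<Longrightarrow> b \<le> a \<Longrightarrow> rank2 a (b + 1) 1 < rank2 a b 1"
  "b < 0 \<Longrightarrow> b \<le> a \<Longrightarrow> rank2 (a - 1) b 1 < rank2 a b 1"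
  by (auto simp: rank2_def Cauchy_pos_def)

lemma layer_less: "2 \<le> k \<Longrightarrow> layer (k - 1) < layer k" "k < 0 \<Longrightarrow> layer (k + 1) < layer k"
  by (simp_all add: layer_def)

lemma layer_base: "layer 0 = 0" "layer 1 = 0"
  by (simp_all add: layer_def)

text \<open>\<open>h\<close> and \<open>j\<close> are the prescribed products of the four signs of a
  cube, for an odd and for an even lowest corner respectively. \<open>consistent\<close> concerns
  the eight cubes around an odd vertex, and \<open>centre\<close> the cube whose four circles are
  all Cauchy data.\<close>

locale cauchy_problem =
  fixes h j t :: "int \<Rightarrow> int \<Rightarrow> int \<Rightarrow> real"
  assumes h_sign: "h a b k \<in> {-1, 1}" and j_sign: "j a b k \<in> {-1, 1}"
    and t_sign: "Cauchy_pos a b k \<Longrightarrow> t a b k \<in> {-1, 1}"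
    and consistent: "h a b k * h a b (k - 1) * h a (b - 1) (k - 1) * h (a + 1) b (k - 1)
       * j a b (k - 1) * j a b k * j a (b + 1) k * j (a - 1) b k = 1"
    and centre: "t 0 0 0 * t 0 0 1 * t 0 1 1 * t (- 1) 0 1 = h 0 0 0"
begin

definition is_H :: "(int \<Rightarrow> int \<Rightarrow> int \<Rightarrow> real) \<Rightarrow> int \<Rightarrow> int \<Rightarrow> int \<Rightarrow> bool" where
  "is_H s a b k \<longleftrightarrow> s a b k * s a b (k + 1) * s a (b + 1) (k + 1) * s (a - 1) b (k + 1) = h a b k"

definition is_J :: "(int \<Rightarrow> int \<Rightarrow> int \<Rightarrow> real) \<Rightarrow> int \<Rightarrow> int \<Rightarrow> int \<Rightarrow> bool" where
  "is_J s a b k \<longleftrightarrow> s a b (k + 1) * s a b k * s a (b - 1) k * s (a + 1) b k = j a b k"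

text \<open>Layers other than 0 and 1 are reached one from the other by the equations \<open>J\<close> upwards and \<open>H\<close>
  downwards; the layers 0 and 1 are filled outwards from the three rays of Cauchy data.\<close>

function sol :: "int \<Rightarrow> int \<Rightarrow> int \<Rightarrow> real" where
  "sol a b k =
    (if Cauchy_pos a b k then t a b k
     else if 2 \<le> k then j a b (k - 1) * sol a b (k - 1) * sol a (b - 1) (k - 1) * sol (a + 1) b (k - 1)
     else if k < 0 then h a b k * sol a b (k + 1) * sol a (b + 1) (k + 1) * sol (a - 1) b (k + 1)
     else if k = 0 then
       (if 1 \<le> a \<and> 1 \<le> b then j (a - 1) b 0 * sol (a - 1) b 1 * sol (a - 1) b 0 * sol (a - 1) (b - 1) 0
        else if a < 0 \<and> a < b then j a b 0 * sol a b 1 * sol a (b - 1) 0 * sol (a + 1) b 0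
        else j a (b + 1) 0 * sol a (b + 1) 1 * sol a (b + 1) 0 * sol (a + 1) (b + 1) 0)
     else
       (if 1 \<le> a \<and> 1 \<le> b then h a (b - 1) 0 * sol a (b - 1) 0 * sol a (b - 1) 1 * sol (a - 1) (b - 1) 1
        else if a < 0 \<and> a + 1 < b then h (a + 1) b 0 * sol (a + 1) b 0 * sol (a + 1) b 1 * sol (a + 1) (b + 1) 1
        else h a b 0 * sol a b 0 * sol a (b + 1) 1 * sol (a - 1) b 1))"
  by pat_completeness auto
termination
proof (relation "measures [\<lambda>(a, b, k). layer k, \<lambda>(a, b, k). rank2 a b k]")
  let ?M = "measures [\<lambda>(a, b, k). layer k, \<lambda>(a, b, k). rank2 a b k]"
  have k1: "k = 1" if "\<not> 2 \<le> k" "\<not> k < 0" "k \<noteq> 0" for k :: int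
    using that by linarith
  fix a b k :: int
  assume C: "\<not> Cauchy_pos a b k"
  { assume "2 \<le> k"
    then show "((a, b, k - 1), a, b, k) \<in> ?M"
      "((a, b - 1, k - 1), a, b, k) \<in> ?M"
      "((a + 1, b, k - 1), a, b, k) \<in> ?M"
      by (simp_all add: layer_less) }
  assume k2: "\<not> 2 \<le> k"
  { assume "k < 0"
    then show "((a, b, k + 1), a, b, k) \<in> ?M"
      "((a, b + 1, k + 1), a, b, k) \<in> ?M"
      "((a - 1, b, k + 1), a, b, k) \<in> ?M"
      by (simp_all add: layer_less) }
  assume k0: "\<not> k < 0"
  { assume k: "k = 0"
    { assume "1 \<le> a \<and> 1 \<le> b"
      then show "((a - 1, b, 1), a, b, k) \<in> ?M"
        "((a - 1, b, 0), a, b, k) \<in> ?M"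
        "((a - 1, b - 1, 0), a, b, k) \<in> ?M"
        using k by (simp_all add: layer_base rank2_0) }
    assume n: "\<not> (1 \<le> a \<and> 1 \<le> b)"
    { assume "a < 0 \<and> a < b"
      then show "((a, b, 1), a, b, k) \<in> ?M"
        "((a, b - 1, 0), a, b, k) \<in> ?M"
        "((a + 1, b, 0), a, b, k) \<in> ?M"
        using k by (simp_all add: layer_base rank2_0) }
    assume "\<not> (a < 0 \<and> a < b)"
    then have "b < 0 \<and> b < a" using not_Cauchy_pos_0 C n k by blast
    then show "((a, b + 1, 1), a, b, k) \<in> ?M"
        "((a, b + 1, 0), a, b, k) \<in> ?M"
        "((a + 1, b + 1, 0), a, b, k) \<in> ?M"
      using k by (simp_all add: layer_base rank2_0) }
  assume "k \<noteq> 0"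
  then have k: "k = 1" using k1 k2 k0 by blast
  { assume "1 \<le> a \<and> 1 \<le> b"
    then show "((a, b - 1, 0), a, b, k) \<in> ?M"
        "((a, b - 1, 1), a, b, k) \<in> ?M"
        "((a - 1, b - 1, 1), a, b, k) \<in> ?M"
      using k by (simp_all add: layer_base rank2_1) }
  assume n: "\<not> (1 \<le> a \<and> 1 \<le> b)"
  { assume "a < 0 \<and> a + 1 < b"
    then show "((a + 1, b, 0), a, b, k) \<in> ?M"
        "((a + 1, b, 1), a, b, k) \<in> ?M"
        "((a + 1, b + 1, 1), a, b, k) \<in> ?M"
      using k by (simp_all add: layer_base rank2_1) }
  assume "\<not> (a < 0 \<and> a + 1 < b)"
  then have "b < 0 \<and> b \<le> a" using not_Cauchy_pos_1 C n k by blast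
  then show "((a, b, 0), a, b, k) \<in> ?M"
        "((a, b + 1, 1), a, b, k) \<in> ?M"
        "((a - 1, b, 1), a, b, k) \<in> ?M"
    using k by (simp_all add: layer_base rank2_1)
qed simp

declare sol.simps [simp del]

lemma sol_sign: "sol a b k \<in> {-1, 1}"
proof (induction a b k rule: sol.induct)
  case (1 a b k)
  consider (C) "Cauchy_pos a b k" | (up) "\<not> Cauchy_pos a b k" "2 \<le> k" | (down) "\<not> Cauchy_pos a b k" "\<not> 2 \<le> k" "k < 0"
    | (D) "\<not> Cauchy_pos a b k" "\<not> 2 \<le> k" "\<not> k < 0" "k = 0" | (U) "\<not> Cauchy_pos a b k" "\<not> 2 \<le> k" "\<not> k < 0" "k \<noteq> 0"
    by blast
  then show ?case
  proof cases
    case C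
    then show ?thesis by (subst sol.simps) (simp only: if_True t_sign)
  next
    case up
    have e: "sol a b k = j a b (k - 1) * sol a b (k - 1) * sol a (b - 1) (k - 1) * sol (a + 1) b (k - 1)"
      using up by (subst sol.simps) simp
    show ?thesis unfolding e by (intro sign_mult j_sign h_sign 1) (use up in simp_all)
  next
    case down
    have e: "sol a b k = h a b k * sol a b (k + 1) * sol a (b + 1) (k + 1) * sol (a - 1) b (k + 1)"
      using down by (subst sol.simps) simp
    show ?thesis unfolding e by (intro sign_mult j_sign h_sign 1) (use down in simp_all)
  next
    case D
    consider (1) "1 \<le> a \<and> 1 \<le> b" | (2) "\<not> (1 \<le> a \<and> 1 \<le> b)" "a < 0 \<and> a < b" | (3) "\<not> (1 \<le> a \<and> 1 \<le> b)" "\<not> (a < 0 \<and> a < b)"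
      by blast
    then show ?thesis
    proof cases
      case c: 1
    have e: "sol a b k = j (a - 1) b 0 * sol (a - 1) b 1 * sol (a - 1) b 0 * sol (a - 1) (b - 1) 0"
      using D c by (subst sol.simps) auto
    show ?thesis unfolding e by (intro sign_mult j_sign h_sign 1) (use D c in simp_all)
    next
      case c: 2
    have e: "sol a b k = j a b 0 * sol a b 1 * sol a (b - 1) 0 * sol (a + 1) b 0"
      using D c by (subst sol.simps) auto
    show ?thesis unfolding e by (intro sign_mult j_sign h_sign 1) (use D c in simp_all)
    next
      case c: 3
    have e: "sol a b k = j a (b + 1) 0 * sol a (b + 1) 1 * sol a (b + 1) 0 * sol (a + 1) (b + 1) 0"
      using D c by (subst sol.simps) auto
    show ?thesis unfolding e by (intro sign_mult j_sign h_sign 1) (use D c in simp_all)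
    qed
  next
    case U
    consider (1) "1 \<le> a \<and> 1 \<le> b" | (2) "\<not> (1 \<le> a \<and> 1 \<le> b)" "a < 0 \<and> a + 1 < b" | (3) "\<not> (1 \<le> a \<and> 1 \<le> b)" "\<not> (a < 0 \<and> a + 1 < b)"
      by blast
    then show ?thesis
    proof cases
      case c: 1
    have e: "sol a b k = h a (b - 1) 0 * sol a (b - 1) 0 * sol a (b - 1) 1 * sol (a - 1) (b - 1) 1"
      using U c by (subst sol.simps) auto
    show ?thesis unfolding e by (intro sign_mult j_sign h_sign 1) (use U c in simp_all)
    next
      case c: 2
    have e: "sol a b k = h (a + 1) b 0 * sol (a + 1) b 0 * sol (a + 1) b 1 * sol (a + 1) (b + 1) 1"
      using U c by (subst sol.simps) auto
    show ?thesis unfolding e by (intro sign_mult j_sign h_sign 1) (use U c in simp_all)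
    next
      case c: 3
    have e: "sol a b k = h a b 0 * sol a b 0 * sol a (b + 1) 1 * sol (a - 1) b 1"
      using U c by (subst sol.simps) auto
    show ?thesis unfolding e by (intro sign_mult j_sign h_sign 1) (use U c in simp_all)
    qed
  qed
qed

lemma sol_square: "sol a b k * sol a b k = 1" "sol a b k * (sol a b k * x) = x"
  using sol_sign[of a b k] by auto

lemma sol_Cauchy: "Cauchy_pos a b k \<Longrightarrow> sol a b k = t a b k"
  by (simp add: sol.simps[of a b k])

text \<open>Apart from the central cube, each equation is the one by which its outermost circle was
  defined; the case split follows the sectors.\<close>

lemma H_0: "is_H sol a b 0"
proof -
  consider "a = 0" "b = 0" | "1 \<le> a" "0 \<le> b" | "a \<le> 0" "a + 1 \<le> b" | "b < 0" "b \<le> a" by linarith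
  then show ?thesis
  proof cases
    case 1
    then show ?thesis using centre by (simp add: is_H_def sol_Cauchy Cauchy_pos_def)
  next
    case 2
    then have "sol a (b + 1) 1 = h a b 0 * sol a b 0 * sol a b 1 * sol (a - 1) b 1"
      by (subst sol.simps) (simp add: Cauchy_pos_def)
    then show ?thesis by (simp add: is_H_def mult_ac sol_square)
  next
    case 3
    then have "sol (a - 1) b 1 = h a b 0 * sol a b 0 * sol a b 1 * sol a (b + 1) 1"
      by (subst sol.simps) (simp add: Cauchy_pos_def)
    then show ?thesis by (simp add: is_H_def mult_ac sol_square)
  next
    case 4
    then have "sol a b 1 = h a b 0 * sol a b 0 * sol a (b + 1) 1 * sol (a - 1) b 1"
      by (subst sol.simps) (simp add: Cauchy_pos_def)
    then show ?thesis by (simp add: is_H_def mult_ac sol_square)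
  qed
qed

text \<open>Here every equation, without exception, defined one of its circles.\<close>

lemma J_0: "is_J sol a b 0"
proof -
  consider "0 \<le> a" "1 \<le> b" | "a < 0" "a < b" | "b \<le> 0" "b \<le> a" by linarith
  then show ?thesis
  proof cases
    case 1
    then have "sol (a + 1) b 0 = j a b 0 * sol a b 1 * sol a b 0 * sol a (b - 1) 0"
      by (subst sol.simps) (simp add: Cauchy_pos_def)
    then show ?thesis by (simp add: is_J_def mult_ac sol_square)
  next
    case 2
    then have "sol a b 0 = j a b 0 * sol a b 1 * sol a (b - 1) 0 * sol (a + 1) b 0"
      by (subst sol.simps) (simp add: Cauchy_pos_def)
    then show ?thesis by (simp add: is_J_def mult_ac sol_square)
  next
    case 3
    then have "sol a (b - 1) 0 = j a b 0 * sol a b 1 * sol a b 0 * sol (a + 1) b 0"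
      by (subst sol.simps) (simp add: Cauchy_pos_def)
    then show ?thesis by (simp add: is_J_def mult_ac sol_square)
  qed
qed

lemma J_pos: "1 \<le> k \<Longrightarrow> is_J sol a b k"
  unfolding is_J_def by (subst sol.simps) (simp add: Cauchy_pos_def mult_ac sol_square)

lemma H_neg: "k < 0 \<Longrightarrow> is_H sol a b k"
  unfolding is_H_def by (subst sol.simps[of a b k]) (simp add: Cauchy_pos_def mult_ac sol_square)

text \<open>Around an odd vertex every circle occurs in an even number of the eight cubes.\<close>

lemma eight_cubes:
  fixes s :: "int \<Rightarrow> int \<Rightarrow> int \<Rightarrow> real"
  assumes "\<And>a b k. s a b k \<in> {-1, 1}"
  defines "Hs \<equiv> (\<lambda>a b k. s a b k * s a b (k + 1) * s a (b + 1) (k + 1) * s (a - 1) b (k + 1))"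
    and "Js \<equiv> (\<lambda>a b k. s a b (k + 1) * s a b k * s a (b - 1) k * s (a + 1) b k)"
  shows "Hs a b k * Hs a b (k - 1) * Hs a (b - 1) (k - 1) * Hs (a + 1) b (k - 1)
       * Js a b (k - 1) * Js a b k * Js a (b + 1) k * Js (a - 1) b k = 1"
proof -
  have s1: "s a b k * s a b k = 1" for a b k using assms(1)[of a b k] by auto
  have s2: "s a b k * (s a b k * x) = x" for a b k x using assms(1)[of a b k] by auto
  show ?thesis unfolding Hs_def Js_def by (simp add: mult_ac s1 s2)
qed

lemma H_from_others:
  assumes "is_H sol a b (k - 1)" "is_H sol a (b - 1) (k - 1)" "is_H sol (a + 1) b (k - 1)"
    "is_J sol a b (k - 1)" "is_J sol a b k" "is_J sol a (b + 1) k" "is_J sol (a - 1) b k"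
  shows "is_H sol a b k"
proof -
  define P where "P = h a b (k - 1) * h a (b - 1) (k - 1) * h (a + 1) b (k - 1)
       * j a b (k - 1) * j a b k * j a (b + 1) k * j (a - 1) b k"
  have "h a b k * P = 1" using consistent[of a b k] by (simp only: P_def mult.assoc)
  moreover have "(sol a b k * sol a b (k + 1) * sol a (b + 1) (k + 1) * sol (a - 1) b (k + 1)) * P = 1"
    using eight_cubes[where s=sol and a=a and b=b and k=k, OF sol_sign] unfolding P_def assms[unfolded is_H_def is_J_def, symmetric]
    by (simp only: mult.assoc)
  ultimately show ?thesis unfolding is_H_def by (metis mult_cancel_right zero_neq_one mult_zero_right)
qed

lemma J_from_others:
  assumes "is_H sol a b k" "is_H sol a b (k - 1)" "is_H sol a (b - 1) (k - 1)" "is_H sol (a + 1) b (k - 1)"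
    "is_J sol a b k" "is_J sol a (b + 1) k" "is_J sol (a - 1) b k"
  shows "is_J sol a b (k - 1)"
proof -
  define P where "P = h a b k * h a b (k - 1) * h a (b - 1) (k - 1) * h (a + 1) b (k - 1)"
  define Q where "Q = j a b k * j a (b + 1) k * j (a - 1) b k"
  have "P * (j a b (k - 1) * Q) = 1" using consistent[of a b k] by (simp only: P_def Q_def mult.assoc)
  moreover have "P * ((sol a b (k - 1 + 1) * sol a b (k - 1) * sol a (b - 1) (k - 1) * sol (a + 1) b (k - 1)) * Q) = 1"
    using eight_cubes[where s=sol and a=a and b=b and k=k, OF sol_sign] unfolding P_def Q_def assms[unfolded is_H_def is_J_def, symmetric]
    by (simp only: mult.assoc)
  ultimately show ?thesis unfolding is_J_def
    by (metis mult_cancel_left mult_cancel_right zero_neq_one mult_zero_right mult_zero_left)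
qed

text \<open>Upwards the equations \<open>J\<close> hold by construction, and the equation
  \<open>H\<close> of the next layer is the eighth one around an odd vertex of that layer.\<close>

lemma H_pos: "0 \<le> k \<Longrightarrow> is_H sol a b k"
proof (induction k arbitrary: a b rule: int_ge_induct)
  case base
  show ?case by (rule H_0)
next
  case (step k)
  have J: "is_J sol a b k" for a b using step(1) J_0 J_pos[of k] by (cases "k = 0") auto
  show ?case using H_from_others[of a b "k + 1"] step(2) J J_pos[of "k + 1"] step(1) by simp
qed

lemma H_all: "is_H sol a b k"
  using H_pos H_neg by (cases "0 \<le> k") auto

text \<open>Downwards the roles are exchanged: \<open>H\<close> holds by construction and
  \<open>J\<close> is the eighth equation.\<close>

lemma J_neg: "k \<le> 0 \<Longrightarrow> is_J sol a b k"
proof (induction k arbitrary: a b rule: int_le_induct)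
  case base
  show ?case by (rule J_0)
next
  case (step k)
  then show ?case by (intro J_from_others H_all)
qed

lemma J_all: "is_J sol a b k"
  using J_pos[of k] J_neg[of k] by (cases "k \<le> 0") auto

lemma sol_unique:
  assumes s: "\<And>a b k. s a b k \<in> {-1, 1}" and C: "\<And>a b k. Cauchy_pos a b k \<Longrightarrow> s a b k = t a b k"
    and H: "\<And>a b k. is_H s a b k" and J: "\<And>a b k. is_J s a b k"
  shows "s a b k = sol a b k"
proof (induction a b k rule: sol.induct)
  case (1 a b k)
  have s1: "s a b k * s a b k = 1" for a b k using s[of a b k] by auto
  have s2: "s a b k * (s a b k * x) = x" for a b k x using s[of a b k] by auto
  note HJ = H[unfolded is_H_def, symmetric] J[unfolded is_J_def, symmetric]
  have "s a b k =
    (if Cauchy_pos a b k then t a b k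
     else if 2 \<le> k then j a b (k - 1) * s a b (k - 1) * s a (b - 1) (k - 1) * s (a + 1) b (k - 1)
     else if k < 0 then h a b k * s a b (k + 1) * s a (b + 1) (k + 1) * s (a - 1) b (k + 1)
     else if k = 0 then
       (if 1 \<le> a \<and> 1 \<le> b then j (a - 1) b 0 * s (a - 1) b 1 * s (a - 1) b 0 * s (a - 1) (b - 1) 0
        else if a < 0 \<and> a < b then j a b 0 * s a b 1 * s a (b - 1) 0 * s (a + 1) b 0
        else j a (b + 1) 0 * s a (b + 1) 1 * s a (b + 1) 0 * s (a + 1) (b + 1) 0)
     else
       (if 1 \<le> a \<and> 1 \<le> b then h a (b - 1) 0 * s a (b - 1) 0 * s a (b - 1) 1 * s (a - 1) (b - 1) 1
        else if a < 0 \<and> a + 1 < b then h (a + 1) b 0 * s (a + 1) b 0 * s (a + 1) b 1 * s (a + 1) (b + 1) 1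
        else h a b 0 * s a b 0 * s a (b + 1) 1 * s (a - 1) b 1))"
  proof (cases "Cauchy_pos a b k \<or> 2 \<le> k \<or> k < 0 \<or> k = 0")
    case True
    then show ?thesis using C by (auto simp: HJ mult_ac s1 s2)
  next
    case False
    then have "k = 1" by linarith
    then show ?thesis using False by (auto simp: HJ mult_ac s1 s2)
  qed
  also have "\<dots> = sol a b k"
    unfolding sol.simps[of a b k] using 1 by simp
  finally show ?case .
qed

end

section \<open>Consistency around an odd vertex\<close>

text \<open>For points of the circle this is, up to sign, the sine of half the angle between the two
  radii, so that \<open>2 * R * ang z R u v\<close> is a signed chord.\<close>

definition ang :: "complex \<Rightarrow> real \<Rightarrow> complex \<Rightarrow> complex \<Rightarrow> real" where
  "ang z R u v = Im (csqrt ((u - z) / of_real R) * cnj (csqrt ((v - z) / of_real R)))"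

lemma ang_swap: "ang z R v u = - ang z R u v"
  by (simp add: ang_def algebra_simps)

lemma circle_diff:
  assumes "0 < R" "cmod (u - z) = R" "cmod (v - z) = R"
  shows "u - v = \<i> * of_real (2 * R * ang z R u v) * csqrt ((u - z) / of_real R) * csqrt ((v - z) / of_real R)"
proof -
  define x where "x = csqrt ((u - z) / of_real R)"
  define y where "y = csqrt ((v - z) / of_real R)"
  have n: "cmod x = 1" "cmod y = 1" using assms by (simp_all add: x_def y_def norm_divide)
  then have nz: "x \<noteq> 0" "y \<noteq> 0" by auto
  have c: "cnj x = inverse x" "cnj y = inverse y" using unit_cnj[OF n(1)] unit_cnj[OF n(2)] by (metis inverse_unique)+
  have c': "cnj (x * cnj y) = inverse x * y" by (simp add: c(1))
  have "u - v = of_real R * (x\<^sup>2 - y\<^sup>2)"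
    unfolding x_def y_def power2_csqrt using assms(1) by (simp add: field_simps)
  also have "x\<^sup>2 - y\<^sup>2 = x * y * (x * cnj y - cnj (x * cnj y))"
    unfolding c' unfolding c(2) using nz by (simp add: field_simps power2_eq_square)
  also have "x * cnj y - cnj (x * cnj y) = 2 * \<i> * of_real (ang z R u v)"
    by (simp add: complex_eq_iff ang_def x_def y_def)
  finally show ?thesis unfolding x_def y_def by (simp add: mult_ac)
qed

lemma ang_nonzero:
  assumes "0 < R" "cmod (u - z) = R" "cmod (v - z) = R" "u \<noteq> v"
  shows "ang z R u v \<noteq> 0"
  using circle_diff[OF assms(1-3)] assms(4) by auto

text \<open>Again abc = 4 R S, now with one real factor for each side; the factors of shared sides
  can be paired when areas are multiplied.\<close>

lemma area3_ang:
  assumes "0 < R" "cmod (u - z) = R" "cmod (v - z) = R" "cmod (w - z) = R"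
  shows "area3 u v w = 4 * R\<^sup>2 * (ang z R v u * ang z R w u * ang z R w v)"
proof -
  let ?x = "csqrt ((u - z) / of_real R)" and ?y = "csqrt ((v - z) / of_real R)" and ?w = "csqrt ((w - z) / of_real R)"
  have n: "cmod ?x = 1" using assms by (simp add: norm_divide)
  have x: "cnj ?x * ?x = 1" using unit_cnj[OF n] by (simp add: mult.commute)
  have "cnj (v - u) * (w - u) = of_real (4 * R\<^sup>2 * (ang z R v u * ang z R w u)) * (?w * cnj ?y) * (cnj ?x * ?x)"
    unfolding circle_diff[OF assms(1,3,2)] circle_diff[OF assms(1,4,2)] by (simp add: power2_eq_square mult_ac)
  then have "cnj (v - u) * (w - u) = of_real (4 * R\<^sup>2 * (ang z R v u * ang z R w u)) * (?w * cnj ?y)"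
    unfolding x by (simp only: mult_1_right)
  then have "area3 u v w = 4 * R\<^sup>2 * (ang z R v u * ang z R w u) * Im (?w * cnj ?y)"
    unfolding area3_def by (simp only: Im_real_multiple)
  then show ?thesis by (simp add: ang_def[of z R w v] del: times_complex.sel)
qed

text \<open>For concyclic points the cross ratio is real; its sign tells whether two of the points are
  separated by the other two.\<close>

lemma concyclic_cross_ratio:
  assumes "0 < R" "cmod (a - z) = R" "cmod (b - z) = R" "cmod (k - z) = R" "cmod (l - z) = R"
    and "k \<noteq> a" "k \<noteq> b" "l \<noteq> a" "l \<noteq> b" "a \<noteq> b"
  obtains \<rho> :: real where "(k - a) * (l - b) = of_real \<rho> * ((k - b) * (l - a))" "0 < area3 k a b * area3 l a b * \<rho>"
proof -
  note ne = ang_nonzero[OF assms(1)]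
  have nz: "ang z R k a \<noteq> 0" "ang z R k b \<noteq> 0" "ang z R l a \<noteq> 0" "ang z R l b \<noteq> 0" "ang z R b a \<noteq> 0"
    using ne assms by auto
  define \<rho> where "\<rho> = ang z R k a * ang z R l b / (ang z R k b * ang z R l a)"
  have e: "\<rho> * (ang z R k b * ang z R l a) = ang z R k a * ang z R l b" using nz by (simp add: \<rho>_def)
  have "(k - a) * (l - b) = of_real \<rho> * ((k - b) * (l - a))"
    unfolding circle_diff[OF assms(1,4,2)] circle_diff[OF assms(1,5,3)] circle_diff[OF assms(1,4,3)] circle_diff[OF assms(1,5,2)]
    using arg_cong[OF e, of "of_real :: real \<Rightarrow> complex"] by (simp add: mult_ac)
  moreover have "area3 k a b * area3 l a b * \<rho> = (4 * R\<^sup>2 * (ang z R k a * ang z R l b * ang z R b a))\<^sup>2"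
    unfolding area3_ang[OF assms(1,4,2,3)] area3_ang[OF assms(1,5,2,3)] \<rho>_def
    using nz by (simp add: ang_swap[of z R a k] ang_swap[of z R b k] ang_swap[of z R a l] ang_swap[of z R b l] field_simps power2_eq_square)
  ultimately show ?thesis using nz assms(1) that[of \<rho>] by simp
qed

text \<open>All six points lie on one circle, and each of the twelve edges of the octahedron belongs
  to two faces, so the product of the eight areas is a square.\<close>

lemma octahedron_areas_pos:
  fixes a b c :: "bool \<Rightarrow> complex"
  assumes R: "0 < R" and on: "\<And>i. cmod (a i - z) = R" "\<And>i. cmod (b i - z) = R" "\<And>i. cmod (c i - z) = R"
    and ne: "\<And>i j. a i \<noteq> b j" "\<And>i j. b i \<noteq> c j" "\<And>i j. a i \<noteq> c j"
  shows "0 < area3 (a True) (b True) (c True) * area3 (a True) (b True) (c False)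
    * area3 (a True) (b False) (c True) * area3 (a True) (b False) (c False)
    * area3 (a False) (b True) (c True) * area3 (a False) (b True) (c False)
    * area3 (a False) (b False) (c True) * area3 (a False) (b False) (c False)"
proof -
  have ar: "area3 (a i) (b j) (c l) = 4 * R\<^sup>2 * (ang z R (b j) (a i) * ang z R (c l) (a i) * ang z R (c l) (b j))" for i j l
    by (rule area3_ang[OF R on])
  have nz: "ang z R (b j) (a i) \<noteq> 0" "ang z R (c l) (a i) \<noteq> 0" "ang z R (c l) (b j) \<noteq> 0" for i j l
    using ang_nonzero[OF R] on ne by metis+
  let ?P = "\<lambda>f::bool \<Rightarrow> bool \<Rightarrow> real. f True True * f True False * f False True * f False False"
  have "area3 (a True) (b True) (c True) * area3 (a True) (b True) (c False)
    * area3 (a True) (b False) (c True) * area3 (a True) (b False) (c False)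
    * area3 (a False) (b True) (c True) * area3 (a False) (b True) (c False)
    * area3 (a False) (b False) (c True) * area3 (a False) (b False) (c False) =
    ((4 * R\<^sup>2)^4 * ?P (\<lambda>i j. ang z R (b j) (a i)) * ?P (\<lambda>i l. ang z R (c l) (a i)) * ?P (\<lambda>j l. ang z R (c l) (b j)))\<^sup>2"
    unfolding ar by (simp only: power2_eq_square power4_eq_xxxx mult_ac)
  also have "\<dots> > 0" using nz R by simp
  finally show ?thesis .
qed

text \<open>The cross ratios of the twelve faces of a rhombic dodecahedron, suitably inverted, multiply to 1
  because every edge belongs to two faces.\<close>

lemma Theta_product_pos:
  fixes a b c :: "bool \<Rightarrow> complex" and k :: "bool \<Rightarrow> bool \<Rightarrow> bool \<Rightarrow> complex"
  assumes R: "0 < R" and on: "\<And>i. cmod (a i - z) = R" "\<And>i. cmod (b i - z) = R" "\<And>i. cmod (c i - z) = R"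
    and ne: "\<And>i j. a i \<noteq> b j" "\<And>i j. b i \<noteq> c j" "\<And>i j. a i \<noteq> c j"
    and knea: "\<And>i j l. k i j l \<noteq> a i" and kneb: "\<And>i j l. k i j l \<noteq> b j" and knec: "\<And>i j l. k i j l \<noteq> c l"
    and ab: "\<And>i j. \<exists>z R. 0 < R \<and> cmod (a i - z) = R \<and> cmod (b j - z) = R \<and> (\<forall>l. cmod (k i j l - z) = R)"
    and bc: "\<And>j l. \<exists>z R. 0 < R \<and> cmod (b j - z) = R \<and> cmod (c l - z) = R \<and> (\<forall>i. cmod (k i j l - z) = R)"
    and ac: "\<And>i l. \<exists>z R. 0 < R \<and> cmod (a i - z) = R \<and> cmod (c l - z) = R \<and> (\<forall>j. cmod (k i j l - z) = R)"
  defines "T \<equiv> (\<lambda>i j l. Theta (k i j l) (a i) (b j) (c l))"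
  shows "0 < T True True True * T True True False * T True False True * T True False False
    * T False True True * T False True False * T False False True * T False False False"
proof -
  \<comment> \<open>The parity of the indices decides in which direction the cross ratio of a face
    is taken. Adjacent faces then have their common edge once in a numerator and once in a
    denominator.\<close>
  have "\<exists>\<rho>::real. (k i j (i = j) - a i) * (k i j (i \<noteq> j) - b j) = of_real \<rho> * ((k i j (i = j) - b j) * (k i j (i \<noteq> j) - a i)) \<and>
     0 < area3 (k i j (i = j)) (a i) (b j) * area3 (k i j (i \<noteq> j)) (a i) (b j) * \<rho>" for i j
  proof -
    obtain z R where "0 < R" "cmod (a i - z) = R" "cmod (b j - z) = R" "\<forall>l. cmod (k i j l - z) = R" using ab by blast
    then show ?thesis using concyclic_cross_ratio[of R "a i" z "b j" "k i j (i = j)" "k i j (i \<noteq> j)"] knea kneb ne by metis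
  qed
  then obtain \<rho>1 :: "bool \<Rightarrow> bool \<Rightarrow> real" where
    r1: "\<And>i j. (k i j (i = j) - a i) * (k i j (i \<noteq> j) - b j) = of_real (\<rho>1 i j) * ((k i j (i = j) - b j) * (k i j (i \<noteq> j) - a i))"
    and p1: "\<And>i j. 0 < area3 (k i j (i = j)) (a i) (b j) * area3 (k i j (i \<noteq> j)) (a i) (b j) * \<rho>1 i j" by metis
  have "\<exists>\<rho>::real. (k (j = l) j l - b j) * (k (j \<noteq> l) j l - c l) = of_real \<rho> * ((k (j = l) j l - c l) * (k (j \<noteq> l) j l - b j)) \<and>
     0 < area3 (k (j = l) j l) (b j) (c l) * area3 (k (j \<noteq> l) j l) (b j) (c l) * \<rho>" for j l
  proof -
    obtain z R where "0 < R" "cmod (b j - z) = R" "cmod (c l - z) = R" "\<forall>i. cmod (k i j l - z) = R" using bc by blast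
    then show ?thesis using concyclic_cross_ratio[of R "b j" z "c l" "k (j = l) j l" "k (j \<noteq> l) j l"] kneb knec ne by metis
  qed
  then obtain \<rho>2 :: "bool \<Rightarrow> bool \<Rightarrow> real" where
    r2: "\<And>j l. (k (j = l) j l - b j) * (k (j \<noteq> l) j l - c l) = of_real (\<rho>2 j l) * ((k (j = l) j l - c l) * (k (j \<noteq> l) j l - b j))"
    and p2: "\<And>j l. 0 < area3 (k (j = l) j l) (b j) (c l) * area3 (k (j \<noteq> l) j l) (b j) (c l) * \<rho>2 j l" by metis
  have "\<exists>\<rho>::real. (k i (i \<noteq> l) l - a i) * (k i (i = l) l - c l) = of_real \<rho> * ((k i (i \<noteq> l) l - c l) * (k i (i = l) l - a i)) \<and>
     0 < area3 (k i (i \<noteq> l) l) (a i) (c l) * area3 (k i (i = l) l) (a i) (c l) * \<rho>" for i l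
  proof -
    obtain z R where "0 < R" "cmod (a i - z) = R" "cmod (c l - z) = R" "\<forall>j. cmod (k i j l - z) = R" using ac by blast
    then show ?thesis using concyclic_cross_ratio[of R "a i" z "c l" "k i (i \<noteq> l) l" "k i (i = l) l"] knea knec ne by metis
  qed
  then obtain \<rho>3 :: "bool \<Rightarrow> bool \<Rightarrow> real" where
    r3: "\<And>i l. (k i (i \<noteq> l) l - a i) * (k i (i = l) l - c l) = of_real (\<rho>3 i l) * ((k i (i \<noteq> l) l - c l) * (k i (i = l) l - a i))"
    and p3: "\<And>i l. 0 < area3 (k i (i \<noteq> l) l) (a i) (c l) * area3 (k i (i = l) l) (a i) (c l) * \<rho>3 i l" by metis
  define N1 where "N1 = (\<lambda>i j. (k i j (i = j) - a i) * (k i j (i \<noteq> j) - b j))"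
  define M1 where "M1 = (\<lambda>i j. (k i j (i = j) - b j) * (k i j (i \<noteq> j) - a i))"
  define N2 where "N2 = (\<lambda>j l. (k (j = l) j l - b j) * (k (j \<noteq> l) j l - c l))"
  define M2 where "M2 = (\<lambda>j l. (k (j = l) j l - c l) * (k (j \<noteq> l) j l - b j))"
  define N3 where "N3 = (\<lambda>i l. (k i (i \<noteq> l) l - a i) * (k i (i = l) l - c l))"
  define M3 where "M3 = (\<lambda>i l. (k i (i \<noteq> l) l - c l) * (k i (i = l) l - a i))"
  define A1 where "A1 = (\<lambda>i j. area3 (k i j (i = j)) (a i) (b j) * area3 (k i j (i \<noteq> j)) (a i) (b j))"
  define A2 where "A2 = (\<lambda>j l. area3 (k (j = l) j l) (b j) (c l) * area3 (k (j \<noteq> l) j l) (b j) (c l))"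
  define A3 where "A3 = (\<lambda>i l. area3 (k i (i \<noteq> l) l) (a i) (c l) * area3 (k i (i = l) l) (a i) (c l))"
  have MN: "M1 True True * M1 True False * M1 False True * M1 False False
    * (M2 True True * M2 True False * M2 False True * M2 False False)
    * (M3 True True * M3 True False * M3 False True * M3 False False)
    = N1 True True * N1 True False * N1 False True * N1 False False
    * (N2 True True * N2 True False * N2 False True * N2 False False)
    * (N3 True True * N3 True False * N3 False True * N3 False False)"
    unfolding M1_def M2_def M3_def N1_def N2_def N3_def by (simp add: mult_ac)
  have nz: "M1 i j \<noteq> 0" "M2 i j \<noteq> 0" "M3 i j \<noteq> 0" for i j
    using knea kneb knec by (simp_all add: M1_def M2_def M3_def)
  let ?\<rho> = "\<rho>1 True True * \<rho>1 True False * \<rho>1 False True * \<rho>1 False False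
    * (\<rho>2 True True * \<rho>2 True False * \<rho>2 False True * \<rho>2 False False)
    * (\<rho>3 True True * \<rho>3 True False * \<rho>3 False True * \<rho>3 False False)"
  define M where "M = M1 True True * M1 True False * M1 False True * M1 False False
    * (M2 True True * M2 True False * M2 False True * M2 False False)
    * (M3 True True * M3 True False * M3 False True * M3 False False)"
  have q: "N1 i j = of_real (\<rho>1 i j) * M1 i j" "N2 i j = of_real (\<rho>2 i j) * M2 i j" "N3 i j = of_real (\<rho>3 i j) * M3 i j" for i j
    unfolding N1_def M1_def N2_def M2_def N3_def M3_def by (rule r1 r2 r3)+
  have "M = of_real ?\<rho> * M"
    unfolding M_def by (subst MN, unfold q) (simp only: of_real_mult mult_ac)
  moreover have "M \<noteq> 0" using nz by (simp add: M_def)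
  ultimately have "of_real ?\<rho> = (1::complex)" by (metis mult_cancel_right1)
  then have rho: "?\<rho> = 1" by (simp only: of_real_eq_1_iff)
  have pos: "0 < A1 i j * \<rho>1 i j" "0 < A2 i j * \<rho>2 i j" "0 < A3 i j * \<rho>3 i j" for i j
    unfolding A1_def A2_def A3_def by (rule p1 p2 p3)+
  let ?A = "A1 True True * A1 True False * A1 False True * A1 False False
    * (A2 True True * A2 True False * A2 False True * A2 False False)
    * (A3 True True * A3 True False * A3 False True * A3 False False)"
  have "0 < (A1 True True * \<rho>1 True True) * (A1 True False * \<rho>1 True False) * (A1 False True * \<rho>1 False True) * (A1 False False * \<rho>1 False False)
    * ((A2 True True * \<rho>2 True True) * (A2 True False * \<rho>2 True False) * (A2 False True * \<rho>2 False True) * (A2 False False * \<rho>2 False False))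
    * ((A3 True True * \<rho>3 True True) * (A3 True False * \<rho>3 True False) * (A3 False True * \<rho>3 False True) * (A3 False False * \<rho>3 False False))"
    by (intro mult_pos_pos pos)
  also have "\<dots> = ?A * ?\<rho>" by (simp only: mult_ac)
  finally have Apos: "0 < ?A" unfolding rho by simp
  \<comment> \<open>Each \<open>Theta\<close> has three triangles at the outer corner, which are
    collected in \<open>?A\<close>; its fourth triangle is a face of the octahedron of the inner
    points.\<close>
  let ?O = "area3 (a True) (b True) (c True) * area3 (a True) (b True) (c False)
    * area3 (a True) (b False) (c True) * area3 (a True) (b False) (c False)
    * area3 (a False) (b True) (c True) * area3 (a False) (b True) (c False)
    * area3 (a False) (b False) (c True) * area3 (a False) (b False) (c False)"
  have "T True True True * T True True False * T True False True * T True False False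
    * T False True True * T False True False * T False False True * T False False False = ?A * ?O"
    unfolding T_def Theta_def A1_def A2_def A3_def by (simp add: mult_ac)
  moreover have "0 < ?O" by (rule octahedron_areas_pos[OF R on ne])
  ultimately show ?thesis using Apos by (simp only: mult_pos_pos)
qed

section \<open>The eight cubes around an odd lattice vertex\<close>

lemma even_vec3: "n + vec3 x y z \<in> even_lattice \<longleftrightarrow> (n \<in> even_lattice \<longleftrightarrow> even (x + y + z))"
proof -
  have "level (n + vec3 x y z) = level n + (x + y + z)" by (simp add: level_def)
  then show ?thesis by (simp add: even_lattice_def)
qed

context pattern
begin

definition cube_Theta :: "int^3 \<Rightarrow> real" where
  "cube_Theta n = (if n \<in> even_lattice
     then Theta (pc n) (pc (n + vec3 0 1 1)) (pc (n + vec3 1 0 1)) (pc (n + vec3 1 1 0))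
     else Theta (pc (n + vec3 1 1 1)) (pc (n + vec3 1 0 0)) (pc (n + vec3 0 1 0)) (pc (n + vec3 0 0 1)))"

definition cube_sign :: "(int^3 \<Rightarrow> real) \<Rightarrow> int^3 \<Rightarrow> real" where
  "cube_sign \<sigma> n = (if n \<in> even_lattice
     then \<sigma> (n + vec3 1 1 1) * \<sigma> (n + vec3 1 0 0) * \<sigma> (n + vec3 0 1 0) * \<sigma> (n + vec3 0 0 1)
     else \<sigma> n * \<sigma> (n + vec3 0 1 1) * \<sigma> (n + vec3 1 0 1) * \<sigma> (n + vec3 1 1 0))"

lemma cube_good_iff: "cube_good \<sigma> n \<longleftrightarrow> cube_sign \<sigma> n * cube_Theta n < 0"
proof -
  have v: "n + main_diagonal + - main_diagonal = n" "n + main_diagonal + vec3 0 (- 1) (- 1) = n + vec3 1 0 0" "n + main_diagonal + vec3 (- 1) 0 (- 1) = n + vec3 0 1 0"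
    "n + main_diagonal + vec3 (- 1) (- 1) 0 = n + vec3 0 0 1" "n + main_diagonal + vec3 (- 1) 0 0 = n + vec3 0 1 1"
    "n + main_diagonal + vec3 0 (- 1) 0 = n + vec3 1 0 1" "n + main_diagonal + vec3 0 0 (- 1) = n + vec3 1 1 0"
    by (simp_all add: vec3_eq_iff main_diagonal_def)
  have d: "main_diagonal $ 1 = 1" "main_diagonal $ 2 = 1" "main_diagonal $ 3 = 1" "(- main_diagonal) $ 1 = - 1" "(- main_diagonal) $ 2 = - 1" "(- main_diagonal) $ 3 = - 1" by (simp_all add: main_diagonal_def)
  show ?thesis
    unfolding cube_good_def good_def cube_Theta_def cube_sign_def ev_nth od_nth d v main_diagonal_def[symmetric]
    by (cases "n \<in> even_lattice") (simp_all only: if_True if_False simp_thms)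
qed

lemma diagonals_cases:
  assumes "s \<in> diagonals"
  obtains "s = vec3 1 1 1" | "s = vec3 1 1 (-1)" | "s = vec3 1 (-1) 1" | "s = vec3 1 (-1) (-1)"
    | "s = vec3 (-1) 1 1" | "s = vec3 (-1) 1 (-1)" | "s = vec3 (-1) (-1) 1" | "s = vec3 (-1) (-1) (-1)"
proof -
  have "s$1 = 1 \<or> s$1 = -1" "s$2 = 1 \<or> s$2 = -1" "s$3 = 1 \<or> s$3 = -1"
    using assms unfolding diagonals_def by auto
  moreover have "s = vec3 (s$1) (s$2) (s$3)" by simp
  ultimately show ?thesis using that by metis
qed

text \<open>The lowest corner of the cube spanned by a vertex and its translate by \<open>s\<close>,
  relative to that vertex.\<close>

definition base :: "int^3 \<Rightarrow> int^3" where
  "base s = vec3 (min 0 (s$1)) (min 0 (s$2)) (min 0 (s$3))"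

lemma vec3_add: "m + vec3 x y z + vec3 x' y' z' = m + vec3 (x + x') (y + y') (z + z')"
  by (simp add: vec3_eq_iff)

lemma vec3_zero: "m + vec3 0 0 0 = m"
  by (simp add: vec3_eq_iff)

lemma cube_Theta_octant:
  assumes "m \<notin> even_lattice" "s \<in> diagonals"
  shows "cube_Theta (m + base s) = Theta (pc (m + s)) (pc (m + vec3 (s$1) 0 0)) (pc (m + vec3 0 (s$2) 0)) (pc (m + vec3 0 0 (s$3)))"
  using assms(2)
  by (cases rule: diagonals_cases)
     (use assms(1) in \<open>simp_all add: cube_Theta_def base_def even_vec3 vec3_add vec3_zero Theta_swap\<close>)

lemma cube_sign_octant:
  assumes "m \<notin> even_lattice" "s \<in> diagonals"
  shows "cube_sign \<sigma> (m + base s) = \<sigma> m * \<sigma> (m + vec3 0 (s$2) (s$3)) * \<sigma> (m + vec3 (s$1) 0 (s$3)) * \<sigma> (m + vec3 (s$1) (s$2) 0)"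
  using assms(2)
  by (cases rule: diagonals_cases)
     (use assms(1) in \<open>simp_all add: cube_sign_def base_def even_vec3 vec3_add vec3_zero mult_ac\<close>)

text \<open>The condition depends on the cube only and not on the even corner from which it is
  described, since \<open>Theta\<close> is symmetric.\<close>

lemma good_base:
  assumes "v \<in> even_lattice" "s \<in> diagonals"
  shows "good \<sigma> v s \<longleftrightarrow> cube_good \<sigma> (v + s + base (- s))"
proof -
  have odd: "v + s \<notin> even_lattice" using cube_odd[OF assms, of 0] not_even by (simp add: od_nth)
  have s: "- s \<in> diagonals" using assms(2) by (simp add: diagonals_iff)
  have v: "v + s + - s = v" "v + s + vec3 ((- s)$1) 0 0 = v + vec3 0 (s$2) (s$3)" "v + s + vec3 0 ((- s)$2) 0 = v + vec3 (s$1) 0 (s$3)"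
    "v + s + vec3 0 0 ((- s)$3) = v + vec3 (s$1) (s$2) 0"
    "v + s + vec3 0 ((- s)$2) ((- s)$3) = v + vec3 (s$1) 0 0" "v + s + vec3 ((- s)$1) 0 ((- s)$3) = v + vec3 0 (s$2) 0"
    "v + s + vec3 ((- s)$1) ((- s)$2) 0 = v + vec3 0 0 (s$3)"
    by (simp_all add: vec3_eq_iff)
  show ?thesis
    unfolding cube_good_iff cube_Theta_octant[OF odd s] cube_sign_octant[OF odd s] good_def ev_nth od_nth v ..
qed

lemma all_opposite_iff:
  assumes "\<sigma> \<in> orientations"
  shows "all_opposite_correlated \<Phi> (as_lie_circles p cc \<sigma>) \<longleftrightarrow> (\<forall>n. cube_good \<sigma> n)"
proof -
  have ev_iff: "correlated \<Phi> (as_lie_circles p cc \<sigma>) v s \<longleftrightarrow> good \<sigma> v s" if "v \<in> even_lattice" "s \<in> diagonals" for v s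
    by (rule correlated_iff_good[OF orientation_admissible[OF assms that]])
  have neg: "- s \<in> diagonals" if "s \<in> diagonals" for s using that by (simp add: diagonals_iff)
  show ?thesis
  proof
    assume a: "all_opposite_correlated \<Phi> (as_lie_circles p cc \<sigma>)"
    show "\<forall>n. cube_good \<sigma> n"
    proof
      fix n
      have "n \<notin> even_lattice \<Longrightarrow> n + main_diagonal \<in> even_lattice" by (simp add: main_diagonal_def even_vec3)
      then show "cube_good \<sigma> n"
        using a ev_iff main_diagonal_diagonal unfolding cube_good_def all_opposite_correlated_def by (cases "n \<in> even_lattice") auto
    qed
  next
    assume g: "\<forall>n. cube_good \<sigma> n"
    have even: "correlated \<Phi> (as_lie_circles p cc \<sigma>) v s" if "v \<in> even_lattice" "s \<in> diagonals" for v s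
      using ev_iff[OF that] good_base[OF that] g by simp
    show "all_opposite_correlated \<Phi> (as_lie_circles p cc \<sigma>)"
      unfolding all_opposite_correlated_def
    proof (intro allI ballI)
      fix v s assume s: "s \<in> diagonals"
      show "correlated \<Phi> (as_lie_circles p cc \<sigma>) v s"
      proof (cases "v \<in> even_lattice")
        case True then show ?thesis using even s by blast
      next
        case False
        have "v + vec3 (s$1) (s$2) (s$3) \<in> even_lattice"
          unfolding even_vec3 using False s diagonals_iff by (metis abs_1 even_abs_add_iff even_add odd_one)
        then have "v + s \<in> even_lattice" by simp
        then have "correlated \<Phi> (as_lie_circles p cc \<sigma>) (v + s) (- s)" using even neg s by blast
        then show ?thesis using correlated_opposite_iff by blast
      qed
    qed
  qed
qed

lemma cube_Theta_nonzero: "cube_Theta n \<noteq> 0"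
proof -
  \<comment> \<open>Any signs would do, as \<open>cube_Theta\<close> involves the points
    only.\<close>
  define \<sigma> :: "int^3 \<Rightarrow> real" where "\<sigma> = (\<lambda>v. 1)"
  have a: "admissible \<sigma> v s" if "v \<in> even_lattice" "s \<in> diagonals" for v s
    using that by (simp add: admissible_def \<sigma>_def)
  have e: "n \<notin> even_lattice \<Longrightarrow> n + main_diagonal \<in> even_lattice" by (simp add: main_diagonal_def even_vec3)
  have v: "n + main_diagonal + vec3 0 (- 1) (- 1) = n + vec3 1 0 0" "n + main_diagonal + vec3 (- 1) 0 (- 1) = n + vec3 0 1 0"
    "n + main_diagonal + vec3 (- 1) (- 1) 0 = n + vec3 0 0 1"
    by (simp_all add: vec3_eq_iff main_diagonal_def)
  have d: "main_diagonal $ 1 = 1" "main_diagonal $ 2 = 1" "main_diagonal $ 3 = 1" "(- main_diagonal) $ 1 = - 1" "(- main_diagonal) $ 2 = - 1" "(- main_diagonal) $ 3 = - 1" by (simp_all add: main_diagonal_def)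
  show ?thesis
    using Delta_good(2)[OF a[of n main_diagonal]] Delta_good(2)[OF a[of "n + main_diagonal" "- main_diagonal"]] e main_diagonal_diagonal
    unfolding cube_Theta_def ev_nth d v by (simp add: main_diagonal_def[symmetric])
qed

text \<open>The six neighbours of \<open>m\<close> lie on the circle of \<open>m\<close>. Each of
  the twelve circles that differ from \<open>m\<close> by a unit in two coordinates carries two of
  these neighbours and two of the eight far corners.\<close>

lemma cube_Theta_product:
  assumes "m \<notin> even_lattice"
  shows "0 < cube_Theta m * cube_Theta (m + vec3 0 0 (-1)) * cube_Theta (m + vec3 0 (-1) 0) * cube_Theta (m + vec3 0 (-1) (-1))
    * cube_Theta (m + vec3 (-1) 0 0) * cube_Theta (m + vec3 (-1) 0 (-1)) * cube_Theta (m + vec3 (-1) (-1) 0) * cube_Theta (m + vec3 (-1) (-1) (-1))"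
proof -
  define f where "f = (\<lambda>i. if i then 1 else - 1 :: int)"
  define a where "a = (\<lambda>i. pc (m + vec3 (f i) 0 0))"
  define b where "b = (\<lambda>i. pc (m + vec3 0 (f i) 0))"
  define c where "c = (\<lambda>i. pc (m + vec3 0 0 (f i)))"
  define k where "k = (\<lambda>i j l. pc (m + vec3 (f i) (f j) (f l)))"
  have fo: "odd (f i)" "\<bar>f i\<bar> = 1" for i by (auto simp: f_def)
  have on: "cmod (pc n - zc v) = R v" "0 < R v" if "n \<in> even_lattice" "v \<notin> even_lattice" "neighbours n v" for n v
  proof -
    have v: "v \<in> odd_lattice" using that not_even by blast
    then have "p n \<in> sphere (fst (cc v)) (R v)" using pcc that by (auto simp: fundamental_point_circle_complex_def)
    then show "cmod (pc n - zc v) = R v" unfolding cmod_cpx by (simp add: dist_commute)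
    show "0 < R v" using R_pos[OF v] .
  qed
  have ne: "pc n \<noteq> pc n'" if "n \<in> even_lattice" "n' \<in> even_lattice" "n \<noteq> n'" "neighbours n v" "neighbours n' v" for n n' v
  proof -
    have "nearby n n'" using that unfolding nearby_def by blast
    then have "p n \<noteq> p n'" using gen that unfolding generic_def by blast
    then show ?thesis by (simp add: vec_eq_iff forall_2)
  qed
  have nb: "neighbours (m + vec3 x y z) (m + vec3 x' y' z') \<longleftrightarrow> \<bar>x - x'\<bar> + \<bar>y - y'\<bar> + \<bar>z - z'\<bar> = 1"
    "neighbours (m + vec3 x y z) m \<longleftrightarrow> \<bar>x\<bar> + \<bar>y\<bar> + \<bar>z\<bar> = 1" for x y z x' y' z'
    by (simp_all add: neighbours_iff)
  have nn: "m + vec3 x y z \<noteq> m + vec3 x' y' z'" if "x \<noteq> x' \<or> y \<noteq> y' \<or> z \<noteq> z'" for x y z x' y' z'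
    using that by (auto simp: vec3_eq_iff)
  have f0: "f i \<noteq> 0" "0 \<noteq> f i" for i by (simp_all add: f_def)
  have ev: "m + vec3 (f i) 0 0 \<in> even_lattice" "m + vec3 0 (f i) 0 \<in> even_lattice" "m + vec3 0 0 (f i) \<in> even_lattice"
     "m + vec3 (f i) (f j) (f l) \<in> even_lattice" "m + vec3 (f i) (f j) 0 \<notin> even_lattice" "m + vec3 (f i) 0 (f j) \<notin> even_lattice"
     "m + vec3 0 (f i) (f j) \<notin> even_lattice" for i j l
    using assms fo by (simp_all add: even_vec3)
  have "0 < (\<lambda>i j l. Theta (k i j l) (a i) (b j) (c l)) True True True * (\<lambda>i j l. Theta (k i j l) (a i) (b j) (c l)) True True False
    * (\<lambda>i j l. Theta (k i j l) (a i) (b j) (c l)) True False True * (\<lambda>i j l. Theta (k i j l) (a i) (b j) (c l)) True False False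
    * (\<lambda>i j l. Theta (k i j l) (a i) (b j) (c l)) False True True * (\<lambda>i j l. Theta (k i j l) (a i) (b j) (c l)) False True False
    * (\<lambda>i j l. Theta (k i j l) (a i) (b j) (c l)) False False True * (\<lambda>i j l. Theta (k i j l) (a i) (b j) (c l)) False False False"
  proof (rule Theta_product_pos[of "R m" a "zc m" b c k])
    show "0 < R m" using R_pos assms not_even by blast
    show "cmod (a i - zc m) = R m" "cmod (b i - zc m) = R m" "cmod (c i - zc m) = R m" for i
      unfolding a_def b_def c_def by (rule on(1)[OF ev(1) assms] on(1)[OF ev(2) assms] on(1)[OF ev(3) assms]; simp add: nb fo)+
    show "a i \<noteq> b j" for i j unfolding a_def b_def by (rule ne[OF ev(1) ev(2) nn, of _ _ m]) (simp_all add: nb fo f0)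
    show "b i \<noteq> c j" for i j unfolding b_def c_def by (rule ne[OF ev(2) ev(3) nn, of _ _ m]) (simp_all add: nb fo f0)
    show "a i \<noteq> c j" for i j unfolding a_def c_def by (rule ne[OF ev(1) ev(3) nn, of _ _ m]) (simp_all add: nb fo f0)
    show "k i j l \<noteq> a i" for i j l unfolding a_def k_def
      by (rule ne[OF ev(4) ev(1) nn, of _ _ _ _ "m + vec3 (f i) (f j) 0"]) (simp_all add: nb fo f0)
    show "k i j l \<noteq> b j" for i j l unfolding b_def k_def
      by (rule ne[OF ev(4) ev(2) nn, of _ _ _ _ "m + vec3 (f i) (f j) 0"]) (simp_all add: nb fo f0)
    show "k i j l \<noteq> c l" for i j l unfolding c_def k_def
      by (rule ne[OF ev(4) ev(3) nn, of _ _ _ _ "m + vec3 (f i) 0 (f l)"]) (simp_all add: nb fo f0)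
    show "\<exists>z R. 0 < R \<and> cmod (a i - z) = R \<and> cmod (b j - z) = R \<and> (\<forall>l. cmod (k i j l - z) = R)" for i j
      unfolding a_def b_def k_def using on[OF ev(1)[of i] ev(5)[of i j]] on[OF ev(2)[of j] ev(5)[of i j]] on[OF ev(4)[of i j] ev(5)[of i j]]
      by (intro exI[of _ "zc (m + vec3 (f i) (f j) 0)"] exI[of _ "R (m + vec3 (f i) (f j) 0)"]) (simp add: nb fo)
    show "\<exists>z R. 0 < R \<and> cmod (b j - z) = R \<and> cmod (c l - z) = R \<and> (\<forall>i. cmod (k i j l - z) = R)" for j l
      unfolding b_def c_def k_def using on[OF ev(2)[of j] ev(7)[of j l]] on[OF ev(3)[of l] ev(7)[of j l]] on[OF ev(4)[of _ j l] ev(7)[of j l]]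
      by (intro exI[of _ "zc (m + vec3 0 (f j) (f l))"] exI[of _ "R (m + vec3 0 (f j) (f l))"]) (simp add: nb fo)
    show "\<exists>z R. 0 < R \<and> cmod (a i - z) = R \<and> cmod (c l - z) = R \<and> (\<forall>j. cmod (k i j l - z) = R)" for i l
      unfolding a_def c_def k_def using on[OF ev(1)[of i] ev(6)[of i l]] on[OF ev(3)[of l] ev(6)[of i l]] on[OF ev(4)[of i _ l] ev(6)[of i l]]
      by (intro exI[of _ "zc (m + vec3 (f i) 0 (f l))"] exI[of _ "R (m + vec3 (f i) 0 (f l))"]) (simp add: nb fo)
  qed
  moreover have "Theta (k i j l) (a i) (b j) (c l) = cube_Theta (m + vec3 (min 0 (f i)) (min 0 (f j)) (min 0 (f l)))" for i j l
    using cube_Theta_octant[OF assms, of "vec3 (f i) (f j) (f l)"] fo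
    by (simp add: diagonals_iff base_def a_def b_def c_def k_def)
  ultimately show ?thesis by (simp add: f_def vec3_zero)
qed

end

section \<open>Lattice coordinates and Cauchy data\<close>

lemma sign_product_less_0_iff:
  assumes "x \<in> {-1, 1}" "y \<noteq> (0::real)"
  shows "x * y < 0 \<longleftrightarrow> x = - sgn y"
  using assms by (auto simp: sgn_if)

text \<open>Coordinates along f1, f2 and e1 + e3; the last one raises the level by 2 and so numbers
  the layers.\<close>

definition odd_vertex :: "int^3 \<Rightarrow> int \<Rightarrow> int \<Rightarrow> int \<Rightarrow> int^3" where
  "odd_vertex w a b k = w + vec3 (a + k) (b - a) (k - b)"

lemma odd_vertex_odd: "w \<notin> even_lattice \<Longrightarrow> odd_vertex w a b k \<notin> even_lattice"
  unfolding odd_vertex_def even_vec3 by simp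

lemma odd_vertex_inject: "odd_vertex w a b k = odd_vertex w a' b' k' \<longleftrightarrow> a = a' \<and> b = b' \<and> k = k'"
  unfolding odd_vertex_def vec3_eq_iff by auto

lemma odd_vertex_surj:
  assumes "w \<notin> even_lattice" "u \<notin> even_lattice"
  obtains a b k where "u = odd_vertex w a b k"
proof -
  have "even (level u - level w)" using assms by (simp add: even_lattice_def)
  then obtain k where k: "level u - level w = 2 * k" by (elim evenE)
  then have "u = odd_vertex w (u$1 - w$1 - k) (k - (u$3 - w$3)) k"
    unfolding odd_vertex_def vec3_eq_iff by (simp add: level_def)
  then show ?thesis by (rule that)
qed

lemma odd_vertex_shifts:
  "odd_vertex w a b k + vec3 0 1 1 = odd_vertex w (a - 1) b (k + 1)" "odd_vertex w a b k + vec3 1 0 1 = odd_vertex w a b (k + 1)"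
  "odd_vertex w a b k + vec3 1 1 0 = odd_vertex w a (b + 1) (k + 1)"
  by (simp_all add: odd_vertex_def vec3_eq_iff)

text \<open>Indexed so that the cube with this lowest corner carries the equation \<open>J\<close>
  at \<open>a\<close>, \<open>b\<close>, \<open>k\<close>.\<close>

definition even_vertex :: "int^3 \<Rightarrow> int \<Rightarrow> int \<Rightarrow> int \<Rightarrow> int^3" where
  "even_vertex w a b k = odd_vertex w a b (k + 1) + vec3 (-1) (-1) (-1)"

lemma even_vertex_shifts:
  "even_vertex w a b k + vec3 1 1 1 = odd_vertex w a b (k + 1)" "even_vertex w a b k + vec3 1 0 0 = odd_vertex w (a + 1) b k"
  "even_vertex w a b k + vec3 0 1 0 = odd_vertex w a b k" "even_vertex w a b k + vec3 0 0 1 = odd_vertex w a (b - 1) k"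
  by (simp_all add: even_vertex_def odd_vertex_def vec3_eq_iff)

lemma even_vertex_even: "w \<notin> even_lattice \<Longrightarrow> even_vertex w a b k \<in> even_lattice"
  unfolding even_vertex_def even_vec3 using odd_vertex_odd by simp

lemma even_vertex_surj:
  assumes "w \<notin> even_lattice" "u \<in> even_lattice"
  obtains a b k where "u = even_vertex w a b k"
proof -
  have "u + vec3 1 1 1 \<notin> even_lattice" using assms(2) by (simp add: even_vec3)
  then obtain a b k where "u + vec3 1 1 1 = odd_vertex w a b k" using odd_vertex_surj assms(1) by blast
  then have "u = even_vertex w a b (k - 1)" unfolding even_vertex_def by (auto simp: vec3_eq_iff)
  then show ?thesis by (rule that)
qed

text \<open>The three disjuncts are the three sectors; the two quantities in each of them are the
  coefficients i and j of that sector, expressed by the coordinates of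
  \<open>plane_vertex\<close>.\<close>

definition strip :: "int \<Rightarrow> int \<Rightarrow> bool" where
  "strip a b \<longleftrightarrow> (0 \<le> a \<and> 0 \<le> b \<and> min a b \<le> 1) \<or> (0 \<le> b - a \<and> 0 \<le> 1 - a \<and> min (b - a) (1 - a) \<le> 1)
     \<or> (0 \<le> 1 - b \<and> 0 \<le> 1 - b + a \<and> min (1 - b) (1 - b + a) \<le> 1)"

text \<open>The points of level 0 as seen from the first sector: w + e3 + a f1 + b f2.\<close>

definition plane_vertex :: "int^3 \<Rightarrow> int \<Rightarrow> int \<Rightarrow> int^3" where
  "plane_vertex w a b = w + vec3 a (b - a) (1 - b)"

lemma plane_vertex_cauchy_points: "plane_vertex w a b \<in> cauchy_points w \<longleftrightarrow> strip a b"
proof -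
  have 1: "plane_vertex w a b = w + unit_shift 3 + i *s (unit_shift 1 - unit_shift 2) + j *s (unit_shift 2 - unit_shift 3)
      \<longleftrightarrow> i = a \<and> j = b" for i j
    unfolding plane_vertex_def unit_shift_vec3 vec3_eq_iff by auto
  have 2: "plane_vertex w a b = w + unit_shift 1 + i *s (unit_shift 2 - unit_shift 3) + j *s (unit_shift 3 - unit_shift 1)
      \<longleftrightarrow> i = b - a \<and> j = 1 - a" for i j
    unfolding plane_vertex_def unit_shift_vec3 vec3_eq_iff by auto
  have 3: "plane_vertex w a b = w + unit_shift 2 + i *s (unit_shift 3 - unit_shift 1) + j *s (unit_shift 1 - unit_shift 2)
      \<longleftrightarrow> i = 1 - b \<and> j = 1 - b + a" for i j
    unfolding plane_vertex_def unit_shift_vec3 vec3_eq_iff by auto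
  show ?thesis
    unfolding cauchy_points_def Let_def sector_strip_def Un_iff mem_Collect_eq 1 2 3 strip_def
    by (simp add: conj_assoc)
qed

text \<open>Together the sectors form three arms, each two points wide. Along every arm there is
  just one row of complete triangles of either kind, which gives the rays.\<close>

lemma Cauchy_pos_strip:
  "Cauchy_pos a b 0 \<longleftrightarrow> strip (a + 1) (b + 1) \<and> strip a (b + 1) \<and> strip a b"
  "Cauchy_pos a b 1 \<longleftrightarrow> strip a b \<and> strip (a + 1) b \<and> strip (a + 1) (b + 1)"
  unfolding Cauchy_pos_def strip_def by (simp_all add: min_def, presburger+)

lemma level_odd_vertex: "level (odd_vertex w a b k) = level w + 2 * k"
  by (simp add: odd_vertex_def level_def)

lemma neighbours_A2:
  "level v = -1 \<Longrightarrow> (\<forall>n\<in>A2 0. neighbours v n \<longrightarrow> P n) \<longleftrightarrow> P (v + unit_shift 1) \<and> P (v + unit_shift 2) \<and> P (v + unit_shift 3)"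
  "level v = 1 \<Longrightarrow> (\<forall>n\<in>A2 0. neighbours v n \<longrightarrow> P n) \<longleftrightarrow> P (v - unit_shift 1) \<and> P (v - unit_shift 2) \<and> P (v - unit_shift 3)"
proof -
  have l: "level (n + unit_shift l) = level n + 1" for n l by (rule level_shift)
  have m: "level (n - unit_shift l) = level n - 1" for n l using l[of "n - unit_shift l" l] by simp
  have n: "n = v + unit_shift l \<or> v = n + unit_shift l \<longleftrightarrow> n = v + unit_shift l \<or> n = v - unit_shift l" for n v l
    by auto
  have nb: "neighbours v n \<longleftrightarrow> (\<exists>l. n = v + unit_shift l \<or> n = v - unit_shift l)" for n
    unfolding neighbours_def using n by blast
  {
    assume v: "level v = -1"
    have e: "n \<in> A2 0 \<and> neighbours v n \<longleftrightarrow> (\<exists>l. n = v + unit_shift l)" for n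
      unfolding nb A2_def by (auto simp: l m v)
    have "(\<forall>n\<in>A2 0. neighbours v n \<longrightarrow> P n) \<longleftrightarrow> (\<forall>n. n \<in> A2 0 \<and> neighbours v n \<longrightarrow> P n)" by blast
    also have "\<dots> \<longleftrightarrow> (\<forall>l. P (v + unit_shift l))" unfolding e by auto
    finally show "(\<forall>n\<in>A2 0. neighbours v n \<longrightarrow> P n) \<longleftrightarrow> P (v + unit_shift 1) \<and> P (v + unit_shift 2) \<and> P (v + unit_shift 3)"
      unfolding forall_3 .
  }
  assume v: "level v = 1"
  have e: "n \<in> A2 0 \<and> neighbours v n \<longleftrightarrow> (\<exists>l. n = v - unit_shift l)" for n
    unfolding nb A2_def by (auto simp: l m v)
  have "(\<forall>n\<in>A2 0. neighbours v n \<longrightarrow> P n) \<longleftrightarrow> (\<forall>n. n \<in> A2 0 \<and> neighbours v n \<longrightarrow> P n)" by blast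
  also have "\<dots> \<longleftrightarrow> (\<forall>l. P (v - unit_shift l))" unfolding e by auto
  finally show "(\<forall>n\<in>A2 0. neighbours v n \<longrightarrow> P n) \<longleftrightarrow> P (v - unit_shift 1) \<and> P (v - unit_shift 2) \<and> P (v - unit_shift 3)"
    unfolding forall_3 .
qed

lemma odd_vertex_cauchy_circles:
  assumes "w \<in> A2 (-1)"
  shows "odd_vertex w a b k \<in> cauchy_circles w \<longleftrightarrow> Cauchy_pos a b k"
proof -
  have lw: "level w = -1" using assms by (simp add: A2_def)
  have mem: "odd_vertex w a b k \<in> A2 1 \<union> A2 (- 1) \<longleftrightarrow> k = 0 \<or> k = 1"
    unfolding A2_def by (auto simp: level_odd_vertex lw)
  have 0: "odd_vertex w a b 0 + unit_shift 1 = plane_vertex w (a + 1) (b + 1)" "odd_vertex w a b 0 + unit_shift 2 = plane_vertex w a (b + 1)"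
    "odd_vertex w a b 0 + unit_shift 3 = plane_vertex w a b"
    by (simp_all add: odd_vertex_def plane_vertex_def unit_shift_vec3 vec3_eq_iff)
  have 1: "odd_vertex w a b 1 - unit_shift 1 = plane_vertex w a b" "odd_vertex w a b 1 - unit_shift 2 = plane_vertex w (a + 1) b"
    "odd_vertex w a b 1 - unit_shift 3 = plane_vertex w (a + 1) (b + 1)"
    by (simp_all add: odd_vertex_def plane_vertex_def unit_shift_vec3 vec3_eq_iff)
  show ?thesis
  proof (cases "k = 0 \<or> k = 1")
    case False
    then show ?thesis unfolding cauchy_circles_def using mem by (auto simp: Cauchy_pos_def)
  next
    case True
    then consider "k = 0" | "k = 1" by blast
    then show ?thesis
    proof cases
      assume k: "k = 0"
      have "level (odd_vertex w a b 0) = -1" by (simp add: level_odd_vertex lw)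
      from neighbours_A2(1)[OF this] show ?thesis
        using mem unfolding cauchy_circles_def k mem_Collect_eq Cauchy_pos_strip by (simp add: 0 plane_vertex_cauchy_points)
    next
      assume k: "k = 1"
      have "level (odd_vertex w a b 1) = 1" by (simp add: level_odd_vertex lw)
      from neighbours_A2(2)[OF this] show ?thesis
        using mem unfolding cauchy_circles_def k mem_Collect_eq Cauchy_pos_strip by (simp add: 1 plane_vertex_cauchy_points)
    qed
  qed
qed

lemma cauchy_circlesE:
  assumes "w \<in> A2 (-1)" "v \<in> cauchy_circles w"
  obtains a b k where "v = odd_vertex w a b k" "Cauchy_pos a b k"
proof -
  have w: "w \<notin> even_lattice" using assms(1) by (simp add: A2_def even_lattice_def)
  have "v \<notin> even_lattice" using assms(2) by (auto simp: cauchy_circles_def A2_def even_lattice_def)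
  then obtain a b k where "v = odd_vertex w a b k" using odd_vertex_surj w by blast
  then show ?thesis using that odd_vertex_cauchy_circles assms by blast
qed

context pattern
begin

lemma cube_sign_odd_vertex: "w \<notin> even_lattice \<Longrightarrow> cube_sign \<sigma> (odd_vertex w a b k) = \<sigma> (odd_vertex w a b k) * \<sigma> (odd_vertex w a b (k + 1)) * \<sigma> (odd_vertex w a (b + 1) (k + 1)) * \<sigma> (odd_vertex w (a - 1) b (k + 1))"
  using odd_vertex_odd[of w a b k] by (simp add: cube_sign_def odd_vertex_shifts mult_ac)

lemma cube_sign_even_vertex: "w \<notin> even_lattice \<Longrightarrow> cube_sign \<sigma> (even_vertex w a b k) = \<sigma> (odd_vertex w a b (k + 1)) * \<sigma> (odd_vertex w a b k) * \<sigma> (odd_vertex w a (b - 1) k) * \<sigma> (odd_vertex w (a + 1) b k)"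
  using even_vertex_even[of w a b k] by (simp add: cube_sign_def even_vertex_shifts mult_ac)

theorem cauchy_solution:
  assumes w: "w \<in> A2 (-1)" and \<tau>: "\<And>v. v \<in> cauchy_circles w \<Longrightarrow> \<tau> v \<in> {-1, 1}" and good: "cube_good \<tau> w"
  shows "\<exists>!\<sigma>. \<sigma> \<in> orientations \<and> (\<forall>v\<in>cauchy_circles w. \<sigma> v = \<tau> v) \<and> (\<forall>n. cube_good \<sigma> n)"
proof -
  have wo: "w \<notin> even_lattice" using w by (simp add: A2_def even_lattice_def)
  note WC = odd_vertex_cauchy_circles[OF w]
  define h where "h = (\<lambda>a b k. - sgn (cube_Theta (odd_vertex w a b k)))"
  define j where "j = (\<lambda>a b k. - sgn (cube_Theta (even_vertex w a b k)))"
  define t where "t = (\<lambda>a b k. \<tau> (odd_vertex w a b k))"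
  have sg: "- sgn (cube_Theta n) \<in> {-1, 1}" for n using cube_Theta_nonzero[of n] by (auto simp: sgn_if)
  have centre: "t 0 0 0 * t 0 0 1 * t 0 1 1 * t (- 1) 0 1 = h 0 0 0"
  proof -
    have W0: "odd_vertex w 0 0 0 = w" by (simp add: odd_vertex_def vec3_eq_iff)
    have "t 0 0 0 * t 0 0 1 * t 0 1 1 * t (- 1) 0 1 \<in> {-1, 1}"
      unfolding t_def by (intro sign_mult \<tau>) (simp_all add: WC Cauchy_pos_def)
    moreover have "(t 0 0 0 * t 0 0 1 * t 0 1 1 * t (- 1) 0 1) * cube_Theta w < 0"
      using good unfolding cube_good_iff t_def using cube_sign_odd_vertex[OF wo, of \<tau> 0 0 0] by (simp add: W0)
    ultimately show ?thesis unfolding h_def W0 using sign_product_less_0_iff cube_Theta_nonzero by blast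
  qed
  \<comment> \<open>The eight prescribed products each carry a minus sign; these cancel, and only
    the signs of the areas count.\<close>
  have consistent: "h a b k * h a b (k - 1) * h a (b - 1) (k - 1) * h (a + 1) b (k - 1)
       * j a b (k - 1) * j a b k * j a (b + 1) k * j (a - 1) b k = 1" for a b k
  proof -
    let ?m = "odd_vertex w a b k"
    have n: "?m + vec3 0 0 (-1) = even_vertex w a (b + 1) k" "?m + vec3 0 (-1) 0 = even_vertex w a b k" "?m + vec3 0 (-1) (-1) = odd_vertex w (a + 1) b (k - 1)"
     "?m + vec3 (-1) 0 0 = even_vertex w (a - 1) b k" "?m + vec3 (-1) 0 (-1) = odd_vertex w a b (k - 1)" "?m + vec3 (-1) (-1) 0 = odd_vertex w a (b - 1) (k - 1)"
     "?m + vec3 (-1) (-1) (-1) = even_vertex w a b (k - 1)"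
      by (simp_all add: even_vertex_def odd_vertex_def vec3_eq_iff)
    have "0 < cube_Theta ?m * cube_Theta (even_vertex w a (b + 1) k) * cube_Theta (even_vertex w a b k) * cube_Theta (odd_vertex w (a + 1) b (k - 1))
      * cube_Theta (even_vertex w (a - 1) b k) * cube_Theta (odd_vertex w a b (k - 1)) * cube_Theta (odd_vertex w a (b - 1) (k - 1)) * cube_Theta (even_vertex w a b (k - 1))"
      using cube_Theta_product[OF odd_vertex_odd[OF wo], of a b k] unfolding n .
    then have "sgn (cube_Theta ?m * cube_Theta (even_vertex w a (b + 1) k) * cube_Theta (even_vertex w a b k) * cube_Theta (odd_vertex w (a + 1) b (k - 1))
      * cube_Theta (even_vertex w (a - 1) b k) * cube_Theta (odd_vertex w a b (k - 1)) * cube_Theta (odd_vertex w a (b - 1) (k - 1)) * cube_Theta (even_vertex w a b (k - 1))) = 1"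
      by (rule sgn_pos)
    then show ?thesis unfolding h_def j_def sgn_mult by (simp add: mult_ac)
  qed
  interpret P: cauchy_problem h j t
    by unfold_locales (use sg \<tau> WC consistent centre in \<open>auto simp: h_def j_def t_def\<close>)
  have goodW: "cube_good \<sigma> (odd_vertex w a b k) \<longleftrightarrow> P.is_H (\<lambda>a b k. \<sigma> (odd_vertex w a b k)) a b k"
    and goodU: "cube_good \<sigma> (even_vertex w a b k) \<longleftrightarrow> P.is_J (\<lambda>a b k. \<sigma> (odd_vertex w a b k)) a b k"
    if s: "\<And>a b k. \<sigma> (odd_vertex w a b k) \<in> {-1, 1}" for \<sigma> a b k
  proof -
    have "cube_sign \<sigma> (odd_vertex w a b k) \<in> {-1, 1}" "cube_sign \<sigma> (even_vertex w a b k) \<in> {-1, 1}"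
      unfolding cube_sign_odd_vertex[OF wo] cube_sign_even_vertex[OF wo] by (intro sign_mult s)+
    then have "cube_good \<sigma> (odd_vertex w a b k) \<longleftrightarrow> cube_sign \<sigma> (odd_vertex w a b k) = h a b k"
      "cube_good \<sigma> (even_vertex w a b k) \<longleftrightarrow> cube_sign \<sigma> (even_vertex w a b k) = j a b k"
      unfolding cube_good_iff h_def j_def using sign_product_less_0_iff cube_Theta_nonzero by blast+
    then show "cube_good \<sigma> (odd_vertex w a b k) \<longleftrightarrow> P.is_H (\<lambda>a b k. \<sigma> (odd_vertex w a b k)) a b k"
      "cube_good \<sigma> (even_vertex w a b k) \<longleftrightarrow> P.is_J (\<lambda>a b k. \<sigma> (odd_vertex w a b k)) a b k"
      unfolding P.is_H_def P.is_J_def cube_sign_odd_vertex[OF wo] cube_sign_even_vertex[OF wo] .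
  qed
  \<comment> \<open>The description is well defined because \<open>odd_vertex\<close> is injective;
    off the odd sublattice the value must be \<open>undefined\<close> since orientations are
    extensional.\<close>
  define \<sigma> where "\<sigma> = (\<lambda>u. if u \<in> even_lattice then undefined else
      (THE x. \<exists>a b k. u = odd_vertex w a b k \<and> x = P.sol a b k))"
  have \<sigma>W: "\<sigma> (odd_vertex w a b k) = P.sol a b k" for a b k
    unfolding \<sigma>_def using odd_vertex_odd[OF wo] by (auto simp: odd_vertex_inject)
  have \<sigma>o: "\<sigma> \<in> orientations"
    unfolding orientations_def
  proof (rule PiE_I)
    fix u assume "u \<in> odd_lattice"
    then obtain a b k where "u = odd_vertex w a b k" using odd_vertex_surj wo not_even by metis
    then show "\<sigma> u \<in> {-1, 1}" using P.sol_sign by (simp only: \<sigma>W)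
  next
    fix u assume "u \<notin> odd_lattice"
    then have "u \<in> even_lattice" using not_even by blast
    then show "\<sigma> u = undefined" by (simp add: \<sigma>_def)
  qed
  have \<sigma>C: "\<forall>v\<in>cauchy_circles w. \<sigma> v = \<tau> v"
  proof
    fix v assume "v \<in> cauchy_circles w"
    then obtain a b k where "v = odd_vertex w a b k" "Cauchy_pos a b k" using cauchy_circlesE w by blast
    then show "\<sigma> v = \<tau> v" using P.sol_Cauchy by (simp add: \<sigma>W t_def)
  qed
  have \<sigma>g: "cube_good \<sigma> n" for n
  proof (cases "n \<in> even_lattice")
    case True
    then obtain a b k where n: "n = even_vertex w a b k" using even_vertex_surj wo by blast
    have "P.is_J (\<lambda>a b k. \<sigma> (odd_vertex w a b k)) a b k" unfolding \<sigma>W by (rule P.J_all)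
    then show ?thesis unfolding n using goodU[of \<sigma>] P.sol_sign \<sigma>W by metis
  next
    case False
    then obtain a b k where n: "n = odd_vertex w a b k" using odd_vertex_surj wo by blast
    have "P.is_H (\<lambda>a b k. \<sigma> (odd_vertex w a b k)) a b k" unfolding \<sigma>W by (rule P.H_all)
    then show ?thesis unfolding n using goodW[of \<sigma>] P.sol_sign \<sigma>W by metis
  qed
  show ?thesis
  proof (rule ex1I[of _ \<sigma>])
    show "\<sigma> \<in> orientations \<and> (\<forall>v\<in>cauchy_circles w. \<sigma> v = \<tau> v) \<and> (\<forall>n. cube_good \<sigma> n)"
      using \<sigma>o \<sigma>C \<sigma>g by blast
  next
    fix \<sigma>' assume a: "\<sigma>' \<in> orientations \<and> (\<forall>v\<in>cauchy_circles w. \<sigma>' v = \<tau> v) \<and> (\<forall>n. cube_good \<sigma>' n)"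
    then have s: "\<sigma>' (odd_vertex w a b k) \<in> {-1, 1}" for a b k
      using odd_vertex_odd[OF wo] not_even unfolding orientations_def by blast
    have "(\<lambda>a b k. \<sigma>' (odd_vertex w a b k)) a b k = P.sol a b k" for a b k
      by (rule P.sol_unique) (use s a WC goodW[of \<sigma>', OF s] goodU[of \<sigma>', OF s] in \<open>auto simp: t_def\<close>)
    then have eq: "\<sigma>' (odd_vertex w a b k) = \<sigma> (odd_vertex w a b k)" for a b k by (simp only: \<sigma>W)
    show "\<sigma>' = \<sigma>"
    proof (rule PiE_ext)
      show "\<sigma>' \<in> odd_lattice \<rightarrow>\<^sub>E {-1, 1}" "\<sigma> \<in> odd_lattice \<rightarrow>\<^sub>E {-1, 1}"
        using a \<sigma>o unfolding orientations_def by blast+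
      fix u assume "u \<in> odd_lattice"
      then obtain a b k where "u = odd_vertex w a b k" using odd_vertex_surj wo not_even by metis
      then show "\<sigma>' u = \<sigma> u" using eq by simp
    qed
  qed
qed

text \<open>The vertex \<open>w\<close> is odd, so the condition is read from the opposite even
  corner. All four circles of this cube are Cauchy circles, so \<tau> need not be an
  orientation.\<close>

lemma correlated_start:
  assumes w: "w \<in> A2 (-1)" and \<tau>: "\<And>v. v \<in> cauchy_circles w \<Longrightarrow> \<tau> v \<in> {-1, 1}"
  shows "correlated \<Phi> (as_lie_circles p cc \<tau>) w main_diagonal \<longleftrightarrow> cube_good \<tau> w"
proof -
  have wo: "w \<notin> even_lattice" using w by (simp add: A2_def even_lattice_def)
  have e: "w + main_diagonal \<in> even_lattice" using wo by (simp add: main_diagonal_def even_vec3)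
  have "od (w + main_diagonal) (- main_diagonal) 0 = odd_vertex w 0 0 0" "od (w + main_diagonal) (- main_diagonal) 1 = odd_vertex w (-1) 0 1"
      "od (w + main_diagonal) (- main_diagonal) 2 = odd_vertex w 0 0 1" "od (w + main_diagonal) (- main_diagonal) 3 = odd_vertex w 0 1 1"
    by (simp_all add: od_nth odd_vertex_def main_diagonal_def vec3_eq_iff)
  then have "\<forall>k. od (w + main_diagonal) (- main_diagonal) k \<in> cauchy_circles w"
    unfolding forall_4_from_0 by (simp add: odd_vertex_cauchy_circles[OF w] Cauchy_pos_def)
  then have "admissible \<tau> (w + main_diagonal) (- main_diagonal)"
    unfolding admissible_def using e main_diagonal_diagonal \<tau> by blast
  then have "correlated \<Phi> (as_lie_circles p cc \<tau>) (w + main_diagonal) (- main_diagonal) \<longleftrightarrow> good \<tau> (w + main_diagonal) (- main_diagonal)"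
    by (rule correlated_iff_good)
  then show ?thesis unfolding correlated_opposite_iff cube_good_def using wo by simp
qed

text \<open>The sign at \<open>w\<close> is one factor of the sign equation of the starting cube,
  and the other three circles are prescribed.\<close>

lemma start_unique:
  assumes w: "w \<in> A2 (-1)" and \<sigma>0: "\<sigma>0 \<in> cauchy_circles w - {w} \<rightarrow> {-1, 1}"
  shows "\<exists>!s. s \<in> {-1, 1} \<and> cube_good (\<sigma>0(w := s)) w"
proof -
  have wo: "w \<notin> even_lattice" using w by (simp add: A2_def even_lattice_def)
  have W0: "odd_vertex w 0 0 0 = w" by (simp add: odd_vertex_def vec3_eq_iff)
  have ne: "odd_vertex w 0 0 1 \<noteq> w" "odd_vertex w 0 1 1 \<noteq> w" "odd_vertex w (-1) 0 1 \<noteq> w"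
    using odd_vertex_inject[of w _ _ _ 0 0 0] unfolding W0 by simp_all
  define Q where "Q = \<sigma>0 (odd_vertex w 0 0 1) * \<sigma>0 (odd_vertex w 0 1 1) * \<sigma>0 (odd_vertex w (-1) 0 1)"
  have c: "odd_vertex w 0 0 1 \<in> cauchy_circles w - {w}" "odd_vertex w 0 1 1 \<in> cauchy_circles w - {w}" "odd_vertex w (-1) 0 1 \<in> cauchy_circles w - {w}"
    using ne by (simp_all add: odd_vertex_cauchy_circles[OF w] Cauchy_pos_def)
  have "\<sigma>0 v \<noteq> 0" if "v \<in> cauchy_circles w - {w}" for v using \<sigma>0 that by (auto simp: Pi_def)
  then have Q0: "Q * cube_Theta w \<noteq> 0" using c cube_Theta_nonzero by (simp add: Q_def)
  have "cube_good (\<sigma>0(w := s)) w \<longleftrightarrow> s * (Q * cube_Theta w) < 0" for s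
    unfolding cube_good_iff using cube_sign_odd_vertex[OF wo, of "\<sigma>0(w := s)" 0 0 0] ne by (simp add: W0 Q_def mult_ac)
  then have eq: "s \<in> {-1, 1} \<and> cube_good (\<sigma>0(w := s)) w \<longleftrightarrow> s \<in> {-1, 1} \<and> s = - sgn (Q * cube_Theta w)" for s
    using sign_product_less_0_iff Q0 by metis
  have "- sgn (Q * cube_Theta w) \<in> {-1, 1}" using Q0 by (simp add: sgn_if)
  then have "- sgn (Q * cube_Theta w) \<in> {-1, 1} \<and> - sgn (Q * cube_Theta w) = - sgn (Q * cube_Theta w)" by (rule conjI[OF _ refl])
  then show ?thesis unfolding eq by (rule ex1I) (rule conjunct2)
qed

end

theorem theorem5p6:
  fixes \<Phi> :: "vec5 \<Rightarrow> vec5"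
    and p :: "int^3 \<Rightarrow> real^2"
    and c :: "int^3 \<Rightarrow> circle"
    and w d :: "int^3"
    and \<sigma>0 :: "int^3 \<Rightarrow> real"
  defines "d \<equiv> unit_shift 1 + unit_shift 2 + unit_shift 3"
  assumes "lie_plucker_isometry \<Phi>"
    and "fundamental_point_circle_complex p c"
    and "generic \<Phi> p c"
    and "w \<in> A2 (-1)"
    and "\<sigma>0 \<in> cauchy_circles w - {w} \<rightarrow> {-1, 1}"
  shows "(\<exists>!s. s \<in> {-1, 1} \<and> correlated \<Phi> (as_lie_circles p c (\<sigma>0(w := s))) w d) \<and>
    (\<forall>s\<in>{-1, 1}. correlated \<Phi> (as_lie_circles p c (\<sigma>0(w := s))) w d \<longrightarrow>
      (\<exists>!\<sigma>. \<sigma> \<in> orientations \<and> (\<forall>v\<in>cauchy_circles w. \<sigma> v = (\<sigma>0(w := s)) v) \<and>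
         fundamental_circle_complex \<Phi> (as_lie_circles p c \<sigma>)) \<and>
      (\<forall>\<sigma>. \<sigma> \<in> orientations \<and> (\<forall>v\<in>cauchy_circles w. \<sigma> v = (\<sigma>0(w := s)) v) \<longrightarrow>
         (fundamental_circle_complex \<Phi> (as_lie_circles p c \<sigma>) \<longleftrightarrow>
          all_opposite_correlated \<Phi> (as_lie_circles p c \<sigma>))))"
proof -
  interpret I: isometry \<Phi> by (rule isometry.intro) fact
  obtain J \<kappa> where "lie_model \<Phi> J \<kappa>" using I.model_exists by blast
  then interpret pattern \<Phi> J \<kappa> p c
    using assms(3,4) by (intro pattern.intro pattern_axioms.intro)
  have d: "d = main_diagonal" by (simp add: d_def main_diagonal_def unit_shift_vec3 vec3_eq_iff)
  have \<tau>: "(\<sigma>0(w := s)) v \<in> {-1, 1}" if "s \<in> {-1, 1}" "v \<in> cauchy_circles w" for s v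
    using assms(6) that by (auto simp: Pi_def)
  have start: "correlated \<Phi> (as_lie_circles p c (\<sigma>0(w := s))) w d \<longleftrightarrow> cube_good (\<sigma>0(w := s)) w" if "s \<in> {-1, 1}" for s
    unfolding d using assms(5) \<tau>[OF that] by (rule correlated_start)
  have 1: "\<exists>!s. s \<in> {-1, 1} \<and> correlated \<Phi> (as_lie_circles p c (\<sigma>0(w := s))) w d"
    using start_unique[OF assms(5,6)] start by (simp cong: conj_cong)
  have 2: "\<exists>!\<sigma>. \<sigma> \<in> orientations \<and> (\<forall>v\<in>cauchy_circles w. \<sigma> v = (\<sigma>0(w := s)) v) \<and>
         fundamental_circle_complex \<Phi> (as_lie_circles p c \<sigma>)"
    if "s \<in> {-1, 1}" "correlated \<Phi> (as_lie_circles p c (\<sigma>0(w := s))) w d" for s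
  proof -
    have "cube_good (\<sigma>0(w := s)) w" using start that by blast
    from cauchy_solution[OF assms(5) \<tau>[OF that(1)] this] show ?thesis using fundamental_iff by (simp cong: conj_cong)
  qed
  have 3: "fundamental_circle_complex \<Phi> (as_lie_circles p c \<sigma>) \<longleftrightarrow> all_opposite_correlated \<Phi> (as_lie_circles p c \<sigma>)"
    if "\<sigma> \<in> orientations" for \<sigma>
    using fundamental_iff[OF that] all_opposite_iff[OF that] by simp
  show ?thesis
    by (intro conjI ballI impI allI 1 2 3) (assumption | erule conjunct1)+
qed

end
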